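(* The following problem is decidable: given an entailment $\Pi\land\Sigma\vdash\{\exists\vec{y_i}(\Pi_i\land\Sigma_i)\}_{i\in I}$ of the symbolic-heap system with arrays (with $I$ finite) such that every array atomic formula occurring in each $\Sigma_i$ has the form $\mathrm{Arr}(t,t+u)$ where the term $u$ contains no variable of $\vec{y_i}$, decide whether it is valid, i.e. whether for all stores $s$ and heaps $h$, $s,h\models\Pi\land\Sigma$ implies $s,h\models\exists\vec{y_i}(\Pi_i\land\Sigma_i)$ for some $i\in I$.
   Context: Terms: $t::=x\mid 0\mid 1\mid 2\mid\cdots\mid t+t$ over variables $x$, interpreted in $N$. A store $s$ maps variables to $N$, extended to terms by $s(n)=n$, $s(t+u)=s(t)+s(u)$. A heap is a finite partial function $h$ from $N\setminus\{0\}$ to $N$. Pure formulas $\Pi$ are formulas of Presburger arithmetic (built from $t=t$, $\land$, $\neg$, $\exists$). Spatial formulas: $\Sigma::=\mathrm{Emp}\mid t\mapsto u\mid\mathrm{Arr}(t,u)\mid\Sigma*\Sigma$. Satisfaction: pure formulas hold iff true under $s$; $s,h\models\mathrm{Emp}$ iff $\mathrm{Dom}(h)=\emptyset$; $s,h\models t\mapsto u$ iff $\mathrm{Dom}(h)=\{s(t)\}$ and $h(s(t))=s(u)$; $s,h\models\mathrm{Arr}(t,u)$ iff $s(t)\le s(u)$ and $\mathrm{Dom}(h)=\{x\mid s(t)\le x\le s(u)\}$; $s,h\models F_1*F_2$ iff $h$ is the disjoint union of $h_1,h_2$ with $s,h_1\models F_1$, $s,h_2\models F_2$; $\land$ and $\exists$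 classical (for $\exists x$, the store is updated at $x$). *)

theory Defs
  imports Main "HOL-Library.Nat_Bijection"
begin

section \<open>Symbolic heaps with arrays\<close>

type_synonym var = nat

datatype tm = Var var | Num nat | Add tm tm

datatype pure = Eq tm tm | And pure pure | Neg pure | Ex var pure

datatype spatial = Emp | PointsTo tm tm | Arr tm tm | Sep spatial spatial

text \<open>\<open>Exists ys P S\<close> is the symbolic heap with the quantifier block \<open>ys\<close> (possibly empty) in front of
  the conjunction of \<open>P\<close> and \<open>S\<close>. The finite family on the right of an entailment is a list.\<close>

datatype symheap = Exists "var list" pure spatial

datatype entailment = Entails pure spatial "symheap list"

type_synonym store = "var \<Rightarrow> nat"
type_synonym heap = "nat \<rightharpoonup> nat"

definition is_heap :: "heap \<Rightarrow> bool" where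
  "is_heap h \<longleftrightarrow> finite (dom h) \<and> 0 \<notin> dom h"

fun tm_val :: "store \<Rightarrow> tm \<Rightarrow> nat" where
  "tm_val s (Var x) = s x"
| "tm_val s (Num n) = n"
| "tm_val s (Add t u) = tm_val s t + tm_val s u"

fun sat_pure :: "store \<Rightarrow> pure \<Rightarrow> bool" where
  "sat_pure s (Eq t u) \<longleftrightarrow> tm_val s t = tm_val s u"
| "sat_pure s (And P Q) \<longleftrightarrow> sat_pure s P \<and> sat_pure s Q"
| "sat_pure s (Neg P) \<longleftrightarrow> \<not> sat_pure s P"
| "sat_pure s (Ex x P) \<longleftrightarrow> (\<exists>a. sat_pure (s(x := a)) P)"

text \<open>In the case of \<open>Sep\<close> no \<open>is_heap\<close> condition on \<open>h1\<close>, \<open>h2\<close> is needed: it is inherited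
  from \<open>h\<close> by restrictions of \<open>h\<close>.\<close>

fun sat_spatial :: "store \<Rightarrow> heap \<Rightarrow> spatial \<Rightarrow> bool" where
  "sat_spatial s h Emp \<longleftrightarrow> dom h = {}"
| "sat_spatial s h (PointsTo t u) \<longleftrightarrow>
     dom h = {tm_val s t} \<and> h (tm_val s t) = Some (tm_val s u)"
| "sat_spatial s h (Arr t u) \<longleftrightarrow>
     tm_val s t \<le> tm_val s u \<and> dom h = {x. tm_val s t \<le> x \<and> x \<le> tm_val s u}"
| "sat_spatial s h (Sep S T) \<longleftrightarrow>
     (\<exists>h1 h2. dom h1 \<inter> dom h2 = {} \<and> h = h1 ++ h2 \<and> sat_spatial s h1 S \<and> sat_spatial s h2 T)"

fun sat_exs :: "store \<Rightarrow> heap \<Rightarrow> var list \<Rightarrow> pure \<Rightarrow> spatial \<Rightarrow> bool" where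
  "sat_exs s h [] P S \<longleftrightarrow> sat_pure s P \<and> sat_spatial s h S"
| "sat_exs s h (y # ys) P S \<longleftrightarrow> (\<exists>a. sat_exs (s(y := a)) h ys P S)"

fun sat_symheap :: "store \<Rightarrow> heap \<Rightarrow> symheap \<Rightarrow> bool" where
  "sat_symheap s h (Exists ys P S) \<longleftrightarrow> sat_exs s h ys P S"

fun valid :: "entailment \<Rightarrow> bool" where
  "valid (Entails P S Ds) \<longleftrightarrow>
     (\<forall>s h. is_heap h \<longrightarrow> sat_pure s P \<and> sat_spatial s h S \<longrightarrow> (\<exists>D\<in>set Ds. sat_symheap s h D))"

fun tm_vars :: "tm \<Rightarrow> var set" where
  "tm_vars (Var x) = {x}"
| "tm_vars (Num n) = {}"
| "tm_vars (Add t u) = tm_vars t \<union> tm_vars u"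

text \<open>The pairs \<open>(t, v)\<close> such that \<open>Arr t v\<close> occurs in the formula.\<close>

fun arrays :: "spatial \<Rightarrow> (tm \<times> tm) set" where
  "arrays Emp = {}"
| "arrays (PointsTo t u) = {}"
| "arrays (Arr t u) = {(t, u)}"
| "arrays (Sep S T) = arrays S \<union> arrays T"

fun restricted_symheap :: "symheap \<Rightarrow> bool" where
  "restricted_symheap (Exists ys P S) \<longleftrightarrow>
     (\<forall>(t, v)\<in>arrays S. \<exists>u. v = Add t u \<and> tm_vars u \<inter> set ys = {})"

text \<open>The left-hand side of the entailment is not restricted.\<close>

fun restricted :: "entailment \<Rightarrow> bool" where
  "restricted (Entails P S Ds) \<longleftrightarrow> (\<forall>D\<in>set Ds. restricted_symheap D)"


section \<open>Decidability\<close>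

text \<open>Kleene's partial recursive functions: programs and their (partial) input-output relation.
  \<open>PrimRec f g\<close> recurses on the first argument; its step function \<open>g\<close> receives the counter, the
  previous value and the parameters.\<close>

datatype recf = Zero | Succ | Proj nat | Comp recf "recf list" | PrimRec recf recf | Mu recf

inductive computes :: "recf \<Rightarrow> nat list \<Rightarrow> nat \<Rightarrow> bool" where
  Zero: "computes Zero xs 0"
| Succ: "computes Succ [x] (Suc x)"
| Proj: "i < length xs \<Longrightarrow> computes (Proj i) xs (xs ! i)"
| Comp: "list_all2 (\<lambda>g y. computes g xs y) gs ys \<Longrightarrow> computes f ys z \<Longrightarrow> computes (Comp f gs) xs z"
| PrimRec_0: "computes f xs z \<Longrightarrow> computes (PrimRec f g) (0 # xs) z"
| PrimRec_Suc: "computes (PrimRec f g) (n # xs) r \<Longrightarrow> computes g (n # r # xs) z \<Longrightarrow>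
    computes (PrimRec f g) (Suc n # xs) z"
| Mu: "computes f (n # xs) 0 \<Longrightarrow> (\<forall>m<n. \<exists>k. computes f (m # xs) (Suc k)) \<Longrightarrow>
    computes (Mu f) xs n"

lemma computes_deterministic: "computes f xs y \<Longrightarrow> computes f xs z \<Longrightarrow> y = z"
proof (induction arbitrary: z rule: computes.induct)
  case (Zero xs)
  then show ?case by (auto elim: computes.cases)
next
  case (Succ x)
  then show ?case by (auto elim: computes.cases)
next
  case (Proj i xs)
  from Proj.prems show ?case by (auto elim: computes.cases)
next
  case (Comp xs gs ys f z')
  from Comp.prems obtain ys' where
    ys': "list_all2 (\<lambda>g y. computes g xs y) gs ys'" and f: "computes f ys' z"
    by (auto elim: computes.cases)
  have "ys = ys'"
    using Comp.IH(1) ys' by (auto simp: list_all2_conv_all_nth intro!: nth_equalityI)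
  with Comp.IH(2) f show ?case by simp
next
  case (PrimRec_0 f xs y g)
  from PrimRec_0.prems have "computes f xs z" by (auto elim: computes.cases)
  then show ?case by (rule PrimRec_0.IH)
next
  case (PrimRec_Suc f g n xs r y)
  from PrimRec_Suc.prems obtain r' where "computes (PrimRec f g) (n # xs) r'" "computes g (n # r' # xs) z"
    by (auto elim: computes.cases)
  with PrimRec_Suc.IH show ?case by blast
next
  case (Mu f n xs)
  from Mu.prems have z: "computes f (z # xs) 0" "\<forall>m<z. \<exists>k. computes f (m # xs) (Suc k)"
    by (auto elim: computes.cases)
  show ?case
  proof (cases n z rule: linorder_cases)
    case less
    then obtain k where "computes f (n # xs) (Suc k)" using z by blast
    with Mu.IH(1) show ?thesis by blast
  next
    case greater
    then show ?thesis using Mu.IH(2) z(1) by blast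
  qed
qed

definition decidable :: "nat set \<Rightarrow> bool" where
  "decidable A \<longleftrightarrow> (\<exists>f. \<forall>n. computes f [n] (if n \<in> A then 1 else 0))"


section \<open>Encoding of entailments as numbers\<close>

fun code_tm :: "tm \<Rightarrow> nat" where
  "code_tm (Var x) = prod_encode (0, x)"
| "code_tm (Num n) = prod_encode (1, n)"
| "code_tm (Add t u) = prod_encode (2, prod_encode (code_tm t, code_tm u))"

fun code_pure :: "pure \<Rightarrow> nat" where
  "code_pure (Eq t u) = prod_encode (0, prod_encode (code_tm t, code_tm u))"
| "code_pure (And P Q) = prod_encode (1, prod_encode (code_pure P, code_pure Q))"
| "code_pure (Neg P) = prod_encode (2, code_pure P)"
| "code_pure (Ex x P) = prod_encode (3, prod_encode (x, code_pure P))"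

fun code_spatial :: "spatial \<Rightarrow> nat" where
  "code_spatial Emp = prod_encode (0, 0)"
| "code_spatial (PointsTo t u) = prod_encode (1, prod_encode (code_tm t, code_tm u))"
| "code_spatial (Arr t u) = prod_encode (2, prod_encode (code_tm t, code_tm u))"
| "code_spatial (Sep S T) = prod_encode (3, prod_encode (code_spatial S, code_spatial T))"

fun code_symheap :: "symheap \<Rightarrow> nat" where
  "code_symheap (Exists ys P S) =
     prod_encode (list_encode ys, prod_encode (code_pure P, code_spatial S))"

fun code_entailment :: "entailment \<Rightarrow> nat" where
  "code_entailment (Entails P S Ds) =
     prod_encode (prod_encode (code_pure P, code_spatial S), list_encode (map code_symheap Ds))"

lemma code_tm_inject: "code_tm t = code_tm u \<Longrightarrow> t = u"
proof (induction t arbitrary: u)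
  case (Var x) then show ?case by (cases u) auto
next
  case (Num x) then show ?case by (cases u) auto
next
  case (Add t1 t2) then show ?case by (cases u) auto
qed

lemma code_pure_inject: "code_pure P = code_pure Q \<Longrightarrow> P = Q"
proof (induction P arbitrary: Q)
  case (Eq t u) then show ?case by (cases Q) (auto dest: code_tm_inject)
next
  case (And P1 P2) then show ?case by (cases Q) auto
next
  case (Neg P) then show ?case by (cases Q) auto
next
  case (Ex x P) then show ?case by (cases Q) auto
qed

lemma code_spatial_inject: "code_spatial S = code_spatial T \<Longrightarrow> S = T"
proof (induction S arbitrary: T)
  case Emp then show ?case by (cases T) auto
next
  case (PointsTo t u) then show ?case by (cases T) (auto dest: code_tm_inject)
next
  case (Arr t u) then show ?case by (cases T) (auto dest: code_tm_inject)
next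
  case (Sep S1 S2) then show ?case by (cases T) auto
qed

lemma code_symheap_inject: "code_symheap D = code_symheap E \<Longrightarrow> D = E"
  by (cases D; cases E) (auto simp: list_encode_eq dest: code_pure_inject code_spatial_inject)

lemma inj_code_entailment: "inj code_entailment"
proof (rule injI)
  fix E F assume "code_entailment E = code_entailment F"
  moreover have "inj code_symheap" by (rule injI) (rule code_symheap_inject)
  ultimately show "E = F"
    by (cases E; cases F) (auto dest: code_pure_inject code_spatial_inject simp: list_encode_eq inj_map_eq_map)
qed

end

(* Validity is decided by a bounded search for a countermodel.

   Fix a store s and a heap h satisfying the left-hand side. The domain of h is a union of intervals
   depending on s only. In every disjunct on the right the lengths of all atoms are determined by s
   alone, because no array length mentions a bound variable. As the atoms tile the domain, each
   address on the right is an endpoint of the left-hand side plus a sum of such lengths, that is, one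
   of finitely many linear forms in s. So only the contents of finitely many cells matter, and they
   can be treated as further variables.

   Presburger formulas are handled by an Ehrenfeucht-Fraisse argument in place of quantifier
   elimination: two stores are N-equivalent if all linear forms with coefficients at most N have the
   same sign and the variables agree modulo N!. If the stores are equivalent at a sufficiently larger
   level, every value of a variable in one is answered by a bounded value in the other. This bounds
   the countermodels, the witnesses of the quantifier blocks, and the quantifiers of pure formulas by
   computable functions of the size of the entailment. *)

theory Submission imports Defs
begin


section \<open>Computable functions\<close>

text \<open>A countermodel must defeat every choice of witnesses on the right, so the equivalence is
  used in both directions. It carries the left-hand side from a given countermodel to a small one,
  and it carries a disjunct true in the small model back to the given one, where none holds. Applied
  to a store and itself, it bounds witnesses.

  A quantifier block may rebind variables that occur on the left, while addresses are forms in their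
  original values. So the store is kept twice, and the second copy survives the block.

  Residues modulo \<open>fact N\<close> are needed because a new variable may carry a coefficient:
  comparisons determine a multiple of it, and the answer must be divisible back.

  All sizes are measured by one number \<open>n\<close>, in the end the code of the entailment. It
  bounds the codes of all parts, hence variable indices, constants, block lengths and quantifier
  depths. Coefficients of addresses are at most \<open>2 * n + 1\<close>: one start on the left,
  with coefficients up to \<open>n + 1\<close>, plus lengths on the right, with coefficients up to
  \<open>n\<close> in total.\<close>

definition pfst :: "nat \<Rightarrow> nat" where "pfst z = fst (prod_decode z)"
definition psnd :: "nat \<Rightarrow> nat" where "psnd z = snd (prod_decode z)"

lemma pfst_pair [simp]: "pfst (prod_encode (a, b)) = a"
  and psnd_pair [simp]: "psnd (prod_encode (a, b)) = b"
  by (simp_all add: pfst_def psnd_def)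

lemma pair_surj [simp]: "prod_encode (pfst z, psnd z) = z"
  by (simp add: pfst_def psnd_def)

lemma psnd_le: "psnd z \<le> z" and pfst_le: "pfst z \<le> z"
  by (metis pair_surj le_prod_encode_2, metis pair_surj le_prod_encode_1)

lemma add_le_prod_encode: "a + b \<le> prod_encode (a, b)"
proof -
  have "k \<le> triangle k" for k by (induction k) auto
  from this[of "a + b"] show ?thesis by (simp add: prod_encode_def)
qed

lemma less_prod_encode: "0 < a \<Longrightarrow> b < prod_encode (a, b)"
  using add_le_prod_encode[of a b] by simp

lemma psnd_less: "0 < pfst z \<Longrightarrow> psnd z < z"
  using less_prod_encode[of "pfst z" "psnd z"] by simp

definition computable :: "(nat \<Rightarrow> nat) \<Rightarrow> bool" where
  "computable f \<longleftrightarrow> (\<exists>p. \<forall>x. computes p [x] (f x))"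

definition computable2 :: "(nat \<Rightarrow> nat \<Rightarrow> nat) \<Rightarrow> bool" where
  "computable2 f \<longleftrightarrow> (\<exists>p. \<forall>x y. computes p [x, y] (f x y))"

lemma computes_Comp1:
  "computes g xs a \<Longrightarrow> computes f [a] z \<Longrightarrow> computes (Comp f [g]) xs z"
  by (rule computes.Comp[where ys = "[a]"]) auto

lemma computes_Comp2:
  "computes g xs a \<Longrightarrow> computes g' xs b \<Longrightarrow> computes f [a, b] z \<Longrightarrow> computes (Comp f [g, g']) xs z"
  by (rule computes.Comp[where ys = "[a, b]"]) auto

lemma computes_Proj: "i < length xs \<Longrightarrow> z = xs ! i \<Longrightarrow> computes (Proj i) xs z"
  by (simp add: computes.Proj)

lemma computable_comp: "computable f \<Longrightarrow> computable a \<Longrightarrow> computable (\<lambda>x. f (a x))"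
  unfolding computable_def by (blast intro: computes_Comp1)

lemma computable_comp2:
  "computable2 f \<Longrightarrow> computable a \<Longrightarrow> computable b \<Longrightarrow> computable (\<lambda>x. f (a x) (b x))"
  unfolding computable_def computable2_def by (blast intro: computes_Comp2)

lemma computable2_comp: "computable f \<Longrightarrow> computable2 a \<Longrightarrow> computable2 (\<lambda>x y. f (a x y))"
  unfolding computable_def computable2_def by (blast intro: computes_Comp1)

lemma computable2_comp2:
  "computable2 f \<Longrightarrow> computable2 a \<Longrightarrow> computable2 b \<Longrightarrow> computable2 (\<lambda>x y. f (a x y) (b x y))"
proof -
  assume "computable2 f" "computable2 a" "computable2 b"
  then obtain p q r where p: "\<And>x y. computes p [x, y] (f x y)"
    and q: "\<And>x y. computes q [x, y] (a x y)" and r: "\<And>x y. computes r [x, y] (b x y)"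
    unfolding computable2_def by blast
  have "computes (Comp p [q, r]) [x, y] (f (a x y) (b x y))" for x y
    by (rule computes_Comp2[OF q r p])
  then show ?thesis unfolding computable2_def by blast
qed

lemma computable2_fst: "computable2 (\<lambda>x y. x)"
  unfolding computable2_def by (rule exI[where x = "Proj 0"]) (simp add: computes_Proj)

lemma computable2_snd: "computable2 (\<lambda>x y. y)"
  unfolding computable2_def by (rule exI[where x = "Proj 1"]) (simp add: computes_Proj)

lemma computable2_rec:
  assumes f: "computable f" and g: "computable2 g"
  shows "computable2 (\<lambda>n x. rec_nat (f x) (\<lambda>_ r. g r x) n)"
proof -
  from f g obtain p q where p: "\<And>x. computes p [x] (f x)" and q: "\<And>x y. computes q [x, y] (g x y)"
    unfolding computable_def computable2_def by blast
  have "computes (PrimRec p (Comp q [Proj 1, Proj 2])) [n, x] (rec_nat (f x) (\<lambda>_ r. g r x) n)" for n x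
  proof (induction n)
    case 0 show ?case using p by (simp add: PrimRec_0)
  next
    case (Suc n) then show ?case
      by (rule computes.PrimRec_Suc) (auto intro!: computes_Comp2 computes_Proj intro: q)
  qed
  then show ?thesis unfolding computable2_def by blast
qed

lemma computable_rec:
  assumes g: "computable2 g"
  shows "computable (\<lambda>n. rec_nat 0 (\<lambda>n r. g n r) n)"
proof -
  from g obtain q where q: "\<And>x y. computes q [x, y] (g x y)" unfolding computable2_def by blast
  have "computes (PrimRec Zero q) [n] (rec_nat 0 (\<lambda>n r. g n r) n)" for n
    by (induction n) (auto intro: computes.intros q)
  then show ?thesis unfolding computable_def by blast
qed

lemma computable_Suc: "computable a \<Longrightarrow> computable (\<lambda>x. Suc (a x))"
  by (rule computable_comp[of Suc]) (auto simp: computable_def intro: computes.Succ)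

lemma computable_id: "computable (\<lambda>x. x)"
  unfolding computable_def by (rule exI[where x = "Proj 0"]) (simp add: computes_Proj)

lemma computable_const: "computable (\<lambda>x. c)"
proof (induction c)
  case 0 show ?case unfolding computable_def by (blast intro: computes.Zero)
qed (rule computable_Suc)

lemma computable2_Suc: "computable2 a \<Longrightarrow> computable2 (\<lambda>x y. Suc (a x y))"
  by (rule computable2_comp[OF computable_Suc[OF computable_id]])

lemma computable2_add: "computable2 (+)"
proof -
  have "(\<lambda>n x. rec_nat x (\<lambda>_ r. Suc r) n) = (+)"
    by (intro ext, rename_tac n x, induct_tac n) auto
  with computable2_rec[OF computable_id computable2_Suc[OF computable2_fst]] show ?thesis by simp
qed

lemma computable2_mult: "computable2 (*)"
proof -
  have "(\<lambda>n x. rec_nat 0 (\<lambda>_ r. r + x) n) = (*)"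
    by (intro ext, rename_tac n x, induct_tac n) auto
  with computable2_rec[OF computable_const[of 0] computable2_add] show ?thesis by simp
qed

lemma computable_pred: "computable (\<lambda>n. n - 1)"
proof -
  have "(\<lambda>n. rec_nat 0 (\<lambda>n r. n) n) = (\<lambda>n. n - 1)"
    by (intro ext, rename_tac n, case_tac n) auto
  with computable_rec[OF computable2_fst] show ?thesis by simp
qed

lemma computable2_diff: "computable2 (-)"
proof -
  have "(\<lambda>n x. rec_nat x (\<lambda>_ r. r - 1) n) = (\<lambda>n x. x - n)"
    by (intro ext, rename_tac n x, induct_tac n) auto
  with computable2_rec[OF computable_id computable2_comp[OF computable_pred computable2_fst]]
  have "computable2 (\<lambda>n x. x - n)" by simp
  from computable2_comp2[OF this computable2_snd computable2_fst] show ?thesis by simp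
qed

lemma computable_triangle: "computable triangle"
proof -
  have "(\<lambda>n. rec_nat 0 (\<lambda>n r. Suc n + r) n) = triangle"
    by (intro ext, rename_tac n, induct_tac n) auto
  with computable_rec[OF computable2_comp2[OF computable2_add computable2_Suc[OF computable2_fst] computable2_snd]]
  show ?thesis by simp
qed

lemma computable2_pair: "computable2 (\<lambda>x y. prod_encode (x, y))"
  unfolding prod_encode_def prod.case
  by (intro computable2_comp2[OF computable2_add] computable2_comp[OF computable_triangle]
      computable2_fst computable2_snd)

text \<open>The hypothesis \<open>ex\<close> keeps minimisation total, as \<open>computable\<close>
  demands. The searched argument comes first because \<open>Mu\<close> prepends it.\<close>

lemma computable2_Least:
  assumes f: "computable2 f" and ex: "\<And>x. \<exists>y. f y x = 0"
  shows "computable (\<lambda>x. LEAST y. f y x = 0)"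
proof -
  from f obtain p where p: "\<And>x y. computes p [x, y] (f x y)" unfolding computable2_def by blast
  have "computes (Mu p) [x] (LEAST y. f y x = 0)" for x
  proof (rule computes.Mu)
    show "computes p [LEAST y. f y x = 0, x] 0"
      using p[of "LEAST y. f y x = 0" x] LeastI_ex[OF ex[of x]] by simp
    show "\<forall>m<LEAST y. f y x = 0. \<exists>k. computes p [m, x] (Suc k)"
      using p not_less_Least[where P = "\<lambda>y. f y x = 0"] by (metis not0_implies_Suc)
  qed
  then show ?thesis unfolding computable_def by blast
qed

named_theorems comp_intros

lemmas [comp_intros] = computable_id computable_const computable_Suc
  computable_comp2[OF computable2_add] computable_comp2[OF computable2_mult]
  computable_comp2[OF computable2_diff] computable_comp2[OF computable2_pair]

text \<open>The diagonal of a pair is the least \<open>k\<close> with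
  \<open>z < triangle (Suc k)\<close>. The truncated difference puts this as a test for zero, the
  form that minimisation can search.\<close>

lemma unpair_Least:
  shows "pfst z = z - triangle (LEAST k. Suc z - triangle (Suc k) = 0)"
    and "psnd z = (LEAST k. Suc z - triangle (Suc k) = 0) - pfst z"
proof -
  let ?a = "pfst z" and ?b = "psnd z"
  have "prod_encode (?a, ?b) = z" by simp
  then have z: "z = triangle (?a + ?b) + ?a" by (simp add: prod_encode_def)
  have mono: "i \<le> j \<Longrightarrow> triangle i \<le> triangle j" for i j
    by (rule lift_Suc_mono_le[of triangle]) auto
  have "(LEAST k. Suc z - triangle (Suc k) = 0) = ?a + ?b"
  proof (rule Least_equality)
    show "Suc z - triangle (Suc (?a + ?b)) = 0" using z by simp
    fix k assume "Suc z - triangle (Suc k) = 0"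
    then have "z < triangle (Suc k)" by simp
    with z have "triangle (?a + ?b) < triangle (Suc k)" by simp
    with mono[of "Suc k" "?a + ?b"] show "?a + ?b \<le> k" by (meson not_less not_less_eq_eq order.refl)
  qed
  with z show "?a = z - triangle (LEAST k. Suc z - triangle (Suc k) = 0)"
    "?b = (LEAST k. Suc z - triangle (Suc k) = 0) - ?a" by (simp_all only: diff_add_inverse)
qed

lemma computable_pfst_psnd: "computable pfst" "computable psnd"
proof -
  let ?k = "\<lambda>z. LEAST k. Suc z - triangle (Suc k) = 0"
  have ex: "\<exists>k. Suc z - triangle (Suc k) = 0" for z
  proof -
    have "k \<le> triangle k" for k by (induction k) auto
    from this[of "Suc z"] show ?thesis by (metis diff_is_0_eq)
  qed
  have k: "computable ?k"
    by (rule computable2_Least)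
       (intro computable2_comp2[OF computable2_diff] computable2_comp[OF computable_triangle]
          computable2_Suc computable2_fst computable2_snd, rule ex)
  have "computable (\<lambda>z. z - triangle (?k z))"
    by (intro comp_intros computable_comp[OF computable_triangle] k)
  moreover have "pfst = (\<lambda>z. z - triangle (?k z))" by (intro ext unpair_Least)
  ultimately show 2: "computable pfst" by (simp only:)
  from 2 k have "computable (\<lambda>z. ?k z - pfst z)" by (intro comp_intros)
  moreover have "psnd = (\<lambda>z. ?k z - pfst z)" by (intro ext unpair_Least)
  ultimately show "computable psnd" by (simp only:)
qed

lemmas [comp_intros] = computable_comp[OF computable_pfst_psnd(1)] computable_comp[OF computable_pfst_psnd(2)]

lemma computable_curry:
  assumes "computable (\<lambda>z. f (pfst z) (psnd z))"
  shows "computable2 f"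
  using computable2_comp[OF assms computable2_pair] by simp

section \<open>Decidable predicates and bounded quantifiers\<close>

definition dec :: "(nat \<Rightarrow> bool) \<Rightarrow> bool" where
  "dec P \<longleftrightarrow> computable (\<lambda>x. of_bool (P x))"

lemma dec_not [comp_intros]: "dec P \<Longrightarrow> dec (\<lambda>x. \<not> P x)"
proof -
  assume "dec P"
  then have "computable (\<lambda>x. 1 - of_bool (P x))" unfolding dec_def by (intro comp_intros)
  moreover have "(1::nat) - of_bool b = of_bool (\<not> b)" for b by (cases b) auto
  ultimately show ?thesis unfolding dec_def by (simp only:)
qed

lemma dec_and [comp_intros]: "dec P \<Longrightarrow> dec Q \<Longrightarrow> dec (\<lambda>x. P x \<and> Q x)"
  unfolding dec_def of_bool_conj by (intro comp_intros)

lemma dec_or [comp_intros]: "dec P \<Longrightarrow> dec Q \<Longrightarrow> dec (\<lambda>x. P x \<or> Q x)"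
  using dec_not[OF dec_and[OF dec_not[of P] dec_not[of Q]]] by simp

lemma dec_imp [comp_intros]: "dec P \<Longrightarrow> dec Q \<Longrightarrow> dec (\<lambda>x. P x \<longrightarrow> Q x)"
  unfolding imp_conv_disj by (rule dec_or[OF dec_not])

lemma dec_le [comp_intros]: "computable a \<Longrightarrow> computable b \<Longrightarrow> dec (\<lambda>x. a x \<le> b x)"
proof -
  assume "computable a" "computable b"
  then have "computable (\<lambda>x. 1 - (a x - b x))" by (intro comp_intros)
  moreover have "1 - (a x - b x) = of_bool (a x \<le> b x)" for x by auto
  ultimately show ?thesis unfolding dec_def by (simp only:)
qed

lemma dec_less [comp_intros]: "computable a \<Longrightarrow> computable b \<Longrightarrow> dec (\<lambda>x. a x < b x)"
  unfolding less_eq_Suc_le by (intro comp_intros)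

lemma dec_eq [comp_intros]: "computable a \<Longrightarrow> computable b \<Longrightarrow> dec (\<lambda>x. a x = b x)"
  unfolding eq_iff by (intro comp_intros)

lemma computable_of_bool [comp_intros]: "dec P \<Longrightarrow> computable (\<lambda>x. of_bool (P x))"
  by (simp add: dec_def)

lemma computable_if [comp_intros]:
  assumes "dec P" "computable a" "computable b"
  shows "computable (\<lambda>x. if P x then a x else b x)"
proof -
  have "computable (\<lambda>x. of_bool (P x) * a x + of_bool (\<not> P x) * b x)"
    using assms by (intro comp_intros)
  moreover have "of_bool (P x) * a x + of_bool (\<not> P x) * b x = (if P x then a x else b x)" for x by simp
  ultimately show ?thesis by (simp only:)
qed

lemma computable_Least:
  assumes P: "dec (\<lambda>z. P (pfst z) (psnd z))" and ex: "\<And>x. \<exists>y. P x y"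
  shows "computable (\<lambda>x. LEAST y. P x y)"
proof -
  have "computable (\<lambda>z. of_bool (\<not> P (psnd z) (pfst z)))"
  proof -
    have "computable (\<lambda>z. prod_encode (psnd z, pfst z))" by (intro comp_intros)
    from computable_comp[OF P[unfolded dec_def] this] show ?thesis
      by (intro computable_of_bool dec_not) (simp add: dec_def)
  qed
  from computable2_Least[OF computable_curry[OF this]] ex show ?thesis by simp
qed

text \<open>The least \<open>y\<close> that reaches \<open>b x\<close> or violates \<open>P\<close>
  always exists, since \<open>b x\<close> qualifies. It is at least \<open>b x\<close> exactly when
  no violation precedes \<open>b x\<close>.\<close>

lemma dec_all_less [comp_intros]:
  assumes b: "computable b" and P: "dec (\<lambda>z. P (pfst z) (psnd z))"
  shows "dec (\<lambda>x. \<forall>y<b x. P x y)"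
proof -
  let ?m = "\<lambda>x. LEAST y. b x \<le> y \<or> \<not> P x y"
  have "computable ?m"
  proof (rule computable_Least)
    have "computable (\<lambda>z. b (pfst z))" by (rule computable_comp[OF b]) (intro comp_intros)
    then show "dec (\<lambda>z. b (pfst z) \<le> psnd z \<or> \<not> P (pfst z) (psnd z))" by (intro comp_intros P)
    show "\<exists>y. b x \<le> y \<or> \<not> P x y" for x by (rule exI[where x = "b x"]) simp
  qed
  then have "dec (\<lambda>x. b x \<le> ?m x)" using b by (intro comp_intros)
  moreover have "b x \<le> ?m x \<longleftrightarrow> (\<forall>y<b x. P x y)" for x
  proof
    assume b: "b x \<le> ?m x"
    show "\<forall>y<b x. P x y"
    proof (intro allI impI)
      fix y assume "y < b x"
      with b have "y < ?m x" by (rule less_le_trans[rotated])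
      from not_less_Least[OF this] show "P x y" by simp
    qed
  next
    assume a: "\<forall>y<b x. P x y"
    have "b x \<le> ?m x \<or> \<not> P x (?m x)" by (rule LeastI[of _ "b x"]) simp
    with a show "b x \<le> ?m x" by (metis not_less)
  qed
  ultimately show ?thesis by (simp only:)
qed

lemma dec_ex_less [comp_intros]:
  "computable b \<Longrightarrow> dec (\<lambda>z. P (pfst z) (psnd z)) \<Longrightarrow> dec (\<lambda>x. \<exists>y<b x. P x y)"
  using dec_not[OF dec_all_less[OF _ dec_not, of b P]] by simp

lemma decidableI: "dec (\<lambda>n. n \<in> A) \<Longrightarrow> decidable A"
  unfolding dec_def computable_def decidable_def by (simp add: of_bool_def)

section \<open>Coded sequences and course-of-values recursion\<close>

text \<open>Every number codes an infinite sequence by repeated unpairing. No length is stored: a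
  finite sequence is represented by any code with the right initial entries.\<close>

primrec get :: "nat \<Rightarrow> nat \<Rightarrow> nat" where
  "get c 0 = pfst c"
| "get c (Suc i) = get (psnd c) i"

lemma computable_get [comp_intros]: "computable a \<Longrightarrow> computable b \<Longrightarrow> computable (\<lambda>x. get (a x) (b x))"
proof -
  assume ab: "computable a" "computable b"
  have "(\<lambda>i c. pfst (rec_nat c (\<lambda>_. psnd) i)) = (\<lambda>i c. get c i)"
  proof (intro ext)
    fix i c
    \<comment> \<open>\<open>get\<close> unpairs its argument before recursing,
      \<open>rec_nat\<close> after; the two orders agree.\<close>
    have r: "rec_nat (psnd c) (\<lambda>_. psnd) i = psnd (rec_nat c (\<lambda>_. psnd) i)" for i c
      by (induction i) auto
    show "pfst (rec_nat c (\<lambda>_. psnd) i) = get c i"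
      by (induction i arbitrary: c) (auto simp flip: r)
  qed
  moreover have "computable2 (\<lambda>i c. pfst (rec_nat c (\<lambda>_. psnd) i))"
    by (intro computable2_comp[OF computable_pfst_psnd(1)] computable2_rec computable_id
        computable2_comp[OF computable_pfst_psnd(2)] computable2_fst)
  ultimately have "computable2 (\<lambda>i c. get c i)" by simp
  from computable_comp2[OF this] ab show ?thesis by simp
qed

text \<open>Iterated pairing of \<open>k\<close> copies of \<open>b\<close>, with \<open>Suc\<close>
  for strictness. Pairing is monotone, so this exceeds some code of each sequence of
  \<open>k\<close> entries at most \<open>b\<close>; quantifiers over stores and heaps thereby
  become bounded.\<close>

primrec seq_bound :: "nat \<Rightarrow> nat \<Rightarrow> nat" where
  "seq_bound b 0 = 1"
| "seq_bound b (Suc k) = Suc (prod_encode (b, seq_bound b k))"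

lemma prod_encode_mono: "a \<le> a' \<Longrightarrow> b \<le> b' \<Longrightarrow> prod_encode (a, b) \<le> prod_encode (a', b')"
proof -
  have "i \<le> j \<Longrightarrow> triangle i \<le> triangle j" for i j
    by (rule lift_Suc_mono_le[of triangle]) auto
  moreover assume "a \<le> a'" "b \<le> b'"
  ultimately show ?thesis by (simp add: prod_encode_def add_mono)
qed

lemma ex_code_bounded:
  "(\<And>i. i < k \<Longrightarrow> f i \<le> b) \<Longrightarrow> \<exists>c<seq_bound b k. \<forall>i<k. get c i = f i"
proof (induction k arbitrary: f)
  case 0 show ?case by (auto intro: exI[of _ 0])
next
  case (Suc k)
  from Suc.IH[of "\<lambda>i. f (Suc i)"] Suc.prems obtain c
    where c: "c < seq_bound b k" "\<forall>i<k. get c i = f (Suc i)" by auto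
  have "prod_encode (f 0, c) < seq_bound b (Suc k)"
    using prod_encode_mono[of "f 0" b c "seq_bound b k"] Suc.prems[of 0] c(1) by simp
  moreover have "\<forall>i<Suc k. get (prod_encode (f 0, c)) i = f i"
    using c(2) by (auto simp: less_Suc_eq_0_disj)
  ultimately show ?case by blast
qed

lemma ex_code: "\<exists>c. \<forall>i<k. get c i = f i"
proof -
  have "f i \<le> (\<Sum>i<k. f i)" if "i < k" for i
    using that by (intro member_le_sum) auto
  from ex_code_bounded[of k f, OF this] show ?thesis by blast
qed

text \<open>The history of earlier values is not built up but searched for: the least
  \<open>H\<close> whose first entries satisfy the recursion \<open>G\<close> relative to
  \<open>H\<close> itself. Since \<open>G\<close> is correct at \<open>q\<close> as soon as the
  entries below \<open>q\<close> are, induction shows that any such \<open>H\<close> lists the true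
  values.\<close>

lemma computable_course:
  assumes step: "\<And>x p H. (\<And>q. q < p \<Longrightarrow> get H q = f x q) \<Longrightarrow> f x p = G x p H"
    and G: "computable (\<lambda>z. G (pfst z) (pfst (psnd z)) (psnd (psnd z)))"
    and a: "computable a" and b: "computable b"
  shows "computable (\<lambda>z. f (a z) (b z))"
proof -
  let ?H = "\<lambda>z. LEAST H. \<forall>q<Suc (psnd z). get H q = G (pfst z) q H"
  have ex: "\<exists>H. \<forall>q<Suc p. get H q = G x q H" for x p
  proof -
    obtain H where H: "\<forall>q<Suc p. get H q = f x q" using ex_code by blast
    then have "f x q = G x q H" if "q < Suc p" for q using that by (intro step) simp
    with H have "\<forall>q<Suc p. get H q = G x q H" by simp
    then show ?thesis by blast
  qed
  have eq: "get H p = f x p" if "\<forall>q<Suc p. get H q = G x q H" for H x p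
  proof -
    have "q < Suc p \<longrightarrow> get H q = f x q" for q
    proof (induction q rule: less_induct)
      case (less q)
      then have "q < Suc p \<Longrightarrow> f x q = G x q H" by (intro step) simp
      with that show ?case by simp
    qed
    then show ?thesis by simp
  qed
  have "computable ?H"
  proof (rule computable_Least, intro comp_intros)
    show "computable (\<lambda>z. G (pfst (pfst (pfst z))) (psnd z) (psnd (pfst z)))"
    proof -
      have "computable (\<lambda>z. prod_encode (pfst (pfst (pfst z)), prod_encode (psnd z, psnd (pfst z))))"
        by (intro comp_intros)
      from computable_comp[OF G this] show ?thesis by simp
    qed
  qed (rule ex)
  then have "computable (\<lambda>z. ?H (prod_encode (a z, b z)))"
    by (rule computable_comp) (intro comp_intros a b)
  then have "computable (\<lambda>z. get (?H (prod_encode (a z, b z))) (b z))"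
    by (intro computable_get b)
  moreover have "get (?H (prod_encode (a z, b z))) (b z) = f (a z) (b z)" for z
    using LeastI_ex[OF ex[of "b z" "a z"]] by (intro eq) simp
  ultimately show ?thesis by simp
qed

lemma computable_primrec:
  assumes "\<And>x. f x 0 = g x" "\<And>x k. f x (Suc k) = h x k (f x k)"
    and "computable g" "computable (\<lambda>z. h (pfst z) (pfst (psnd z)) (psnd (psnd z)))"
    and "computable a" "computable b"
  shows "computable (\<lambda>z. f (a z) (b z))"
proof (rule computable_course[where f = f and a = a and b = b and
      G = "\<lambda>x p H. if p = 0 then g x else h x (p - 1) (get H (p - 1))"])
  show "f x p = (if p = 0 then g x else h x (p - 1) (get H (p - 1)))"
    if "\<And>q. q < p \<Longrightarrow> get H q = f x q" for x p H
    using that assms(1,2) by (cases p) auto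
  have "computable (\<lambda>z. h (pfst z) (pfst (psnd z) - 1) (get (psnd (psnd z)) (pfst (psnd z) - 1)))"
  proof -
    have "computable (\<lambda>z. prod_encode (pfst z, prod_encode (pfst (psnd z) - 1,
        get (psnd (psnd z)) (pfst (psnd z) - 1))))"
      by (intro comp_intros)
    from computable_comp[OF assms(4) this] show ?thesis by simp
  qed
  moreover have "computable (\<lambda>z. g (pfst z))" by (rule computable_comp[OF assms(3)]) (intro comp_intros)
  ultimately show "computable (\<lambda>z. if pfst (psnd z) = 0 then g (pfst z) else
      h (pfst z) (pfst (psnd z) - 1) (get (psnd (psnd z)) (pfst (psnd z) - 1)))"
    by (intro comp_intros)
qed (use assms in auto)

text \<open>A finite function as a number, so that a recursion on formulas can return the truth
  values at all stores at once. Taking the least code makes the result depend on the first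
  \<open>b\<close> values only.\<close>

definition tab :: "nat \<Rightarrow> (nat \<Rightarrow> nat) \<Rightarrow> nat" where
  "tab b f = (LEAST w. \<forall>i<b. get w i = f i)"

lemma get_tab: "i < b \<Longrightarrow> get (tab b f) i = f i"
  unfolding tab_def using LeastI_ex[OF ex_code[of b f]] by blast

lemma computable_tab [comp_intros]:
  assumes b: "computable b" and f: "computable (\<lambda>z. f (pfst z) (psnd z))"
  shows "computable (\<lambda>x. tab (b x) (f x))"
  unfolding tab_def
proof (rule computable_Least, intro comp_intros)
  show "computable (\<lambda>z. b (pfst z))" by (rule computable_comp[OF b]) (intro comp_intros)
  show "computable (\<lambda>z. f (pfst (pfst z)) (psnd z))"
  proof -
    have "computable (\<lambda>z. prod_encode (pfst (pfst z), psnd z))" by (intro comp_intros)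
    from computable_comp[OF f this] show ?thesis by simp
  qed
qed (rule ex_code)

section \<open>Structural recursion on codes\<close>

lemma computable_app2:
  assumes f: "computable (\<lambda>z. f (pfst z) (psnd z))" and a: "computable a" and b: "computable b"
  shows "computable (\<lambda>x. f (a x) (b x))"
  using computable_comp[OF f computable_comp2[OF computable2_pair a b]] by simp

lemma computable_app3:
  assumes f: "computable (\<lambda>z. f (pfst z) (pfst (psnd z)) (psnd (psnd z)))"
    and a: "computable a" and b: "computable b" and c: "computable c"
  shows "computable (\<lambda>x. f (a x) (b x) (c x))"
  using computable_comp[OF f computable_comp2[OF computable2_pair a computable_comp2[OF computable2_pair b c]]]
  by simp

lemma computable_app4:
  assumes f: "computable (\<lambda>z. f (pfst z) (pfst (psnd z)) (pfst (psnd (psnd z))) (psnd (psnd (psnd z))))"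
    and a: "computable a" and b: "computable b" and c: "computable c" and d: "computable d"
  shows "computable (\<lambda>x. f (a x) (b x) (c x) (d x))"
  using computable_comp[OF f computable_comp2[OF computable2_pair a computable_comp2[OF computable2_pair b
        computable_comp2[OF computable2_pair c d]]]]
  by simp

text \<open>0 marks numbers that code nothing, and proper values are shifted by one. A single
  recursion thus recognises codes and evaluates them; a truth value appears as 1 or 2.\<close>

definition on_code :: "('a \<Rightarrow> nat) \<Rightarrow> ('a \<Rightarrow> nat) \<Rightarrow> nat \<Rightarrow> nat" where
  "on_code code f p = (if p \<in> range code then Suc (f (inv code p)) else 0)"

lemma on_code_code: "inj code \<Longrightarrow> on_code code f (code t) = Suc (f t)"
  by (simp add: on_code_def inv_f_f)

lemma on_code_0: "p \<notin> range code \<Longrightarrow> on_code code f p = 0"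
  by (simp add: on_code_def)

lemma on_code_eq_0_iff: "on_code code f p = 0 \<longleftrightarrow> p \<notin> range code"
  by (simp add: on_code_def)

lemma inj_code_tm: "inj code_tm" and inj_code_pure: "inj code_pure" and inj_code_spatial: "inj code_spatial"
  by (auto intro!: injI code_tm_inject code_pure_inject code_spatial_inject)

lemmas on_code_simps [simp] = on_code_code[OF inj_code_tm] on_code_code[OF inj_code_pure]
  on_code_code[OF inj_code_spatial]

text \<open>A positive tag makes a pair strictly larger than its components. Every constructor with
  recursive arguments has such a tag, so recursion on codes is well founded.\<close>

lemma component_less: "pfst p = Suc k \<Longrightarrow> psnd p < p" "pfst p = Suc k \<Longrightarrow> pfst (psnd p) < p"
    "pfst p = Suc k \<Longrightarrow> psnd (psnd p) < p"
  using psnd_less[of p] pfst_le[of "psnd p"] psnd_le[of "psnd p"] by auto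

text \<open>Codes of subterms are smaller, so course-of-values recursion applies, with
  \<open>x\<close> as a fixed parameter. The history also tells whether the components are codes,
  which is why \<open>?G\<close> tests its entries against 0.\<close>

lemma computable_on_code_tm:
  assumes R: "\<And>x v. R x (Var v) = f1 x v" "\<And>x v. R x (Num v) = f2 x v"
      "\<And>x t u. R x (Add t u) = f3 x (R x t) (R x u)"
    and f: "computable (\<lambda>z. f1 (pfst z) (psnd z))" "computable (\<lambda>z. f2 (pfst z) (psnd z))"
      "computable (\<lambda>z. f3 (pfst z) (pfst (psnd z)) (psnd (psnd z)))"
    and a: "computable a" and b: "computable b"
  shows "computable (\<lambda>z. on_code code_tm (R (a z)) (b z))"
proof -
  let ?l = "\<lambda>H p. get H (pfst (psnd p))" and ?r = "\<lambda>H p. get H (psnd (psnd p))"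
  let ?G = "\<lambda>x p H. if pfst p = 0 then Suc (f1 x (psnd p))
    else if pfst p = 1 then Suc (f2 x (psnd p))
    else if pfst p = 2 \<and> ?l H p \<noteq> 0 \<and> ?r H p \<noteq> 0 then Suc (f3 x (?l H p - 1) (?r H p - 1)) else 0"
  show ?thesis
  proof (rule computable_course[where f = "\<lambda>x. on_code code_tm (R x)" and G = ?G, OF _ _ a b])
    fix x p H assume H: "\<And>q. q < p \<Longrightarrow> get H q = on_code code_tm (R x) q"
    show "on_code code_tm (R x) p = ?G x p H"
    proof (cases "p \<in> range code_tm")
      case True
      then obtain t where p: "p = code_tm t" by blast
      have v: "on_code code_tm (R x) p = Suc (R x t)" by (simp add: p)
      show ?thesis
      proof (cases t)
        case (Add t1 t2)
        with p have "pfst p = Suc 1" by simp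
        from H[OF component_less(2)[OF this]] H[OF component_less(3)[OF this]] p Add R show ?thesis unfolding v by simp
      qed (unfold v, use R p in simp_all)
    next
      \<comment> \<open>On a non-code every branch must be closed: a guard that holds exhibits a
        term with code \<open>p\<close>.\<close>
      case False
      have "p \<in> range code_tm" if "pfst p = 0"
        using that code_tm.simps(1)[of "psnd p"] pair_surj[of p] by (metis rangeI)
      moreover have "p \<in> range code_tm" if "pfst p = 1"
        using that code_tm.simps(2)[of "psnd p"] pair_surj[of p] by (metis rangeI)
      moreover have "p \<in> range code_tm" if "pfst p = 2" "?l H p \<noteq> 0" "?r H p \<noteq> 0"
      proof -
        from that(1) have "pfst p = Suc 1" by simp
        from H[OF component_less(2)[OF this]] H[OF component_less(3)[OF this]] that
        obtain t u where "pfst (psnd p) = code_tm t" "psnd (psnd p) = code_tm u"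
          by (auto simp: on_code_eq_0_iff)
        with that have "code_tm (Add t u) = p" by (metis code_tm.simps(3) pair_surj)
        then show ?thesis by (metis rangeI)
      qed
      ultimately show ?thesis using False by (auto simp: on_code_0)
    qed
  next
    show "computable (\<lambda>z. ?G (pfst z) (pfst (psnd z)) (psnd (psnd z)))"
      by (intro comp_intros computable_app2[OF f(1)] computable_app2[OF f(2)] computable_app3[OF f(3)])
  qed
qed

lemma dec_code_tm [comp_intros]: "computable b \<Longrightarrow> dec (\<lambda>z. b z \<in> range code_tm)"
proof -
  assume "computable b"
  then have "computable (\<lambda>z. on_code code_tm ((\<lambda>x t. 0) 0) (b z))"
    by (intro computable_on_code_tm[where ?f1.0 = "\<lambda>x v. 0" and ?f2.0 = "\<lambda>x v. 0" and ?f3.0 = "\<lambda>x v w. 0"] comp_intros) simp_all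
  then have "dec (\<lambda>z. \<not> on_code code_tm (\<lambda>t. 0) (b z) = 0)" by (intro comp_intros)
  then show ?thesis by (simp add: on_code_eq_0_iff)
qed

text \<open>The clause \<open>f4\<close> receives the bound variable and the code of the body
  besides the recursive value: a bounded quantifier needs the one to vary the store and the other to
  limit the witness.\<close>

lemma computable_on_code_pure:
  assumes R: "\<And>x t u. R x (Eq t u) = f1 x (code_tm t) (code_tm u)"
      "\<And>x P Q. R x (And P Q) = f2 x (R x P) (R x Q)" "\<And>x P. R x (Neg P) = f3 x (R x P)"
      "\<And>x y P. R x (Ex y P) = f4 x y (code_pure P) (R x P)"
    and f: "computable (\<lambda>z. f1 (pfst z) (pfst (psnd z)) (psnd (psnd z)))"
      "computable (\<lambda>z. f2 (pfst z) (pfst (psnd z)) (psnd (psnd z)))"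
      "computable (\<lambda>z. f3 (pfst z) (psnd z))"
      "computable (\<lambda>z. f4 (pfst z) (pfst (psnd z)) (pfst (psnd (psnd z))) (psnd (psnd (psnd z))))"
    and a: "computable a" and b: "computable b"
  shows "computable (\<lambda>z. on_code code_pure (R (a z)) (b z))"
proof -
  let ?l = "\<lambda>H p. get H (pfst (psnd p))" and ?r = "\<lambda>H p. get H (psnd (psnd p))"
  let ?G = "\<lambda>x p H. if pfst p = 0 \<and> pfst (psnd p) \<in> range code_tm \<and> psnd (psnd p) \<in> range code_tm
      then Suc (f1 x (pfst (psnd p)) (psnd (psnd p)))
    else if pfst p = 1 \<and> ?l H p \<noteq> 0 \<and> ?r H p \<noteq> 0 then Suc (f2 x (?l H p - 1) (?r H p - 1))
    else if pfst p = 2 \<and> get H (psnd p) \<noteq> 0 then Suc (f3 x (get H (psnd p) - 1))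
    else if pfst p = 3 \<and> ?r H p \<noteq> 0 then Suc (f4 x (pfst (psnd p)) (psnd (psnd p)) (?r H p - 1))
    else 0"
  show ?thesis
  proof (rule computable_course[where f = "\<lambda>x. on_code code_pure (R x)" and G = ?G, OF _ _ a b])
    fix x p H assume H: "\<And>q. q < p \<Longrightarrow> get H q = on_code code_pure (R x) q"
    note H' = H[OF component_less(1)] H[OF component_less(2)] H[OF component_less(3)]
    show "on_code code_pure (R x) p = ?G x p H"
    proof (cases "p \<in> range code_pure")
      case True
      then obtain P where p: "p = code_pure P" by blast
      have v: "on_code code_pure (R x) p = Suc (R x P)" by (simp add: p)
      show ?thesis
      proof (cases P)
        case (And P1 P2)
        with p have "pfst p = Suc 0" by simp
        from H'[OF this] p And R show ?thesis unfolding v by simp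
      next
        case (Neg P1)
        with p have "pfst p = Suc 1" by simp
        from H'[OF this] p Neg R show ?thesis unfolding v by simp
      next
        case (Ex y P1)
        with p have "pfst p = Suc 2" by simp
        from H'[OF this] p Ex R show ?thesis unfolding v by simp
      qed (unfold v, use R p in simp_all)
    next
      case False
      have "p \<in> range code_pure" if "pfst p = 0" "pfst (psnd p) \<in> range code_tm" "psnd (psnd p) \<in> range code_tm"
      proof -
        from that obtain t u where "pfst (psnd p) = code_tm t" "psnd (psnd p) = code_tm u" by blast
        with that have "code_pure (Eq t u) = p" by (metis code_pure.simps(1) pair_surj)
        then show ?thesis by (metis rangeI)
      qed
      moreover have "p \<in> range code_pure" if p: "pfst p = 1" "?l H p \<noteq> 0" "?r H p \<noteq> 0"
      proof -
        from p(1) have "pfst p = Suc 0" by simp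
        from H'[OF this] p obtain P Q where "pfst (psnd p) = code_pure P" "psnd (psnd p) = code_pure Q"
          by (auto simp: on_code_eq_0_iff)
        with p have "code_pure (And P Q) = p" by (metis code_pure.simps(2) pair_surj)
        then show ?thesis by (metis rangeI)
      qed
      moreover have "p \<in> range code_pure" if p: "pfst p = 2" "get H (psnd p) \<noteq> 0"
      proof -
        from p(1) have "pfst p = Suc 1" by simp
        from H'[OF this] p obtain P where "psnd p = code_pure P"
          by (auto simp: on_code_eq_0_iff)
        with p have "code_pure (Neg P) = p" by (metis code_pure.simps(3) pair_surj)
        then show ?thesis by (metis rangeI)
      qed
      moreover have "p \<in> range code_pure" if p: "pfst p = 3" "?r H p \<noteq> 0"
      proof -
        from p(1) have "pfst p = Suc 2" by simp
        from H'[OF this] p obtain P where "psnd (psnd p) = code_pure P"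
          by (auto simp: on_code_eq_0_iff)
        with p have "code_pure (Ex (pfst (psnd p)) P) = p" by (metis code_pure.simps(4) pair_surj)
        then show ?thesis by (metis rangeI)
      qed
      ultimately show ?thesis using False by (auto simp: on_code_0)
    qed
  next
    show "computable (\<lambda>z. ?G (pfst z) (pfst (psnd z)) (psnd (psnd z)))"
      by (intro comp_intros computable_app3[OF f(1)] computable_app3[OF f(2)]
          computable_app2[OF f(3)] computable_app4[OF f(4)])
  qed
qed

lemma computable_on_code_spatial:
  assumes R: "\<And>x. R x Emp = f0 x" "\<And>x t u. R x (PointsTo t u) = f1 x (code_tm t) (code_tm u)"
      "\<And>x t u. R x (Arr t u) = f2 x (code_tm t) (code_tm u)"
      "\<And>x S T. R x (Sep S T) = f3 x (R x S) (R x T)"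
    and f: "computable f0" "computable (\<lambda>z. f1 (pfst z) (pfst (psnd z)) (psnd (psnd z)))"
      "computable (\<lambda>z. f2 (pfst z) (pfst (psnd z)) (psnd (psnd z)))"
      "computable (\<lambda>z. f3 (pfst z) (pfst (psnd z)) (psnd (psnd z)))"
    and a: "computable a" and b: "computable b"
  shows "computable (\<lambda>z. on_code code_spatial (R (a z)) (b z))"
proof -
  let ?l = "\<lambda>H p. get H (pfst (psnd p))" and ?r = "\<lambda>H p. get H (psnd (psnd p))"
  let ?tt = "\<lambda>p. pfst (psnd p) \<in> range code_tm \<and> psnd (psnd p) \<in> range code_tm"
  let ?G = "\<lambda>x p H. if pfst p = 0 \<and> psnd p = 0 then Suc (f0 x)
    else if pfst p = 1 \<and> ?tt p then Suc (f1 x (pfst (psnd p)) (psnd (psnd p)))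
    else if pfst p = 2 \<and> ?tt p then Suc (f2 x (pfst (psnd p)) (psnd (psnd p)))
    else if pfst p = 3 \<and> ?l H p \<noteq> 0 \<and> ?r H p \<noteq> 0 then Suc (f3 x (?l H p - 1) (?r H p - 1))
    else 0"
  show ?thesis
  proof (rule computable_course[where f = "\<lambda>x. on_code code_spatial (R x)" and G = ?G, OF _ _ a b])
    fix x p H assume H: "\<And>q. q < p \<Longrightarrow> get H q = on_code code_spatial (R x) q"
    note H' = H[OF component_less(2)] H[OF component_less(3)]
    show "on_code code_spatial (R x) p = ?G x p H"
    proof (cases "p \<in> range code_spatial")
      case True
      then obtain S where p: "p = code_spatial S" by blast
      have v: "on_code code_spatial (R x) p = Suc (R x S)" by (simp add: p)
      show ?thesis
      proof (cases S)
        case (Sep S1 S2)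
        with p have "pfst p = Suc 2" by simp
        from H'[OF this] p Sep R show ?thesis unfolding v by simp
      qed (unfold v, use R p in simp_all)
    next
      case False
      have "p \<in> range code_spatial" if "pfst p = 0" "psnd p = 0"
        using that by (metis code_spatial.simps(1) pair_surj rangeI)
      moreover have "p \<in> range code_spatial" if "pfst p = 1 \<or> pfst p = 2" "?tt p"
      proof -
        from that obtain t u where "pfst (psnd p) = code_tm t" "psnd (psnd p) = code_tm u" by blast
        with that have "code_spatial (PointsTo t u) = p \<or> code_spatial (Arr t u) = p"
          by (metis code_spatial.simps(2,3) pair_surj)
        then show ?thesis by (metis rangeI)
      qed
      moreover have "p \<in> range code_spatial" if p: "pfst p = 3" "?l H p \<noteq> 0" "?r H p \<noteq> 0"
      proof -
        from p(1) have "pfst p = Suc 2" by simp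
        from H'[OF this] p obtain S T where "pfst (psnd p) = code_spatial S" "psnd (psnd p) = code_spatial T"
          by (auto simp: on_code_eq_0_iff)
        with p have "code_spatial (Sep S T) = p" by (metis code_spatial.simps(4) pair_surj)
        then show ?thesis by (metis rangeI)
      qed
      ultimately show ?thesis using False by (auto simp: on_code_0)
    qed
  next
    show "computable (\<lambda>z. ?G (pfst z) (pfst (psnd z)) (psnd (psnd z)))"
      by (intro comp_intros computable_comp[OF f(1)] computable_app3[OF f(2)] computable_app3[OF f(3)]
          computable_app3[OF f(4)])
  qed
qed

definition list_mem :: "nat \<Rightarrow> nat \<Rightarrow> bool" where
  "list_mem x l \<longleftrightarrow> x \<in> set (list_decode l)"

lemma list_mem_encode [simp]: "list_mem x (list_encode xs) \<longleftrightarrow> x \<in> set xs"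
  by (simp add: list_mem_def)

lemma list_mem_step:
  "list_mem x l \<longleftrightarrow> l \<noteq> 0 \<and> (pfst (l - 1) = x \<or> list_mem x (psnd (l - 1)))"
  by (cases l; cases "prod_decode (l - 1)") (auto simp: list_mem_def pfst_def psnd_def)

lemma dec_list_mem [comp_intros]:
  assumes "computable a" "computable b"
  shows "dec (\<lambda>z. list_mem (a z) (b z))"
  unfolding dec_def
proof (rule computable_course[where f = "\<lambda>x l. of_bool (list_mem x l)" and
      G = "\<lambda>x l H. of_bool (l \<noteq> 0 \<and> (pfst (l - 1) = x \<or> get H (psnd (l - 1)) = 1))", OF _ _ assms])
  fix x l H assume H: "\<And>q. q < l \<Longrightarrow> get H q = of_bool (list_mem x q)"
  show "of_bool (list_mem x l) = of_bool (l \<noteq> 0 \<and> (pfst (l - 1) = x \<or> get H (psnd (l - 1)) = 1))"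
  proof (cases l)
    case (Suc k)
    then have "psnd (l - 1) < l" using psnd_le[of k] by simp
    from H[OF this] show ?thesis by (subst list_mem_step) simp
  qed (simp add: list_mem_step[of x 0])
qed (intro comp_intros)


section \<open>Back-and-forth equivalence of stores\<close>

definition lin :: "nat \<Rightarrow> (nat \<Rightarrow> int) \<Rightarrow> int \<Rightarrow> store \<Rightarrow> int" where
  "lin K c d s = d + (\<Sum>i<K. c i * int (s i))"

definition eqv :: "nat \<Rightarrow> nat \<Rightarrow> store \<Rightarrow> store \<Rightarrow> bool" where
  "eqv K N s s' \<longleftrightarrow>
     (\<forall>c d. (\<forall>i<K. \<bar>c i\<bar> \<le> int N) \<longrightarrow> \<bar>d\<bar> \<le> int N \<longrightarrow> sgn (lin K c d s) = sgn (lin K c d s')) \<and>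
     (\<forall>i<K. s i mod fact N = s' i mod fact N)"

text \<open>The first summand bounds differences of two forms with coefficients at most
  \<open>fact N * N\<close>. The second makes room for a constant shift below the distance
  \<open>2 * (fact N * fact N)\<close>, and makes \<open>fact (lvl N)\<close> divisible by the
  square of \<open>fact N\<close>.\<close>

definition lvl :: "nat \<Rightarrow> nat" where
  "lvl N = 2 * (fact N * N) + 2 * (fact N * fact N)"

text \<open>After the leading \<open>b\<close>, which makes the function inflationary, comes the
  largest value of a form with coefficients at most \<open>fact N * N\<close> on \<open>K\<close>
  values at most \<open>b\<close>, plus the reduced distance.\<close>

definition grow :: "nat \<Rightarrow> nat \<Rightarrow> nat \<Rightarrow> nat" where
  "grow K N b = b + (fact N * N * (1 + K * b) + 2 * (fact N * fact N))"

lemma eqv_refl: "eqv K N s s"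
  by (simp add: eqv_def)

lemma eqv_sym: "eqv K N s s' \<Longrightarrow> eqv K N s' s"
  by (simp add: eqv_def)

lemma eqvD: "eqv K N s s' \<Longrightarrow> (\<And>i. i < K \<Longrightarrow> \<bar>c i\<bar> \<le> int N) \<Longrightarrow> \<bar>d\<bar> \<le> int N \<Longrightarrow>
    sgn (lin K c d s) = sgn (lin K c d s')"
  by (simp add: eqv_def)

lemma eqv_mono: assumes "eqv K M s s'" "N \<le> M" shows "eqv K N s s'"
proof -
  have "(fact N :: nat) dvd fact M" using assms(2) by (rule fact_dvd)
  then have "s i mod fact N = s' i mod fact N" if "i < K" for i
    using assms(1) that unfolding eqv_def by (metis mod_mod_cancel)
  then show ?thesis using assms unfolding eqv_def
    by (meson order_trans of_nat_le_iff)
qed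

lemma lin_scale: "lin K (\<lambda>i. k * c i) (k * d) s = k * lin K c d s"
  by (simp add: lin_def sum_distrib_left algebra_simps)

lemma lin_diff: "lin K (\<lambda>i. c i - c' i) (d - d') s = lin K c d s - lin K c' d' s"
  by (simp add: lin_def sum_subtractf algebra_simps)

lemma lin_upd: assumes "x < K"
  shows "lin K c d (s(x := a)) = c x * int a + lin K (c(x := 0)) d s"
proof -
  have "(\<Sum>i<K. c i * int ((s(x := a)) i)) = c x * int a + (\<Sum>i\<in>{..<K}-{x}. c i * int (s i))"
    using assms by (subst sum.remove[where x = x]) (auto intro: sum.cong)
  moreover have "(\<Sum>i<K. (c(x := 0)) i * int (s i)) = (\<Sum>i\<in>{..<K}-{x}. c i * int (s i))"
    using assms by (subst sum.remove[where x = x]) (auto intro: sum.cong)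
  ultimately show ?thesis by (simp add: lin_def)
qed

lemma lin_le: assumes "\<And>i. i < K \<Longrightarrow> \<bar>c i\<bar> \<le> int m" "\<bar>d\<bar> \<le> int m" "\<And>i. i < K \<Longrightarrow> s i \<le> b"
  shows "lin K c d s \<le> int (m * (1 + K * b))"
proof -
  have "(\<Sum>i<K. c i * int (s i)) \<le> (\<Sum>i<K. int m * int b)"
    using assms(1,3) by (intro sum_mono mult_mono) (auto intro: order_trans[OF abs_ge_self])
  then show ?thesis using assms(2) by (simp add: lin_def algebra_simps)
qed

lemma lvl_ge: "N \<le> lvl N"
proof -
  have "1 * N \<le> fact N * N" by (intro mult_right_mono) (simp_all add: fact_ge_1)
  then have "N \<le> fact N * N" by simp
  then show ?thesis unfolding lvl_def by linarith
qed

text \<open>The witness for \<open>s'\<close> sits at the same distance as \<open>a\<close> above the greatest linear form below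
  \<open>a\<close>, the distance being reduced modulo the square of \<open>fact N\<close> when it is large. Multiplying
  by \<open>fact N\<close> makes all coefficients of the new variable equal.\<close>

lemma eqv_extend:
  assumes e: "eqv K (lvl N) s s'" and x: "x < K"
  obtains a' where "eqv K N (s(x := a)) (s'(x := a'))"
    "\<And>b. (\<And>i. i < K \<Longrightarrow> s' i \<le> b) \<Longrightarrow> a' \<le> grow K N b"
proof -
  define L :: nat where "L = fact N"
  have L: "L > 0" by (simp add: L_def)
  have lvl: "lvl N = 2 * (L * N) + 2 * (L * L)" by (simp add: lvl_def L_def)
  have lvl': "int (lvl N) = 2 * int (L * N) + 2 * int (L * L)" "0 \<le> int (L * L)" by (simp_all add: lvl)
  \<comment> \<open>A condition on the new variable, scaled by a factor at most \<open>L\<close>,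
    gives that variable the coefficient \<open>L\<close> up to sign. The rest becomes a form in
    \<open>T\<close>, to be compared with \<open>L * a\<close>.\<close>
  define T where "T c d \<longleftrightarrow> (\<forall>i<K. \<bar>c i\<bar> \<le> int (L * N)) \<and> \<bar>d\<bar> \<le> int (L * N)" for c :: "nat \<Rightarrow> int" and d
  let ?P = "\<lambda>r::nat. \<exists>c d. T c d \<and> int (L * a) - lin K c d s = int r"
  \<comment> \<open>The zero form does not exceed \<open>L * a\<close>, so some form lies below; the
    least distance selects the greatest one.\<close>
  have "?P (L * a)" by (intro exI[of _ "\<lambda>_. 0"] exI[of _ 0]) (simp add: T_def lin_def)
  then have "?P (LEAST r. ?P r)" by (rule LeastI)
  then obtain c d where Tc: "T c d" and r0: "int (L * a) - lin K c d s = int (LEAST r. ?P r)" by blast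
  define r where "r = (LEAST r. ?P r)"
  have r: "int (L * a) = lin K c d s + int r" using r0 by (simp add: r_def)
  have max: "lin K c' d' s \<le> lin K c d s" if "T c' d'" "lin K c' d' s \<le> int (L * a)" for c' d'
  proof -
    have "?P (nat (int (L * a) - lin K c' d' s))" using that by auto
    then have "r \<le> nat (int (L * a) - lin K c' d' s)" unfolding r_def by (rule Least_le)
    then show ?thesis using r that by simp
  qed
  \<comment> \<open>A large distance keeps its residue modulo \<open>L * L\<close>; the added
    modulus prevents a positive distance from becoming 0. It never increases, so forms above
    \<open>L * a\<close> stay above.\<close>
  define r' where "r' = (if r < L * L then r else L * L + r mod (L * L))"
  have LL: "L * L > 0" using L by simp
  have r'_le: "r' \<le> r"
  proof (cases "r < L * L")
    case False
    then have "1 \<le> r div (L * L)" using LL by (simp add: Suc_le_eq div_greater_zero_iff)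
    then have "L * L * 1 \<le> L * L * (r div (L * L))" by (rule mult_le_mono2)
    then have "L * L + r mod (L * L) \<le> r" using mult_div_mod_eq[of "L * L" r] by linarith
    then show ?thesis using False by (simp add: r'_def)
  qed (simp add: r'_def)
  have r'_less: "r' < 2 * (L * L)"
    using mod_less_divisor[OF LL, of r] by (simp add: r'_def)
  have r'_0: "r' = 0 \<longleftrightarrow> r = 0" using LL by (cases "r < L * L") (simp_all only: r'_def if_True if_False, linarith)
  have r'_mod: "int (L * L) dvd int r' - int r"
  proof -
    have "r' mod (L * L) = r mod (L * L)" by (simp add: r'_def)
    then show ?thesis by (metis mod_eq_dvd_iff of_nat_mod)
  qed
  define q where "q = lin K c d s' + int r'"
  have key: "sgn (q - lin K c' d' s') = sgn (int (L * a) - lin K c' d' s)" if T': "T c' d'" for c' d'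
  proof (cases "lin K c' d' s \<le> int (L * a)")
    case True
    let ?c = "\<lambda>i. c i - c' i" and ?d = "d - d'"
    have b: "\<bar>?c i\<bar> \<le> int (lvl N)" if "i < K" for i
    proof -
      have "\<bar>c i\<bar> \<le> int (L * N)" "\<bar>c' i\<bar> \<le> int (L * N)" using Tc T' that by (auto simp: T_def)
      then show ?thesis using lvl' by linarith
    qed
    have "\<bar>d\<bar> \<le> int (L * N)" "\<bar>d'\<bar> \<le> int (L * N)" using Tc T' by (auto simp: T_def)
    then have "\<bar>?d\<bar> \<le> int (lvl N)" using lvl' by linarith
    from eqvD[of K "lvl N" s s' ?c ?d, OF e b this]
    have "sgn (lin K c d s - lin K c' d' s) = sgn (lin K c d s' - lin K c' d' s')"
      by (simp only: lin_diff)
    moreover have "lin K c d s - lin K c' d' s \<ge> 0" using max[OF T' True] by simp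
    ultimately have y: "lin K c d s' - lin K c' d' s' \<ge> 0"
      "lin K c d s' - lin K c' d' s' = 0 \<longleftrightarrow> lin K c d s - lin K c' d' s = 0"
      by (auto simp: sgn_if split: if_splits)
    show ?thesis
      using y \<open>lin K c d s - lin K c' d' s \<ge> 0\<close> r'_0 r unfolding q_def
      by (auto simp: sgn_if)
  next
    case False
    \<comment> \<open>A form above \<open>L * a\<close> exceeds the greatest form below by at least
      \<open>r + 1\<close>, hence by \<open>r' + 1\<close>. With this constant moved into the form,
      it is a sign condition that \<open>s'\<close> inherits.\<close>
    let ?c = "\<lambda>i. c' i - c i" and ?d = "(d' - (int r' + 1)) - d"
    have b: "\<bar>?c i\<bar> \<le> int (lvl N)" if "i < K" for i
    proof -
      have "\<bar>c i\<bar> \<le> int (L * N)" "\<bar>c' i\<bar> \<le> int (L * N)" using Tc T' that by (auto simp: T_def)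
      then show ?thesis using lvl' by linarith
    qed
    have "\<bar>d\<bar> \<le> int (L * N)" "\<bar>d'\<bar> \<le> int (L * N)" using Tc T' by (auto simp: T_def)
    moreover have "int r' + 1 \<le> 2 * int (L * L)" using r'_less by linarith
    ultimately have "\<bar>?d\<bar> \<le> int (lvl N)" using lvl' by linarith
    from eqvD[of K "lvl N" s s' ?c ?d, OF e b this]
    have "sgn (lin K c' (d' - (int r' + 1)) s - lin K c d s) = sgn (lin K c' (d' - (int r' + 1)) s' - lin K c d s')"
      by (simp only: lin_diff)
    moreover have "lin K c' (d' - k) t = lin K c' d' t - k" for k t by (simp add: lin_def)
    ultimately have "sgn (lin K c' d' s - (int r' + 1) - lin K c d s) = sgn (lin K c' d' s' - (int r' + 1) - lin K c d s')"
      by simp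
    moreover have "lin K c' d' s - (int r' + 1) - lin K c d s \<ge> 0" using False r r'_le by simp
    ultimately have "lin K c' d' s' - (int r' + 1) - lin K c d s' \<ge> 0"
      by (auto simp: sgn_if split: if_splits)
    then show ?thesis using False unfolding q_def by (simp add: sgn_if)
  qed
  have T0: "T (\<lambda>_. 0) 0" by (simp add: T_def)
  from key[OF T0] have q0: "q \<ge> 0" by (simp add: lin_def sgn_if split: if_splits)
  have LLf: "L * L dvd fact (lvl N)" using LL by (intro dvd_fact) (simp_all add: lvl)
  have si: "int (L * L) dvd int (s' i) - int (s i)" if "i < K" for i
  proof -
    have "s i mod fact (lvl N) = s' i mod fact (lvl N)" using e that by (simp add: eqv_def)
    then have "s' i mod (L * L) = s i mod (L * L)" using LLf by (metis mod_mod_cancel)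
    then show ?thesis by (metis mod_eq_dvd_iff of_nat_mod)
  qed
  have "lin K c d s' - lin K c d s = (\<Sum>i<K. c i * (int (s' i) - int (s i)))"
    by (simp add: lin_def sum_subtractf algebra_simps)
  moreover have "int (L * L) dvd (\<Sum>i<K. c i * (int (s' i) - int (s i)))"
    by (intro dvd_sum dvd_mult si) simp
  ultimately have "int (L * L) dvd (lin K c d s' - lin K c d s) + (int r' - int r)"
    using r'_mod by (intro dvd_add) simp_all
  moreover have "(lin K c d s' - lin K c d s) + (int r' - int r) = q - int (L * a)"
    using r by (simp add: q_def)
  \<comment> \<open>The modulus is squared because division by \<open>L\<close> uses up one factor;
    the other leaves \<open>a'\<close> congruent to \<open>a\<close> modulo
    \<open>L\<close>.\<close>
  ultimately have qLL: "int (L * L) dvd q - int (L * a)" by simp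
  then have "int L dvd q - int (L * a)" by (metis dvd_mult_left of_nat_mult)
  then have "int L dvd q" by (metis dvd_triv_left of_nat_mult zdvd_zdiffD)
  then obtain a'' where a'': "q = int L * a''" by blast
  with q0 L have "a'' \<ge> 0" by (simp add: zero_le_mult_iff)
  define a' where "a' = nat a''"
  have a': "q = int (L * a')" using a'' \<open>a'' \<ge> 0\<close> by (simp add: a'_def)
  have "int L * int L dvd int L * (int a' - int a)" using qLL a' by (simp add: algebra_simps)
  then have "int L dvd int a' - int a" using L by simp
  then have amod: "a mod L = a' mod L"
    by (metis mod_eq_dvd_iff of_nat_eq_iff of_nat_mod)
  show thesis
  proof
    show "eqv K N (s(x := a)) (s'(x := a'))" unfolding eqv_def
    proof (intro conjI allI impI)
      fix c0 :: "nat \<Rightarrow> int" and d0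
      assume c0: "\<forall>i<K. \<bar>c0 i\<bar> \<le> int N" and d0: "\<bar>d0\<bar> \<le> int N"
      show "sgn (lin K c0 d0 (s(x := a))) = sgn (lin K c0 d0 (s'(x := a')))"
      proof (cases "c0 x = 0")
        case True
        have "\<bar>(c0(x := 0)) i\<bar> \<le> int (lvl N)" if "i < K" for i
          using c0 that lvl_ge[of N] by (auto intro: order_trans[of _ "int N"])
        moreover have "\<bar>d0\<bar> \<le> int (lvl N)" using d0 lvl_ge[of N] by linarith
        ultimately show ?thesis using eqvD[OF e] True by (simp add: lin_upd[OF x])
      next
        case False
        \<comment> \<open>The sign \<open>g\<close> and the cofactor \<open>m\<close> of the
          coefficient in \<open>L\<close> normalise the coefficient of the new variable to
          \<open>L\<close>.\<close>
        define g where "g = sgn (c0 x)"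
        have g: "g * g = 1" "\<bar>g\<bar> = 1" "c0 x = g * \<bar>c0 x\<bar>" using False by (auto simp: g_def sgn_if)
        have "nat \<bar>c0 x\<bar> dvd L" unfolding L_def
          using False c0 x by (intro dvd_fact) (auto simp: nat_le_iff)
        then obtain m where m: "L = nat \<bar>c0 x\<bar> * m" by blast
        then have Lm: "int L = \<bar>c0 x\<bar> * int m" by simp
        have m0: "0 < m" using m L by (cases m) auto
        have mL: "m \<le> L" using m L by (cases "nat \<bar>c0 x\<bar>") auto
        let ?c = "\<lambda>i. (- g * int m) * (c0(x := 0)) i" and ?d = "(- g * int m) * d0"
        have ab: "\<bar>(- g * int m) * y\<bar> \<le> int (L * N)" if "\<bar>y\<bar> \<le> int N" for y
          using that mL g(2) by (simp add: abs_mult mult_mono)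
        have "\<bar>?c i\<bar> \<le> int (L * N)" if "i < K" for i
          using c0 that by (intro ab) simp
        then have "T ?c ?d" unfolding T_def using ab[OF d0] by blast
        note k = key[OF this]
        have main: "int m * (c0 x * int b + lin K (c0(x := 0)) d0 t) = g * (int (L * b) - lin K ?c ?d t)" for b t
        proof -
          have "g * (int (L * b) - lin K ?c ?d t) = g * (\<bar>c0 x\<bar> * int m * int b) + g * g * int m * lin K (c0(x := 0)) d0 t"
            unfolding lin_scale by (simp add: Lm algebra_simps del: fun_upd_apply)
          also have "\<dots> = (g * \<bar>c0 x\<bar>) * int m * int b + int m * lin K (c0(x := 0)) d0 t"
            using g(1) by (simp add: algebra_simps)
          finally show ?thesis using g(3) by (simp add: algebra_simps)
        qed
        have "sgn (int m * (c0 x * int a + lin K (c0(x := 0)) d0 s)) = sgn (int m * (c0 x * int a' + lin K (c0(x := 0)) d0 s'))"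
          unfolding main using k a' by (simp add: sgn_mult)
        then show ?thesis using m0 by (simp add: lin_upd[OF x] sgn_mult)
      qed
    next
      fix i assume "i < K"
      then have "s i mod fact N = s' i mod fact N" using eqv_mono[OF e lvl_ge] by (simp add: eqv_def)
      then show "(s(x := a)) i mod fact N = (s'(x := a')) i mod fact N" using amod by (simp add: L_def)
    qed
  next
    fix b assume b: "\<And>i. i < K \<Longrightarrow> s' i \<le> b"
    have "lin K c d s' \<le> int (L * N * (1 + K * b))" using Tc b by (intro lin_le) (auto simp: T_def)
    then have "q \<le> int (L * N * (1 + K * b) + 2 * (L * L))" using r'_less unfolding q_def by linarith
    then have "L * a' \<le> L * N * (1 + K * b) + 2 * (L * L)" unfolding a' by (simp only: of_nat_le_iff)
    moreover have "1 * a' \<le> L * a'" using L by (intro mult_right_mono) auto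
    ultimately have "a' \<le> L * N * (1 + K * b) + 2 * (L * L)" by linarith
    then show "a' \<le> grow K N b" unfolding grow_def L_def by (rule trans_le_add2)
  qed
qed

lemma grow_mono: "b \<le> b' \<Longrightarrow> N \<le> N' \<Longrightarrow> grow K N b \<le> grow K N' b'"
  unfolding grow_def by (intro add_mono mult_mono fact_mono) simp_all

lemma grow_ge: "b \<le> grow K N b"
  by (simp add: grow_def)

lemma funpow_lvl_mono: "i \<le> j \<Longrightarrow> (lvl ^^ i) N \<le> (lvl ^^ j) N"
  by (rule lift_Suc_mono_le[of "\<lambda>i. (lvl ^^ i) N"]) (simp_all add: lvl_ge)

lemma funpow_grow_mono: "i \<le> j \<Longrightarrow> (grow K N ^^ i) b \<le> (grow K N ^^ j) b"
  by (rule lift_Suc_mono_le[of "\<lambda>i. (grow K N ^^ i) b"]) (simp_all add: grow_ge)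

text \<open>The variables in \<open>ys\<close> are played one after the other, each costing a level.
  \<open>M\<close> dominates all levels met on the way, so the bound is an iterate of a single
  function.\<close>

lemma eqv_extend_list:
  assumes "eqv K ((lvl ^^ length ys) N) s s'" "set ys \<subseteq> {..<K}" "\<And>i. i \<notin> set ys \<Longrightarrow> t i = s i"
    and "(lvl ^^ length ys) N \<le> M"
  obtains t' where "eqv K N t t'" "\<And>i. i \<notin> set ys \<Longrightarrow> t' i = s' i"
    "\<And>b i. (\<And>i. i < K \<Longrightarrow> s' i \<le> b) \<Longrightarrow> i < K \<Longrightarrow> t' i \<le> (grow K M ^^ length ys) b"
  using assms
proof (induction ys arbitrary: s s' thesis)
  case Nil
  then have "t = s" by auto
  with Nil show ?case by auto
next
  case (Cons y ys)
  let ?N = "(lvl ^^ length ys) N"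
  from Cons.prems have "eqv K (lvl ?N) s s'" "y < K" by simp_all
  then obtain a where a: "eqv K ?N (s(y := t y)) (s'(y := a))"
    and ab: "\<And>b. (\<And>i. i < K \<Longrightarrow> s' i \<le> b) \<Longrightarrow> a \<le> grow K ?N b"
    by (rule eqv_extend[where a = "t y"]) blast
  have le: "?N \<le> M" using Cons.prems(5) lvl_ge[of ?N] by simp
  show ?case
  proof (rule Cons.IH[OF _ a _ _ le])
    show "set ys \<subseteq> {..<K}" using Cons.prems by simp
    show "t i = (s(y := t y)) i" if "i \<notin> set ys" for i using Cons.prems(4) that by simp
    fix t' assume t': "eqv K N t t'" "\<And>i. i \<notin> set ys \<Longrightarrow> t' i = (s'(y := a)) i"
      "\<And>b i. (\<And>i. i < K \<Longrightarrow> (s'(y := a)) i \<le> b) \<Longrightarrow> i < K \<Longrightarrow> t' i \<le> (grow K M ^^ length ys) b"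
    show thesis
    proof (rule Cons.prems(1)[OF t'(1)])
      show "t' i = s' i" if "i \<notin> set (y # ys)" for i using t'(2) that by simp
      fix b i assume b: "\<And>i. i < K \<Longrightarrow> s' i \<le> b" and i: "i < K"
      have "a \<le> grow K M b" using ab[OF b] grow_mono[OF order.refl le, of K b] by linarith
      then have "(s'(y := a)) j \<le> grow K M b" if "j < K" for j
        using b[OF that] grow_ge[of b K M] by auto
      from t'(3)[OF this i] show "t' i \<le> (grow K M ^^ length (y # ys)) b"
        by (simp add: funpow_swap1)
    qed
  qed
qed


section \<open>Linear forms with natural coefficients\<close>

definition nlin :: "nat \<Rightarrow> nat \<Rightarrow> (store \<Rightarrow> nat) \<Rightarrow> bool" where
  "nlin K M f \<longleftrightarrow> (\<exists>c d. (\<forall>i<K. c i \<le> M) \<and> d \<le> M \<and> (\<forall>s. f s = d + (\<Sum>i<K. c i * s i)))"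

lemma nlinI: "(\<And>i. i < K \<Longrightarrow> c i \<le> M) \<Longrightarrow> d \<le> M \<Longrightarrow> (\<And>s. f s = d + (\<Sum>i<K. c i * s i)) \<Longrightarrow> nlin K M f"
  unfolding nlin_def by blast

text \<open>Differences of coefficients between 0 and \<open>M\<close> lie between \<open>-M\<close>
  and \<open>M\<close>, so comparing two forms needs no higher level than \<open>M\<close>.\<close>

lemma nlin_eqv_le:
  assumes "nlin K M f" "nlin K M g" "eqv K M s s'"
  shows "f s \<le> g s \<longleftrightarrow> f s' \<le> g s'"
proof -
  from assms obtain c d c' d' where f: "\<forall>i<K. c i \<le> M" "d \<le> M" "\<And>s. f s = d + (\<Sum>i<K. c i * s i)"
    and g: "\<forall>i<K. c' i \<le> M" "d' \<le> M" "\<And>s. g s = d' + (\<Sum>i<K. c' i * s i)"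
    unfolding nlin_def by blast
  have d: "int (g t) - int (f t) = lin K (\<lambda>i. int (c' i) - int (c i)) (int d' - int d) t" for t
    unfolding lin_diff by (simp add: f(3) g(3) lin_def)
  have "sgn (int (g s) - int (f s)) = sgn (int (g s') - int (f s'))"
    unfolding d using f(1,2) g(1,2) by (intro eqvD[OF assms(3)]) fastforce+
  then show ?thesis by (auto simp: sgn_if split: if_splits)
qed

lemma nlin_eqv_eq:
  "nlin K M f \<Longrightarrow> nlin K M g \<Longrightarrow> eqv K M s s' \<Longrightarrow> f s = g s \<longleftrightarrow> f s' = g s'"
  using nlin_eqv_le[of K M f g s s'] nlin_eqv_le[of K M g f s s'] by (auto simp: eq_iff)

lemma nlin_mono: "nlin K M f \<Longrightarrow> M \<le> M' \<Longrightarrow> nlin K M' f"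
  unfolding nlin_def by (meson le_trans)

lemma nlin_const: "d \<le> M \<Longrightarrow> nlin K M (\<lambda>s. d)"
  by (rule nlinI[where c = "\<lambda>_. 0"]) auto

lemma nlin_var: "x < K \<Longrightarrow> 1 \<le> M \<Longrightarrow> nlin K M (\<lambda>s. s x)"
  by (rule nlinI[where c = "\<lambda>i. of_bool (i = x)" and d = 0]) (auto simp: of_bool_def if_distrib[of "\<lambda>x. x * _"] cong: if_cong)

lemma nlin_add: assumes "nlin K M f" "nlin K M' g" shows "nlin K (M + M') (\<lambda>s. f s + g s)"
proof -
  from assms obtain c d c' d' where f: "\<forall>i<K. c i \<le> M" "d \<le> M" "\<And>s. f s = d + (\<Sum>i<K. c i * s i)"
    and g: "\<forall>i<K. c' i \<le> M'" "d' \<le> M'" "\<And>s. g s = d' + (\<Sum>i<K. c' i * s i)"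
    unfolding nlin_def by blast
  show ?thesis
    by (rule nlinI[where c = "\<lambda>i. c i + c' i" and d = "d + d'"])
       (use f g in \<open>auto intro: add_mono simp: sum.distrib add_mult_distrib\<close>)
qed

lemma nlin_sum: "finite A \<Longrightarrow> (\<And>a. a \<in> A \<Longrightarrow> nlin K (w a) (f a)) \<Longrightarrow> nlin K (\<Sum>a\<in>A. w a) (\<lambda>s. \<Sum>a\<in>A. f a s)"
  by (induction A rule: finite_induct) (auto intro: nlin_add nlin_const)

text \<open>Serves to evaluate forms in the second copy of the store, which starts at index
  \<open>k\<close>.\<close>

lemma nlin_shift: assumes "nlin K M f" "k + K \<le> V" shows "nlin V M (\<lambda>s. f (\<lambda>i. s (k + i)))"
proof -
  from assms obtain c d where f: "\<forall>i<K. c i \<le> M" "d \<le> M" "\<And>s. f s = d + (\<Sum>i<K. c i * s i)"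
    unfolding nlin_def by blast
  let ?c = "\<lambda>j. if k \<le> j \<and> j < k + K then c (j - k) else 0"
  have "(\<Sum>i<K. c i * s (k + i)) = (\<Sum>j<V. ?c j * s j)" for s :: store
  proof -
    have "(\<Sum>j<V. ?c j * s j) = (\<Sum>j\<in>{k..<k + K}. ?c j * s j)"
      using assms(2) by (intro sum.mono_neutral_right) auto
    also have "\<dots> = (\<Sum>i<K. c i * s (k + i))"
      by (rule sum.reindex_bij_witness[of _ "\<lambda>i. k + i" "\<lambda>j. j - k"]) auto
    finally show ?thesis by simp
  qed
  with f show ?thesis by (intro nlinI[where c = ?c and d = d]) auto
qed

lemma nlin_widen: "nlin K M f \<Longrightarrow> K \<le> V \<Longrightarrow> nlin V M f"
  using nlin_shift[of K M f 0 V] by simp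

section \<open>Terms and pure formulas measured by their codes\<close>

fun wt :: "tm \<Rightarrow> nat" where
  "wt (Var x) = 1"
| "wt (Num n) = n"
| "wt (Add t u) = wt t + wt u"

lemma nlin_tm_val: "tm_vars t \<subseteq> {..<K} \<Longrightarrow> nlin K (wt t) (\<lambda>s. tm_val s t)"
  by (induction t) (auto intro: nlin_var nlin_const nlin_add)

lemma Add_code_less: "code_tm t + code_tm u < code_tm (Add t u)"
  using less_prod_encode[of 2 "prod_encode (code_tm t, code_tm u)"] add_le_prod_encode[of "code_tm t" "code_tm u"]
  by simp

text \<open>The \<open>Suc\<close> accounts for \<open>Var 0\<close>, of weight 1 and code
  0.\<close>

lemma wt_le_code: "wt t \<le> Suc (code_tm t)"
proof (induction t)
  case (Num n) show ?case using le_prod_encode_2[of n 1] by simp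
next
  case (Add t u) with Add_code_less[of t u] show ?case by simp
qed simp

lemma tm_vars_le_code: "x \<in> tm_vars t \<Longrightarrow> x \<le> code_tm t"
proof (induction t)
  case (Var y) then show ?case using le_prod_encode_2[of y 0] by simp
next
  case (Add t u) with Add_code_less[of t u] show ?case by auto
qed simp

lemma tm_vars_code: "code_tm t < K \<Longrightarrow> tm_vars t \<subseteq> {..<K}"
  using tm_vars_le_code by fastforce

lemma nlin_tm_code: "code_tm t < K \<Longrightarrow> Suc (code_tm t) \<le> M \<Longrightarrow> nlin K M (\<lambda>s. tm_val s t)"
  by (rule nlin_mono[OF nlin_tm_val[OF tm_vars_code]]) (use wt_le_code[of t] in auto)

lemma tm_val_cong: "(\<And>i. i \<in> tm_vars t \<Longrightarrow> s i = s' i) \<Longrightarrow> tm_val s t = tm_val s' t"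
  by (induction t) auto

lemma tm_val_cong_code: "code_tm t < K \<Longrightarrow> (\<And>i. i < K \<Longrightarrow> s i = s' i) \<Longrightarrow> tm_val s t = tm_val s' t"
  by (intro tm_val_cong) (use tm_vars_code[of t K] in auto)

lemma code_Eq_le: "code_tm t \<le> code_pure (Eq t u)" "code_tm u \<le> code_pure (Eq t u)"
  using add_le_prod_encode[of 0 "prod_encode (code_tm t, code_tm u)"] add_le_prod_encode[of "code_tm t" "code_tm u"]
  by auto

lemma code_pure_less: "code_pure P < code_pure (And P Q)" "code_pure Q < code_pure (And P Q)"
    "code_pure P < code_pure (Neg P)" "code_pure P < code_pure (Ex x P)" "x < code_pure (Ex x P)"
  using less_prod_encode[of 1 "prod_encode (code_pure P, code_pure Q)"] add_le_prod_encode[of "code_pure P" "code_pure Q"]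
    less_prod_encode[of 2 "code_pure P"] less_prod_encode[of 3 "prod_encode (x, code_pure P)"]
    add_le_prod_encode[of x "code_pure P"]
  by auto

lemma sat_pure_cong: "code_pure P < K \<Longrightarrow> (\<And>i. i < K \<Longrightarrow> s i = s' i) \<Longrightarrow> sat_pure s P \<longleftrightarrow> sat_pure s' P"
proof (induction P arbitrary: s s')
  case (Eq t u)
  then have "tm_val s t = tm_val s' t" "tm_val s u = tm_val s' u"
    using code_Eq_le[where t = t and u = u] by (auto intro!: tm_val_cong_code[of _ K])
  then show ?case by simp
next
  case (And P Q)
  then have "code_pure P < K" "code_pure Q < K"
    using code_pure_less(1)[of P Q] code_pure_less(2)[of Q P] by linarith+
  with And show ?case by (metis sat_pure.simps(2))
next
  case (Neg P)
  then have "code_pure P < K" using code_pure_less(3)[of P] by linarith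
  with Neg show ?case by (metis sat_pure.simps(3))
next
  case (Ex x P)
  have "code_pure P < K" using Ex.prems(1) code_pure_less(4)[of P x] by linarith
  then have "sat_pure (s(x := a)) P = sat_pure (s'(x := a)) P" for a
    using Ex.prems(2) by (intro Ex.IH) simp_all
  then show ?case by simp
qed

text \<open>The Ehrenfeucht-Fraisse induction: a quantifier costs one application of
  \<open>lvl\<close>, and the code of a formula bounds its quantifier depth.\<close>

lemma sat_pure_eqv:
  "code_pure P < K \<Longrightarrow> Suc (code_pure P) \<le> N \<Longrightarrow> eqv K ((lvl ^^ code_pure P) N) s s' \<Longrightarrow> sat_pure s P \<longleftrightarrow> sat_pure s' P"
proof (induction P arbitrary: s s')
  case (Eq t u)
  have "eqv K N s s'" using Eq.prems(3) funpow_lvl_mono[of 0 _ N] by (auto elim: eqv_mono)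
  moreover have "nlin K N (\<lambda>s. tm_val s t)" "nlin K N (\<lambda>s. tm_val s u)"
    using Eq.prems(1,2) code_Eq_le(1)[of t u] code_Eq_le(2)[of u t] by (intro nlin_tm_code; linarith)+
  ultimately show ?case using nlin_eqv_eq[of K N "\<lambda>s. tm_val s t" "\<lambda>s. tm_val s u" s s'] by simp
next
  case (And P Q)
  have "sat_pure s P = sat_pure s' P"
    using And.prems code_pure_less(1)[of P Q]
    by (intro And.IH(1)) (auto simp del: code_pure.simps elim!: eqv_mono intro!: funpow_lvl_mono)
  moreover have "sat_pure s Q = sat_pure s' Q"
    using And.prems code_pure_less(2)[of Q P]
    by (intro And.IH(2)) (auto simp del: code_pure.simps elim!: eqv_mono intro!: funpow_lvl_mono)
  ultimately show ?case by simp
next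
  case (Neg P)
  have "sat_pure s P = sat_pure s' P"
    using Neg.prems code_pure_less(3)[of P]
    by (intro Neg.IH) (auto simp del: code_pure.simps elim!: eqv_mono intro!: funpow_lvl_mono)
  then show ?case by simp
next
  case (Ex x P)
  let ?N = "(lvl ^^ code_pure P) N"
  have less: "code_pure P < code_pure (Ex x P)" "x < code_pure (Ex x P)"
    using code_pure_less(4,5) by blast+
  have "(lvl ^^ Suc (code_pure P)) N \<le> (lvl ^^ code_pure (Ex x P)) N" using less by (intro funpow_lvl_mono) simp
  then have e: "eqv K (lvl ?N) s s'" using Ex.prems(3) by (auto elim: eqv_mono)
  have x: "x < K" using Ex.prems less by linarith
  have IH: "sat_pure s P = sat_pure s' P" if "eqv K ?N s s'" for s s'
    using Ex.prems less by (intro Ex.IH[OF _ _ that]) linarith+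
  have "\<exists>a'. sat_pure (s'(x := a')) P" if "eqv K (lvl ?N) s s'" "sat_pure (s(x := a)) P" for s s' a
    using eqv_extend[OF that(1) x] IH that(2) by metis
  from this[OF e] this[OF eqv_sym[OF e]] show ?case by auto
qed

text \<open>The store is compared with itself: \<open>eqv_extend\<close> answers an arbitrary
  witness by a small one that \<open>P\<close> does not distinguish from it.\<close>

lemma sat_pure_Ex_bounded:
  assumes "code_pure (Ex x P) < K" "K \<le> N" "\<And>i. i < K \<Longrightarrow> s i \<le> b" "(lvl ^^ K) N \<le> M"
    and "sat_pure s (Ex x P)"
  shows "\<exists>a\<le>grow K M b. sat_pure (s(x := a)) P"
proof -
  let ?N = "(lvl ^^ code_pure P) N"
  from assms(5) obtain a where a: "sat_pure (s(x := a)) P" by auto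
  have less: "code_pure P < K" "x < K" using assms(1) code_pure_less(4,5)[where P = P and x = x] by (meson less_trans)+
  obtain a' where a': "eqv K ?N (s(x := a)) (s(x := a'))" "a' \<le> grow K ?N b"
    using eqv_extend[OF eqv_refl less(2), of ?N s a thesis] assms(3) by blast
  have "sat_pure (s(x := a')) P" using sat_pure_eqv[OF less(1) _ a'(1)] less(1) assms(2) a by simp
  moreover have "grow K ?N b \<le> grow K M b"
    using funpow_lvl_mono[of "code_pure P" K N] less(1) assms(4) by (intro grow_mono) auto
  ultimately show ?thesis using a'(2) by (meson le_trans)
qed

section \<open>Spatial formulas as coverings\<close>

fun cnt :: "spatial \<Rightarrow> store \<Rightarrow> nat \<Rightarrow> nat" where
  "cnt Emp s x = 0"
| "cnt (PointsTo t u) s x = of_bool (x = tm_val s t)"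
| "cnt (Arr t u) s x = of_bool (tm_val s t \<le> x \<and> x \<le> tm_val s u)"
| "cnt (Sep S T) s x = cnt S s x + cnt T s x"

text \<open>What coverage leaves open. For arrays this is the order of the endpoints: an empty
  interval contributes nothing to \<open>cnt\<close> and would go unnoticed there.\<close>

fun cells_ok :: "store \<Rightarrow> heap \<Rightarrow> spatial \<Rightarrow> bool" where
  "cells_ok s h Emp \<longleftrightarrow> True"
| "cells_ok s h (PointsTo t u) \<longleftrightarrow> h (tm_val s t) = Some (tm_val s u)"
| "cells_ok s h (Arr t u) \<longleftrightarrow> tm_val s t \<le> tm_val s u"
| "cells_ok s h (Sep S T) \<longleftrightarrow> cells_ok s h S \<and> cells_ok s h T"

lemma cells_ok_cong: "cells_ok s h S \<Longrightarrow> (\<And>x. 0 < cnt S s x \<Longrightarrow> h' x = h x) \<Longrightarrow> cells_ok s h' S"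
  by (induction S) auto

text \<open>Multiplicities replace the existential split of the heap: they add up over
  \<open>Sep\<close>, and disjointness of the parts means that no address is counted twice.\<close>

lemma sat_spatial_iff:
  "sat_spatial s h S \<longleftrightarrow> (\<forall>x. cnt S s x = of_bool (x \<in> dom h)) \<and> cells_ok s h S"
proof (induction S arbitrary: h)
  case (Sep S T)
  show ?case
  proof
    assume "sat_spatial s h (Sep S T)"
    then obtain h1 h2 where h: "dom h1 \<inter> dom h2 = {}" "h = h1 ++ h2"
      "\<forall>x. cnt S s x = of_bool (x \<in> dom h1)" "cells_ok s h1 S"
      "\<forall>x. cnt T s x = of_bool (x \<in> dom h2)" "cells_ok s h2 T"
      using Sep.IH by auto
    have "h x = h1 x" if "x \<in> dom h1" for x
      using h(1,2) that by (auto simp: map_add_def split: option.splits)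
    moreover have "h x = h2 x" if "x \<in> dom h2" for x
      using h(2) that by (auto simp: map_add_def)
    ultimately have "cells_ok s h S" "cells_ok s h T"
      using cells_ok_cong[OF h(4), of h] cells_ok_cong[OF h(6), of h] h(3,5) by auto
    moreover have "cnt S s x + cnt T s x = of_bool (x \<in> dom h)" for x
      using h(1,2,3,5) by auto
    ultimately show "(\<forall>x. cnt (Sep S T) s x = of_bool (x \<in> dom h)) \<and> cells_ok s h (Sep S T)"
      by simp
  next
    assume a: "(\<forall>x. cnt (Sep S T) s x = of_bool (x \<in> dom h)) \<and> cells_ok s h (Sep S T)"
    then have c: "cnt S s x + cnt T s x = of_bool (x \<in> dom h)" for x by simp
    \<comment> \<open>The parts of the split are forced: each conjunct owns the addresses that it
      covers.\<close>
    define h1 where "h1 = h |` {x. 0 < cnt S s x}"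
    define h2 where "h2 = h |` {x. 0 < cnt T s x}"
    have d1: "cnt S s x = of_bool (x \<in> dom h1)" and d2: "cnt T s x = of_bool (x \<in> dom h2)" for x
      using c[of x] by (auto simp: h1_def h2_def of_bool_def split: if_splits)
    have "cells_ok s h1 S" by (rule cells_ok_cong[of s h]) (use a in \<open>simp_all add: h1_def\<close>)
    then have "sat_spatial s h1 S" using d1 Sep.IH(1) by blast
    moreover have "cells_ok s h2 T" by (rule cells_ok_cong[of s h]) (use a in \<open>simp_all add: h2_def\<close>)
    then have "sat_spatial s h2 T" using d2 Sep.IH(2) by blast
    moreover have "dom h1 \<inter> dom h2 = {}"
    proof (rule ccontr)
      assume "dom h1 \<inter> dom h2 \<noteq> {}"
      then obtain x where "x \<in> dom h1" "x \<in> dom h2" by blast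
      with c[of x] d1[of x] d2[of x] show False by (auto simp: of_bool_def split: if_splits)
    qed
    moreover have "h = h1 ++ h2"
    proof
      fix x show "h x = (h1 ++ h2) x"
        using c[of x] by (cases "h x") (auto simp: h1_def h2_def map_add_def restrict_map_def of_bool_def split: if_splits)
    qed
    ultimately show "sat_spatial s h (Sep S T)" by auto
  qed
next
  case (PointsTo t u)
  have "(\<forall>x. (of_bool (x = tm_val s t) :: nat) = of_bool (x \<in> dom h)) \<longleftrightarrow> dom h = {tm_val s t}"
    by (simp only: of_bool_eq_iff set_eq_iff singleton_iff) blast
  then show ?case by simp
next
  case (Arr t u)
  have "(\<forall>x. (of_bool (tm_val s t \<le> x \<and> x \<le> tm_val s u) :: nat) = of_bool (x \<in> dom h)) \<longleftrightarrow>
      dom h = {x. tm_val s t \<le> x \<and> x \<le> tm_val s u}"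
    by (simp only: of_bool_eq_iff set_eq_iff mem_Collect_eq) blast
  then show ?case by auto
qed (auto simp: of_bool_def split: if_splits)


fun points :: "spatial \<Rightarrow> (tm \<times> tm) set" where
  "points Emp = {}"
| "points (PointsTo t u) = {(t, u)}"
| "points (Arr t u) = {}"
| "points (Sep S T) = points S \<union> points T"

lemma cells_ok_iff:
  "cells_ok s h S \<longleftrightarrow> (\<forall>(t, u)\<in>arrays S. tm_val s t \<le> tm_val s u) \<and>
     (\<forall>(t, u)\<in>points S. h (tm_val s t) = Some (tm_val s u))"
  by (induction S) auto

lemma code_Sep_ge: "code_spatial S + code_spatial T < code_spatial (Sep S T)"
  using less_prod_encode[of 3 "prod_encode (code_spatial S, code_spatial T)"]
    add_le_prod_encode[of "code_spatial S" "code_spatial T"] by simp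

lemma code_PointsTo_ge: "code_tm t + code_tm u < code_spatial (PointsTo t u)"
  using less_prod_encode[of 1 "prod_encode (code_tm t, code_tm u)"]
    add_le_prod_encode[of "code_tm t" "code_tm u"] by simp

lemma code_Arr_ge: "code_tm t + code_tm u + 2 \<le> code_spatial (Arr t u)"
  using add_le_prod_encode[of 2 "prod_encode (code_tm t, code_tm u)"]
    add_le_prod_encode[of "code_tm t" "code_tm u"] by simp

lemma code_points: "(t, u) \<in> points S \<Longrightarrow> code_tm t \<le> code_spatial S \<and> code_tm u \<le> code_spatial S"
proof (induction S)
  case (PointsTo t' u') then show ?case using code_PointsTo_ge[of t u] by auto
next
  case (Sep S T) then show ?case using code_Sep_ge[of S T] by force
qed simp_all

lemma code_arrays: "(t, u) \<in> arrays S \<Longrightarrow> code_tm t \<le> code_spatial S \<and> code_tm u \<le> code_spatial S"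
proof (induction S)
  case (Arr t' u') then show ?case using code_Arr_ge[of t u] by auto
next
  case (Sep S T) then show ?case using code_Sep_ge[of S T] by force
qed simp_all

lemma sat_spatial_cong:
  "code_spatial S < K \<Longrightarrow> (\<And>i. i < K \<Longrightarrow> s i = s' i) \<Longrightarrow> sat_spatial s h S \<longleftrightarrow> sat_spatial s' h S"
proof (induction S arbitrary: h)
  case (PointsTo t u)
  then have "code_tm t < K" "code_tm u < K" using code_PointsTo_ge[of t u] by linarith+
  then have "tm_val s t = tm_val s' t" "tm_val s u = tm_val s' u"
    using PointsTo.prems(2) by (auto intro: tm_val_cong_code)
  then show ?case by simp
next
  case (Arr t u)
  then have "code_tm t < K" "code_tm u < K" using code_Arr_ge[of t u] by linarith+
  then have "tm_val s t = tm_val s' t" "tm_val s u = tm_val s' u"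
    using Arr.prems(2) by (auto intro: tm_val_cong_code)
  then show ?case by simp
next
  case (Sep S T)
  then have "code_spatial S < K" "code_spatial T < K" using code_Sep_ge[of S T] by linarith+
  with Sep have "sat_spatial s h S = sat_spatial s' h S" "sat_spatial s h T = sat_spatial s' h T" for h
    by blast+
  then show ?case by simp
qed simp

lemma cnt_cong:
  "code_spatial S < K \<Longrightarrow> (\<And>i. i < K \<Longrightarrow> s i = s' i) \<Longrightarrow> cnt S s x = cnt S s' x"
proof (induction S)
  case (PointsTo t u)
  then have "code_tm t < K" using code_PointsTo_ge[of t u] by linarith
  then have "tm_val s t = tm_val s' t"
    using PointsTo.prems(2) by (auto intro: tm_val_cong_code)
  then show ?case by simp
next
  case (Arr t u)
  then have "code_tm t < K" "code_tm u < K" using code_Arr_ge[of t u] by linarith+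
  then have "tm_val s t = tm_val s' t" "tm_val s u = tm_val s' u"
    using Arr.prems(2) by (auto intro: tm_val_cong_code)
  then show ?case by simp
next
  case (Sep S T)
  then have "code_spatial S < K" "code_spatial T < K" using code_Sep_ge[of S T] by linarith+
  with Sep show ?case by simp
qed simp

lemma tm_val_le: "(\<And>i. i < K \<Longrightarrow> s i \<le> b) \<Longrightarrow> code_tm t < K \<Longrightarrow> tm_val s t \<le> K * Suc b"
proof -
  assume s: "\<And>i. i < K \<Longrightarrow> s i \<le> b" and t: "code_tm t < K"
  have "tm_vars t \<subseteq> {..<K} \<Longrightarrow> tm_val s t \<le> wt t * Suc b"
    using s by (induction t) (auto simp: add_mult_distrib intro: add_mono le_SucI trans_le_add1)
  also have "wt t * Suc b \<le> K * Suc b" using wt_le_code[of t] t by (intro mult_right_mono) auto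
  finally show ?thesis using tm_vars_code[OF t] by blast
qed

text \<open>Confines the domain of any heap described by \<open>S\<close>, both for the search and
  for finiteness of a rebuilt heap.\<close>

lemma cnt_pos_le:
  "0 < cnt S s x \<Longrightarrow> code_spatial S < K \<Longrightarrow> (\<And>i. i < K \<Longrightarrow> s i \<le> b) \<Longrightarrow> x \<le> K * Suc b"
proof (induction S)
  case (PointsTo t u)
  then have "code_tm t < K" using code_PointsTo_ge[of t u] by linarith
  with PointsTo show ?case using tm_val_le[of K s b t] by (auto split: if_splits)
next
  case (Arr t u)
  then have "code_tm u < K" using code_Arr_ge[of t u] by linarith
  with Arr have "tm_val s u \<le> K * Suc b" using tm_val_le[of K s b u] by blast
  moreover have "x \<le> tm_val s u" using Arr.prems(1) by simp
  ultimately show ?case by (rule le_trans[rotated])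
next
  case (Sep S T)
  then have "code_spatial S < K" "code_spatial T < K" using code_Sep_ge[of S T] by linarith+
  with Sep show ?case by (metis add_gr_0 cnt.simps(4))
qed simp

section \<open>Addresses of the right-hand side\<close>

text \<open>An interval \<open>st j\<close>..\<open>en j\<close> of a tiling of \<open>D\<close> either starts where a component of \<open>D\<close> starts, or
  directly after another interval. Hence all starting points are determined by \<open>D\<close> and the lengths.\<close>

lemma tiling_start:
  fixes st en :: "'j \<Rightarrow> nat"
  assumes D: "\<And>x. x \<in> D \<Longrightarrow> \<exists>i\<in>I. l i \<le> x \<and> (\<forall>y. l i \<le> y \<longrightarrow> y \<le> x \<longrightarrow> y \<in> D)"
    and le: "\<And>j. j \<in> J \<Longrightarrow> st j \<le> en j"
    and cov: "\<And>x. x \<in> D \<longleftrightarrow> (\<exists>j\<in>J. st j \<le> x \<and> x \<le> en j)"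
    and uniq: "\<And>x j j'. j \<in> J \<Longrightarrow> j' \<in> J \<Longrightarrow> st j \<le> x \<Longrightarrow> x \<le> en j \<Longrightarrow> st j' \<le> x \<Longrightarrow> x \<le> en j' \<Longrightarrow> j = j'"
    and J: "finite J"
    and j: "j \<in> J"
  shows "\<exists>i\<in>I. \<exists>A\<subseteq>J. (\<forall>a\<in>A. st a < st j) \<and> st j = l i + (\<Sum>a\<in>A. Suc (en a) - st a)"
  using j
proof (induction "st j" arbitrary: j rule: less_induct)
  case less
  have "st j \<in> D" using less.prems le cov by blast
  then obtain i where i: "i \<in> I" "l i \<le> st j" "\<forall>y. l i \<le> y \<longrightarrow> y \<le> st j \<longrightarrow> y \<in> D" using D by blast
  show ?case
  proof (cases "l i = st j")
    case True
    then show ?thesis using i(1) by (intro bexI[OF _ i(1)] exI[of _ "{}"]) simp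
  next
    case False
    then have p: "l i \<le> st j - 1" "st j - 1 < st j" using i(2) by auto
    then have "st j - 1 \<in> D" using i(3) by simp
    then obtain j' where j': "j' \<in> J" "st j' \<le> st j - 1" "st j - 1 \<le> en j'" using cov by blast
    have "\<not> st j \<le> en j'"
    proof
      assume "st j \<le> en j'"
      then have "j = j'" using uniq[OF less.prems j'(1), of "st j"] le[OF less.prems] j'(2) p by simp
      with j'(2) p show False by simp
    qed
    then have en: "Suc (en j') = st j" using j'(3) p by simp
    have lt: "st j' < st j" using j'(2) p by simp
    from less.hyps[OF lt j'(1)] obtain i' A where A: "i' \<in> I" "A \<subseteq> J" "\<forall>a\<in>A. st a < st j'"
      "st j' = l i' + (\<Sum>a\<in>A. Suc (en a) - st a)" by blast
    have "finite A" using A(2) J by (rule finite_subset)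
    \<comment> \<open>The clause on earlier starts is carried through the induction for this: the
      intervals of the chain are distinct, so each length is added once.\<close>
    moreover have "j' \<notin> A" using A(3) by blast
    ultimately have "st j = l i' + (\<Sum>a\<in>insert j' A. Suc (en a) - st a)"
      using A(4) en lt by simp
    moreover have "\<forall>a\<in>insert j' A. st a < st j" using A(3) lt by auto
    ultimately show ?thesis using A(1,2) j'(1) by (intro bexI[OF _ A(1)] exI[of _ "insert j' A"]) simp
  qed
qed

text \<open>The third component of an atom denotes its number of cells, for array atoms of the form
  \<open>Arr t (Add t u)\<close>.\<close>

fun atoms :: "spatial \<Rightarrow> (tm \<times> tm \<times> tm) list" where
  "atoms Emp = []"
| "atoms (PointsTo t u) = [(t, t, Num 1)]"
| "atoms (Arr t v) = [(t, v, case v of Add _ u \<Rightarrow> Add u (Num 1) | _ \<Rightarrow> Num 0)]"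
| "atoms (Sep S T) = atoms S @ atoms T"

lemma cnt_atoms:
  "cnt S s x = sum_list (map (\<lambda>(t, u, _). of_bool (tm_val s t \<le> x \<and> x \<le> tm_val s u)) (atoms S))"
  by (induction S) auto

text \<open>Indices are counted rather than atoms, because equal atoms may occur twice in the
  list.\<close>

lemma cnt_card:
  "cnt S s x = card {j. j < length (atoms S) \<and> tm_val s (fst (atoms S ! j)) \<le> x \<and> x \<le> tm_val s (fst (snd (atoms S ! j)))}"
proof -
  have "cnt S s x = (\<Sum>j<length (atoms S). of_bool (tm_val s (fst (atoms S ! j)) \<le> x \<and> x \<le> tm_val s (fst (snd (atoms S ! j)))))"
    unfolding cnt_atoms by (simp add: sum_list_sum_nth atLeast0LessThan case_prod_unfold)
  also have "\<dots> = card {j. j < length (atoms S) \<and> tm_val s (fst (atoms S ! j)) \<le> x \<and> x \<le> tm_val s (fst (snd (atoms S ! j)))}"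
    by (simp add: of_bool_def sum.If_cases Int_def conj_commute)
  finally show ?thesis .
qed

text \<open>Bounds the coefficients of any sum of lengths. The slack of 2 in
  \<open>code_Arr_ge\<close> pays for the added \<open>Num 1\<close> and for the \<open>Suc\<close>
  of \<open>wt_le_code\<close>.\<close>

lemma atoms_weight: "sum_list (map (\<lambda>a. wt (snd (snd a))) (atoms S)) \<le> code_spatial S"
proof (induction S)
  case (PointsTo t u) then show ?case using code_PointsTo_ge[of t u] by simp
next
  case (Arr t v) then show ?case
  proof (cases v)
    case (Add v1 v2)
    then show ?thesis using code_Arr_ge[of t v] wt_le_code[of v2] Add_code_less[of v1 v2]
      by (simp del: code_spatial.simps code_tm.simps)
  qed simp_all
next
  case (Sep S T) then show ?case using code_Sep_ge[of S T] by (simp del: code_spatial.simps)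
qed simp

lemma atoms_vars: "(t, v, z) \<in> set (atoms S) \<Longrightarrow> code_spatial S < K \<Longrightarrow> code_tm t < K \<and> tm_vars z \<subseteq> {..<K}"
proof (induction S)
  case (PointsTo t' u) then show ?case using code_PointsTo_ge[of t u] by (simp del: code_spatial.simps)
next
  case (Arr t' v')
  have le: "code_tm t' < K" "code_tm v' < K" using Arr.prems(2) code_Arr_ge[of t' v'] by linarith+
  show ?case
  proof (cases v')
    case (Add v1 v2)
    then show ?thesis using Arr.prems le tm_vars_code[of v' K] by simp
  qed (use Arr.prems le in auto)
next
  case (Sep S T)
  then have "code_spatial S < K" "code_spatial T < K" using code_Sep_ge[of S T] by linarith+
  with Sep show ?case by auto
qed simp

lemma atoms_size:
  "(t, v, z) \<in> set (atoms S) \<Longrightarrow> \<forall>(t, v)\<in>arrays S. \<exists>u. v = Add t u \<and> tm_vars u \<inter> Y = {} \<Longrightarrow>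
     Suc (tm_val s v) = tm_val s t + tm_val s z \<and> tm_vars z \<inter> Y = {}"
  by (induction S) (auto split: tm.splits)

lemma points_atoms: "(t, u) \<in> points S \<Longrightarrow> (t, t, Num 1) \<in> set (atoms S)"
  by (induction S) auto

lemma cells_ok_atoms: "cells_ok s h S \<Longrightarrow> (t, v, z) \<in> set (atoms S) \<Longrightarrow> tm_val s t \<le> tm_val s v"
  by (induction S) auto

text \<open>By \<open>tiling_start\<close> an address of \<open>S\<close> is a start of an atom of
  \<open>L\<close> plus a sum of lengths from \<open>S\<close>. The start is evaluated in
  \<open>s\<close>; by \<open>restr\<close> the lengths avoid \<open>Y\<close> and have the same
  value in \<open>s1\<close> as in \<open>s\<close>. The bound covers one start of \<open>L\<close>
  and all lengths of \<open>S\<close> together, whichever subset occurs.\<close>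

lemma address_form:
  assumes cnt: "\<And>x. cnt S s1 x = of_bool (0 < cnt L s x)"
    and ok: "cells_ok s1 h S"
    and restr: "\<forall>(t, v)\<in>arrays S. \<exists>u. v = Add t u \<and> tm_vars u \<inter> Y = {}"
    and s1: "\<And>i. i < K \<Longrightarrow> i \<notin> Y \<Longrightarrow> s1 i = s i"
    and codes: "code_spatial L < K" "code_spatial S < K"
    and point: "(t, u) \<in> points S"
  shows "\<exists>f. nlin K (Suc (code_spatial L) + code_spatial S) f \<and> tm_val s1 t = f s"
proof -
  let ?a = "atoms S" and ?J = "{..<length (atoms S)}"
  define st where "st j = tm_val s1 (fst (?a ! j))" for j
  define en where "en j = tm_val s1 (fst (snd (?a ! j)))" for j
  define sz where "sz j = snd (snd (?a ! j))" for j
  define D where "D = {x. 0 < cnt L s x}"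
  have tiles: "card {j. j < length ?a \<and> st j \<le> x \<and> x \<le> en j} = of_bool (x \<in> D)" for x
    using cnt[of x] unfolding cnt_card[of S] by (simp add: st_def en_def D_def)
  have fin: "finite {j. j < length ?a \<and> st j \<le> x \<and> x \<le> en j}" for x by simp
  have a: "(fst (?a ! j), fst (snd (?a ! j)), sz j) \<in> set ?a" if "j \<in> ?J" for j
    using that by (simp add: sz_def)
  \<comment> \<open>An address of \<open>D\<close> lies in some atom of \<open>L\<close>, which
    fills \<open>D\<close> from its start up to that address.\<close>
  have D: "\<exists>i\<in>set (atoms L). tm_val s (fst i) \<le> x \<and> (\<forall>y. tm_val s (fst i) \<le> y \<longrightarrow> y \<le> x \<longrightarrow> y \<in> D)" if "x \<in> D" for x
  proof -
    have "{j. j < length (atoms L) \<and> tm_val s (fst (atoms L ! j)) \<le> x \<and> x \<le> tm_val s (fst (snd (atoms L ! j)))} \<noteq> {}"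
      using that unfolding D_def cnt_card by (metis (no_types, lifting) card.empty less_irrefl mem_Collect_eq)
    then obtain j where j: "j < length (atoms L)" "tm_val s (fst (atoms L ! j)) \<le> x" "x \<le> tm_val s (fst (snd (atoms L ! j)))"
      by blast
    have "y \<in> D" if "tm_val s (fst (atoms L ! j)) \<le> y" "y \<le> x" for y
      unfolding D_def cnt_card using j that by (auto simp: card_gt_0_iff)
    then show ?thesis using j by (intro bexI[of _ "atoms L ! j"]) auto
  qed
  have le: "st j \<le> en j" if "j \<in> ?J" for j
    using cells_ok_atoms[OF ok a[OF that]] by (simp add: st_def en_def)
  have cov: "x \<in> D \<longleftrightarrow> (\<exists>j\<in>?J. st j \<le> x \<and> x \<le> en j)" for x
  proof -
    have "x \<in> D \<longleftrightarrow> card {j. j < length ?a \<and> st j \<le> x \<and> x \<le> en j} \<noteq> 0"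
      using tiles[of x] by simp
    also have "\<dots> \<longleftrightarrow> {j. j < length ?a \<and> st j \<le> x \<and> x \<le> en j} \<noteq> {}"
      using fin[of x] by (simp only: card_eq_0_iff) simp
    finally show ?thesis by auto
  qed
  have uniq: "j = j'" if "j \<in> ?J" "j' \<in> ?J" "st j \<le> x" "x \<le> en j" "st j' \<le> x" "x \<le> en j'" for x j j'
  proof -
    have "card {j. j < length ?a \<and> st j \<le> x \<and> x \<le> en j} \<le> Suc 0" using tiles[of x] by simp
    then show ?thesis using that fin[of x] by (auto simp: card_le_Suc0_iff_eq)
  qed
  from points_atoms[OF point] obtain j where j: "j \<in> ?J" "?a ! j = (t, t, Num 1)"
    by (metis in_set_conv_nth lessThan_iff)
  have "\<exists>i\<in>set (atoms L). \<exists>A\<subseteq>?J. (\<forall>a\<in>A. st a < st j) \<and>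
      st j = tm_val s (fst i) + (\<Sum>a\<in>A. Suc (en a) - st a)"
    by (rule tiling_start[OF D le cov _ finite_lessThan j(1)]) (assumption | rule uniq; assumption)+
  then obtain i A where i: "i \<in> set (atoms L)" and A: "A \<subseteq> ?J"
    and stj: "st j = tm_val s (fst i) + (\<Sum>a\<in>A. Suc (en a) - st a)" by auto
  have finA: "finite A" using A finite_subset by blast
  have size: "Suc (en a) - st a = tm_val s (sz a)" and vars: "tm_vars (sz a) \<subseteq> {..<K}" if "a \<in> A" for a
  proof -
    have aJ: "a \<in> ?J" using A that by blast
    show v: "tm_vars (sz a) \<subseteq> {..<K}" using atoms_vars[OF a[OF aJ] codes(2)] by simp
    from atoms_size[OF a[OF aJ] restr, of s1]
    have "Suc (en a) - st a = tm_val s1 (sz a)" "tm_vars (sz a) \<inter> Y = {}" by (auto simp: st_def en_def)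
    moreover have "tm_val s1 (sz a) = tm_val s (sz a)"
      using calculation(2) v by (intro tm_val_cong s1) auto
    ultimately show "Suc (en a) - st a = tm_val s (sz a)" by simp
  qed
  let ?f = "\<lambda>s. tm_val s (fst i) + (\<Sum>a\<in>A. tm_val s (sz a))"
  have "nlin K (wt (fst i) + (\<Sum>a\<in>A. wt (sz a))) ?f"
    using atoms_vars[of "fst i" "fst (snd i)" "snd (snd i)" L K] i codes(1) vars
    by (intro nlin_add nlin_sum nlin_tm_val finA) (auto dest!: tm_vars_code)
  moreover have "wt (fst i) \<le> Suc (code_spatial L)"
    using atoms_vars[of "fst i" "fst (snd i)" "snd (snd i)" L "Suc (code_spatial L)"] i wt_le_code[of "fst i"] by simp
  moreover have "(\<Sum>a\<in>A. wt (sz a)) \<le> (\<Sum>a\<in>?J. wt (sz a))" using A by (intro sum_mono2) auto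
  moreover have "(\<Sum>a\<in>?J. wt (sz a)) \<le> code_spatial S"
    using atoms_weight[of S] by (simp add: sum_list_sum_nth atLeast0LessThan sz_def)
  ultimately have "nlin K (Suc (code_spatial L) + code_spatial S) ?f"
    by (elim nlin_mono) linarith
  moreover have "tm_val s1 t = ?f s" using stj size j(2) by (simp add: st_def)
  ultimately show ?thesis by blast
qed

section \<open>Codes of linear forms\<close>

definition fval :: "nat \<Rightarrow> nat \<Rightarrow> store \<Rightarrow> nat" where
  "fval K c s = get c 0 + (\<Sum>i<K. get c (Suc i) * s i)"

text \<open>The bound on \<open>c\<close> makes the set finite, so that each code can own a variable
  for the content of the cell it addresses. Distinct codes may denote the same form.\<close>

definition forms :: "nat \<Rightarrow> nat \<Rightarrow> nat set" where
  "forms K M = {c. c < seq_bound M (Suc K) \<and> (\<forall>i\<le>K. get c i \<le> M)}"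

lemma nlin_fval: "c \<in> forms K M \<Longrightarrow> nlin K M (fval K c)"
  by (rule nlinI[where c = "\<lambda>i. get c (Suc i)" and d = "get c 0"]) (auto simp: forms_def fval_def simp del: get.simps)

lemma ex_form:
  assumes "nlin K M f" shows "\<exists>c\<in>forms K M. \<forall>s. f s = fval K c s"
proof -
  from assms obtain c d where f: "\<forall>i<K. c i \<le> M" "d \<le> M" "\<And>s. f s = d + (\<Sum>i<K. c i * s i)"
    unfolding nlin_def by blast
  have "case_nat d c i \<le> M" if "i < Suc K" for i using f that by (cases i) auto
  from ex_code_bounded[of "Suc K" "case_nat d c" M, OF this] obtain e
    where e: "e < seq_bound M (Suc K)" "\<forall>i<Suc K. get e i = case_nat d c i" by blast
  have "get e i \<le> M" if "i \<le> K" for i using e f that by (cases i) (auto simp del: get.simps)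
  moreover have "get e 0 = d" "\<And>i. i < K \<Longrightarrow> get e (Suc i) = c i" using e(2) by (auto simp del: get.simps)
  ultimately show ?thesis using e(1) f(3)
    by (intro bexI[of _ e]) (auto simp: forms_def fval_def simp del: get.simps)
qed

lemma fval_cong: "(\<And>i. i < K \<Longrightarrow> s i = s' i) \<Longrightarrow> fval K c s = fval K c s'"
  by (simp add: fval_def)

lemma sat_exs_iff:
  "sat_exs s h ys P S \<longleftrightarrow> (\<exists>s1. (\<forall>i. i \<notin> set ys \<longrightarrow> s1 i = s i) \<and> sat_pure s1 P \<and> sat_spatial s1 h S)"
proof (induction ys arbitrary: s)
  case Nil
  have "(\<forall>i. s1 i = s i) \<longleftrightarrow> s1 = s" for s1 by auto
  then show ?case by simp
next
  case (Cons y ys)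
  show ?case
  proof
    assume "sat_exs s h (y # ys) P S"
    then obtain a where "sat_exs (s(y := a)) h ys P S" by auto
    then obtain s1 where "\<forall>i. i \<notin> set ys \<longrightarrow> s1 i = (s(y := a)) i" "sat_pure s1 P" "sat_spatial s1 h S"
      unfolding Cons.IH by blast
    then show "\<exists>s1. (\<forall>i. i \<notin> set (y # ys) \<longrightarrow> s1 i = s i) \<and> sat_pure s1 P \<and> sat_spatial s1 h S"
      by (intro exI[of _ s1]) simp
  next
    assume "\<exists>s1. (\<forall>i. i \<notin> set (y # ys) \<longrightarrow> s1 i = s i) \<and> sat_pure s1 P \<and> sat_spatial s1 h S"
    then obtain s1 where s1: "\<forall>i. i \<notin> set (y # ys) \<longrightarrow> s1 i = s i" "sat_pure s1 P" "sat_spatial s1 h S" by blast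
    then have "sat_exs (s(y := s1 y)) h ys P S" unfolding Cons.IH by (intro exI[of _ s1]) auto
    then show "sat_exs s h (y # ys) P S" by auto
  qed
qed

lemma list_encode_bounds: "length xs \<le> list_encode xs" "x \<in> set xs \<Longrightarrow> x < list_encode xs"
proof (induction xs)
  case (Cons a xs)
  have le: "a \<le> prod_encode (a, list_encode xs)" "list_encode xs \<le> prod_encode (a, list_encode xs)"
    by (rule le_prod_encode_1 le_prod_encode_2)+
  { case 1 show ?case using Cons.IH(1) le(2) by simp }
  { case 2 then show ?case using Cons.IH(2) le by (auto simp: less_Suc_eq_le) }
qed simp_all


section \<open>Bounded countermodels\<close>

text \<open>The variables below \<open>Suc n\<close> form the current store, the next \<open>Suc n\<close> ones a copy of the
  store of the left-hand side, and the next ones hold the contents of the cells whose addresses are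
  given by the linear forms in that copy. One further variable serves as an auxiliary address.\<close>

context
  fixes n :: nat
begin

abbreviation (input) "nv \<equiv> Suc n"
abbreviation (input) "mc \<equiv> Suc (2 * n)"

definition xvars :: nat where
  "xvars = Suc (2 * nv + seq_bound mc (Suc nv))"

definition saved :: "store \<Rightarrow> store" where
  "saved \<sigma> = (\<lambda>i. \<sigma> (nv + i))"

text \<open>The domain is fixed by \<open>L\<close> and the saved store. Only cells in the domain
  constrain their variables; a form with its value elsewhere leaves its variable free.\<close>

definition linked :: "spatial \<Rightarrow> store \<Rightarrow> heap \<Rightarrow> bool" where
  "linked L \<sigma> h \<longleftrightarrow> dom h = {x. 0 < cnt L (saved \<sigma>) x} \<and>
     (\<forall>c\<in>forms nv mc. \<forall>v. h (fval nv c (saved \<sigma>)) = Some v \<longrightarrow> \<sigma> (2 * nv + c) = v)"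

lemma xvars_ge: "nv + nv \<le> xvars" "nv \<le> xvars" "c \<in> forms nv mc \<Longrightarrow> Suc (2 * nv + c) < xvars"
  by (auto simp: xvars_def forms_def)

lemma nlin_saved: "nlin nv M f \<Longrightarrow> nlin xvars M (\<lambda>\<sigma>. f (saved \<sigma>))"
  unfolding saved_def by (rule nlin_shift[OF _ xvars_ge(1)])

text \<open>A multiplicity is decided by comparing \<open>g\<close> with endpoints of atoms, which
  are linear forms of the same level. The offset \<open>k\<close> selects the current store or the
  saved copy.\<close>

lemma cnt_eqv:
  assumes "eqv xvars mc \<sigma> \<tau>" "code_spatial S \<le> n" "k + nv \<le> xvars" "nlin xvars mc g"
  shows "cnt S (\<lambda>i. \<sigma> (k + i)) (g \<sigma>) = cnt S (\<lambda>i. \<tau> (k + i)) (g \<tau>)"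
  using assms(2)
proof (induction S)
  case (PointsTo t u)
  then have "nlin nv mc (\<lambda>s. tm_val s t)"
    using code_PointsTo_ge[of t u] by (intro nlin_tm_code; linarith)
  from nlin_eqv_eq[OF assms(4) nlin_shift[OF this assms(3)] assms(1)] show ?case by simp
next
  case (Arr t u)
  then have t: "nlin nv mc (\<lambda>s. tm_val s t)" and u: "nlin nv mc (\<lambda>s. tm_val s u)"
    using code_Arr_ge[of t u] by (intro nlin_tm_code; linarith)+
  show ?case using nlin_eqv_le[OF nlin_shift[OF t assms(3)] assms(4,1)]
      nlin_eqv_le[OF assms(4) nlin_shift[OF u assms(3)] assms(1)] by simp
next
  case (Sep S T)
  then have "code_spatial S \<le> n" "code_spatial T \<le> n" using code_Sep_ge[of S T] by linarith+
  with Sep show ?case by simp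
qed simp

text \<open>Coverage concerns every address. An address of one side is put into the spare last
  variable and answered on the other, where coverage by \<open>S\<close> and membership in the
  domain agree with it; this costs the one \<open>lvl\<close>. Contents pass through the variables
  attached to the forms that give the addresses.\<close>

lemma transport:
  assumes e: "eqv xvars (lvl mc) \<sigma> \<tau>" and l: "linked L \<sigma> h" "linked L \<tau> h'"
    and codes: "code_spatial L \<le> n" "code_spatial S \<le> n"
    and addr: "\<And>t u. (t, u) \<in> points S \<Longrightarrow> \<exists>c\<in>forms nv mc. tm_val \<sigma> t = fval nv c (saved \<sigma>)"
    and sat: "sat_spatial \<sigma> h S"
  shows "sat_spatial \<tau> h' S"
proof -
  have e': "eqv xvars mc \<sigma> \<tau>" using e lvl_ge by (rule eqv_mono)
  from sat have cnt: "\<And>x. cnt S \<sigma> x = of_bool (x \<in> dom h)" and ok: "cells_ok \<sigma> h S"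
    by (auto simp: sat_spatial_iff)
  define X where "X = xvars - 1"
  have X: "X < xvars" and X_ge: "nv \<le> X" "nv + nv \<le> X" by (auto simp: X_def xvars_def)
  have same: "cnt S \<tau> x = of_bool (x \<in> dom h')" for x
  proof -
    obtain x' where x': "eqv xvars mc (\<tau>(X := x)) (\<sigma>(X := x'))"
      using eqv_extend[OF eqv_sym[OF e] X] by metis
    have g: "nlin xvars mc (\<lambda>s. s X)" using X by (rule nlin_var) simp
    have 1: "cnt S \<tau> x = cnt S \<sigma> x'"
    proof -
      have "cnt S (\<tau>(X := x)) x = cnt S (\<sigma>(X := x')) x'"
        using cnt_eqv[OF x' codes(2) _ g, of 0] xvars_ge(2) by (simp add: fun_upd_def)
      moreover have "cnt S (\<tau>(X := x)) x = cnt S \<tau> x" "cnt S (\<sigma>(X := x')) x' = cnt S \<sigma> x'"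
        using codes X_ge by (intro cnt_cong[of _ nv]; simp)+
      ultimately show ?thesis by simp
    qed
    have 2: "cnt L (saved \<tau>) x = cnt L (saved \<sigma>) x'"
    proof -
      have "cnt L (\<lambda>i. (\<tau>(X := x)) (nv + i)) x = cnt L (\<lambda>i. (\<sigma>(X := x')) (nv + i)) x'"
        using cnt_eqv[OF x' codes(1) xvars_ge(1) g] by simp
      moreover have "cnt L (\<lambda>i. (\<tau>(X := x)) (nv + i)) x = cnt L (saved \<tau>) x"
        "cnt L (\<lambda>i. (\<sigma>(X := x')) (nv + i)) x' = cnt L (saved \<sigma>) x'"
        using codes X_ge by (intro cnt_cong[of _ nv]; simp add: saved_def)+
      ultimately show ?thesis by simp
    qed
    have "x \<in> dom h' \<longleftrightarrow> x' \<in> dom h" using l 2 by (simp add: linked_def)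
    then show ?thesis using 1 cnt[of x'] by simp
  qed
  have tm: "nlin xvars mc (\<lambda>s. tm_val s t)" if "code_tm t \<le> n" for t
    using that by (intro nlin_widen[OF nlin_tm_code xvars_ge(2)]) auto
  have "tm_val \<tau> t \<le> tm_val \<tau> u" if "(t, u) \<in> arrays S" for t u
  proof -
    have "code_tm t \<le> n" "code_tm u \<le> n" using code_arrays[OF that] codes by auto
    from nlin_eqv_le[OF this[THEN tm] e'] show ?thesis using ok that by (auto simp: cells_ok_iff)
  qed
  moreover have "h' (tm_val \<tau> t) = Some (tm_val \<tau> u)" if tu: "(t, u) \<in> points S" for t u
  proof -
    have code: "code_tm t \<le> n" "code_tm u \<le> n" using code_points[OF tu] codes by auto
    from addr[OF tu] obtain c where c: "c \<in> forms nv mc" "tm_val \<sigma> t = fval nv c (saved \<sigma>)" by blast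
    have "h (fval nv c (saved \<sigma>)) = Some (tm_val \<sigma> u)" using ok tu c(2) by (auto simp: cells_ok_iff)
    then have "\<sigma> (2 * nv + c) = tm_val \<sigma> u" using l(1) c(1) by (auto simp: linked_def)
    then have u: "\<tau> (2 * nv + c) = tm_val \<tau> u"
      using nlin_eqv_eq[OF nlin_var tm[OF code(2)] e', of "2 * nv + c"] xvars_ge(3)[OF c(1)] by simp
    have t: "tm_val \<tau> t = fval nv c (saved \<tau>)"
      using nlin_eqv_eq[OF tm[OF code(1)] nlin_saved[OF nlin_fval[OF c(1)]] e'] c(2) by simp
    have "cnt S \<sigma> (tm_val \<sigma> t) = cnt S \<tau> (tm_val \<tau> t)"
      using cnt_eqv[OF e' codes(2) _ tm[OF code(1)], of 0] xvars_ge(2) by simp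
    then have "(of_bool (tm_val \<sigma> t \<in> dom h) :: nat) = of_bool (tm_val \<tau> t \<in> dom h')"
      by (simp only: cnt same)
    moreover have "tm_val \<sigma> t \<in> dom h" using ok tu by (auto simp: cells_ok_iff)
    ultimately have "tm_val \<tau> t \<in> dom h'" by (simp only: of_bool_eq_iff)
    then obtain v where v: "h' (tm_val \<tau> t) = Some v" by (auto simp: dom_def)
    then have "\<tau> (2 * nv + c) = v" using l(2) c(1) t unfolding linked_def by metis
    then show ?thesis using u v by simp
  qed
  ultimately show ?thesis unfolding sat_spatial_iff cells_ok_iff using same by auto
qed

definition level :: "nat \<Rightarrow> nat" where "level i = (lvl ^^ i) mc"
text \<open>Leaves a level for each of the \<open>xvars\<close> variables of a countermodel on top
  of the \<open>2 * n + 1\<close> levels that \<open>symheap_transfer\<close> asks for. It dominates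
  every level met, so one function \<open>grow\<close> serves throughout.\<close>

definition top_level :: nat where "top_level = level (xvars + (2 * n + 2))"
text \<open>Bounds all values after \<open>j\<close> successive answers that start from the zero
  store.\<close>

definition bnd :: "nat \<Rightarrow> nat" where "bnd j = (grow xvars top_level ^^ j) 0"

lemma level_mono: "i \<le> j \<Longrightarrow> level i \<le> level j"
  unfolding level_def by (rule funpow_lvl_mono)

lemma bnd_mono: "i \<le> j \<Longrightarrow> bnd i \<le> bnd j"
  unfolding bnd_def by (rule funpow_grow_mono)

text \<open>The block consumes at most \<open>n\<close> of the \<open>2 * n + 1\<close> levels. The
  remaining \<open>n + 1\<close> cover the quantifiers of \<open>P\<close>, at most \<open>n\<close>
  deep, and the one level of \<open>transport\<close>. By \<open>save\<close>, unbound variables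
  still agree with the saved copy, as \<open>address_form\<close> requires.\<close>

lemma symheap_transfer:
  assumes e: "eqv xvars (level (2 * n + 1)) \<sigma> \<tau>" and l: "linked L \<sigma> h" "linked L \<tau> h'"
    and codes: "code_spatial L \<le> n" "code_spatial S \<le> n" "code_pure P \<le> n" "list_encode ys \<le> n"
    and restr: "restricted_symheap (Exists ys P S)"
    and save: "\<And>i. i < nv \<Longrightarrow> \<sigma> (nv + i) = \<sigma> i"
    and s1: "\<And>i. i \<notin> set ys \<Longrightarrow> s1 i = \<sigma> i" "sat_pure s1 P" "sat_spatial s1 h S"
  shows "\<exists>t1. (\<forall>i. i \<notin> set ys \<longrightarrow> t1 i = \<tau> i) \<and> sat_pure t1 P \<and> sat_spatial t1 h' S \<and>
    (\<forall>k. (\<forall>i<xvars. \<tau> i \<le> bnd k) \<longrightarrow> (\<forall>i<xvars. t1 i \<le> bnd (k + n)))"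
proof -
  have ys: "length ys \<le> n" "set ys \<subseteq> {..<nv}" 
    using list_encode_bounds(1)[of ys] list_encode_bounds(2)[of _ ys] codes(4) by fastforce+
  then have ys': "set ys \<subseteq> {..<xvars}" using xvars_ge(2) by fastforce
  have lv: "(lvl ^^ length ys) (level (n + 1)) = level (length ys + (n + 1))"
    by (simp only: level_def funpow_add o_apply)
  have e0: "eqv xvars ((lvl ^^ length ys) (level (n + 1))) \<sigma> \<tau>"
    using e unfolding lv by (rule eqv_mono) (use ys in \<open>auto intro: level_mono\<close>)
  have le: "(lvl ^^ length ys) (level (n + 1)) \<le> top_level"
    unfolding lv top_level_def using ys by (intro level_mono) auto
  obtain t1 where t1: "eqv xvars (level (n + 1)) s1 t1" "\<And>i. i \<notin> set ys \<Longrightarrow> t1 i = \<tau> i"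
    and b: "\<And>b i. (\<And>i. i < xvars \<Longrightarrow> \<tau> i \<le> b) \<Longrightarrow> i < xvars \<Longrightarrow> t1 i \<le> (grow xvars top_level ^^ length ys) b"
    by (rule eqv_extend_list[OF e0 ys' s1(1) le]) blast+
  \<comment> \<open>Bound variables lie below \<open>Suc n\<close>, so the saved copy and the
    contents variables survive the block, even where a bound name also occurs on the left.\<close>
  have hi: "s1 i = \<sigma> i" "t1 i = \<tau> i" if "nv \<le> i" for i
    using that ys(2) by (auto intro!: s1(1) t1(2))
  have saved: "saved s1 = saved \<sigma>" "saved t1 = saved \<tau>" by (auto simp: saved_def hi)
  have l1: "linked L s1 h" "linked L t1 h'" using l by (auto simp: linked_def saved hi)
  show ?thesis
  proof (intro exI[of _ t1] conjI allI impI)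
    show "t1 i = \<tau> i" if "i \<notin> set ys" for i using that by (rule t1(2))
    have "eqv xvars ((lvl ^^ code_pure P) mc) s1 t1"
      using t1(1) by (rule eqv_mono) (use codes in \<open>auto simp: level_def simp del: funpow.simps intro: funpow_lvl_mono\<close>)
    then show "sat_pure t1 P" using sat_pure_eqv[of P xvars mc s1 t1] s1(2) codes xvars_ge(2) by simp
    have "level 1 \<le> level (n + 1)" by (rule level_mono) simp
    then have e1: "eqv xvars (lvl mc) s1 t1" using t1(1) by (auto simp: level_def elim: eqv_mono)
    show "sat_spatial t1 h' S"
    proof (rule transport[OF e1 l1 codes(1,2) _ s1(3)])
      fix t u assume tu: "(t, u) \<in> points S"
      have "\<exists>f. nlin nv (Suc (code_spatial L) + code_spatial S) f \<and> tm_val s1 t = f (saved s1)"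
      proof (rule address_form[OF _ _ _ _ _ _ tu])
        show "cnt S s1 x = of_bool (0 < cnt L (saved s1) x)" for x
          using s1(3) l1(1) by (simp add: sat_spatial_iff linked_def)
        show "cells_ok s1 h S" using s1(3) by (simp add: sat_spatial_iff)
        show "\<forall>(t, v)\<in>arrays S. \<exists>u. v = Add t u \<and> tm_vars u \<inter> set ys = {}" using restr by simp
        show "s1 i = saved s1 i" if "i < nv" "i \<notin> set ys" for i
          using that save[of i] s1(1) unfolding saved by (simp add: saved_def)
      qed (use codes in auto)
      then obtain f where f: "nlin nv (Suc (code_spatial L) + code_spatial S) f" "tm_val s1 t = f (saved s1)" by blast
      then have "nlin nv mc f" using codes by (auto elim: nlin_mono)
      from ex_form[OF this] f(2) show "\<exists>c\<in>forms nv mc. tm_val s1 t = fval nv c (saved s1)" by auto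
    qed
    fix k i assume \<tau>: "\<forall>i<xvars. \<tau> i \<le> bnd k" and i: "i < xvars"
    have "t1 i \<le> (grow xvars top_level ^^ length ys) (bnd k)" using \<tau> by (intro b[OF _ i]) blast
    also have "\<dots> = bnd (length ys + k)" by (simp add: bnd_def funpow_add)
    also have "\<dots> \<le> bnd (k + n)" using ys by (intro bnd_mono) simp
    finally show "t1 i \<le> bnd (k + n)" .
  qed
qed

section \<open>Countermodels with bounded values\<close>

definition cell :: "heap \<Rightarrow> nat \<Rightarrow> nat" where
  "cell h x = (case h x of None \<Rightarrow> 0 | Some v \<Rightarrow> v)"

text \<open>The final 0 covers the auxiliary variable and all indices from \<open>xvars\<close> on.
  There the store thus agrees with the zero store from which \<open>bounded_countermodel\<close>
  starts.\<close>

definition xstore :: "store \<Rightarrow> heap \<Rightarrow> store" where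
  "xstore s h = (\<lambda>i. if i < nv then s i else if i < 2 * nv then s (i - nv)
     else if i < xvars - 1 then cell h (fval nv (i - 2 * nv) s) else 0)"

lemma xstore_simps0: "i < nv \<Longrightarrow> xstore s h i = s i" "i < nv \<Longrightarrow> xstore s h (nv + i) = s i"
    "c \<in> forms nv mc \<Longrightarrow> xstore s h (2 * nv + c) = cell h (fval nv c s)" "xvars \<le> i \<Longrightarrow> xstore s h i = 0"
  using xvars_ge(1) xvars_ge(3)[of c] by (auto simp: xstore_def)

lemmas xstore_simps = xstore_simps0 xstore_simps0[simplified]

lemma linked_xstore:
  assumes "sat_spatial s h L" "code_spatial L \<le> n" shows "linked L (xstore s h) h"
proof -
  have sv: "saved (xstore s h) i = s i" if "i < nv" for i using that by (simp add: saved_def xstore_simps)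
  have "cnt L (saved (xstore s h)) x = cnt L s x" for x
    using assms(2) sv by (intro cnt_cong[of _ nv]) auto
  moreover have "dom h = {x. 0 < cnt L s x}" using assms(1) by (auto simp: sat_spatial_iff)
  moreover have "fval nv c (saved (xstore s h)) = fval nv c s" for c by (rule fval_cong) (rule sv)
  ultimately show ?thesis by (auto simp: linked_def xstore_simps cell_def)
qed

text \<open>The block adds at most \<open>n\<close> answers to the \<open>xvars\<close> ones behind
  the store itself, whence the bound.\<close>

definition bsat :: "store \<Rightarrow> heap \<Rightarrow> symheap \<Rightarrow> bool" where
  "bsat s h D = (case D of Exists ys P S \<Rightarrow> \<exists>s1. (\<forall>i. i \<notin> set ys \<longrightarrow> s1 i = s i) \<and>
     (\<forall>i<nv. s1 i \<le> bnd (xvars + n)) \<and> sat_pure s1 P \<and> sat_spatial s1 h S)"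

text \<open>\<open>symheap_transfer\<close> from the extended store to itself replaces arbitrary
  witnesses by bounded ones.\<close>

lemma bsat_iff:
  assumes "code_symheap D \<le> n" "restricted_symheap D" "code_spatial L \<le> n" "sat_spatial s h L"
    and s: "\<And>i. i < nv \<Longrightarrow> s i \<le> bnd xvars" and h: "\<And>x v. h x = Some v \<Longrightarrow> v \<le> bnd xvars"
  shows "bsat s h D \<longleftrightarrow> sat_symheap s h D"
proof (cases D)
  case (Exists ys P S)
  have codes: "list_encode ys \<le> n" "code_pure P \<le> n" "code_spatial S \<le> n"
    using assms(1) add_le_prod_encode[of "list_encode ys" "prod_encode (code_pure P, code_spatial S)"]
      add_le_prod_encode[of "code_pure P" "code_spatial S"] by (simp_all add: Exists)
  have "sat_symheap s h D \<Longrightarrow> bsat s h D"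
  proof -
    assume "sat_symheap s h D"
    then obtain s1 where s1: "\<forall>i. i \<notin> set ys \<longrightarrow> s1 i = s i" "sat_pure s1 P" "sat_spatial s1 h S"
      by (auto simp: Exists sat_exs_iff)
    \<comment> \<open>From \<open>Suc n\<close> on the witness store is overwritten by the saved
      copy and the contents, at indices that occur in neither \<open>P\<close> nor
      \<open>S\<close>.\<close>
    let ?s1 = "\<lambda>i. if i < nv then s1 i else xstore s h i"
    have sat: "sat_pure ?s1 P" "sat_spatial ?s1 h S"
      using s1 codes sat_pure_cong[of P nv ?s1 s1] sat_spatial_cong[of S nv ?s1 s1 h] by auto
    have agree: "?s1 i = xstore s h i" if "i \<notin> set ys" for i using s1(1) that by (simp add: xstore_simps)
    have save: "xstore s h (nv + i) = xstore s h i" if "i < nv" for i using that by (simp add: xstore_simps)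
    note l = linked_xstore[OF assms(4,3)]
    from symheap_transfer[OF eqv_refl l l assms(3) codes(3,2,1) assms(2)[unfolded Exists] save agree sat]
    obtain t1 where t1: "\<forall>i. i \<notin> set ys \<longrightarrow> t1 i = xstore s h i" "sat_pure t1 P" "sat_spatial t1 h S"
      and b: "\<forall>k. (\<forall>i<xvars. xstore s h i \<le> bnd k) \<longrightarrow> (\<forall>i<xvars. t1 i \<le> bnd (k + n))"
      by blast
    have "xstore s h i \<le> bnd xvars" for i
      using s h by (auto simp: xstore_def cell_def split: option.split)
    with b have t1b: "t1 i \<le> bnd (xvars + n)" if "i < nv" for i
      using that xvars_ge(2) by (meson less_le_trans)
    let ?t1 = "\<lambda>i. if i < nv then t1 i else s i"
    have "sat_pure ?t1 P" "sat_spatial ?t1 h S"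
      using t1 codes sat_pure_cong[of P nv ?t1 t1] sat_spatial_cong[of S nv ?t1 t1 h] by auto
    moreover have "?t1 i = s i" if "i \<notin> set ys" for i using t1(1) that by (simp add: xstore_simps)
    ultimately show "bsat s h D" using t1b by (auto simp: bsat_def Exists intro!: exI[of _ ?t1])
  qed
  moreover have "bsat s h D \<Longrightarrow> sat_symheap s h D"
    by (auto simp: Exists bsat_def sat_exs_iff)
  ultimately show ?thesis by blast
qed

text \<open>An equivalent small store is found first, and a heap is then read off from its contents
  variables. What holds on the left is transported forwards; a disjunct true in the result would be
  transported back.\<close>

lemma bounded_countermodel:
  assumes codes: "code_pure P \<le> n" "code_spatial L \<le> n" "\<And>D. D \<in> set Ds \<Longrightarrow> code_symheap D \<le> n"
    and restr: "\<And>D. D \<in> set Ds \<Longrightarrow> restricted_symheap D"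
    and heap: "is_heap h" and P: "sat_pure s P" and L: "sat_spatial s h L"
    and Ds: "\<And>D. D \<in> set Ds \<Longrightarrow> \<not> sat_symheap s h D"
  shows "\<exists>s' h'. (\<forall>i<nv. s' i \<le> bnd xvars) \<and> is_heap h' \<and> (\<forall>x v. h' x = Some v \<longrightarrow> v \<le> bnd xvars) \<and>
    sat_pure s' P \<and> sat_spatial s' h' L \<and> (\<forall>D\<in>set Ds. \<not> sat_symheap s' h' D)"
proof -
  let ?\<sigma> = "xstore s h"
  let ?N = "level (2 * n + 1)"
  have lv: "(lvl ^^ length [0..<xvars]) ?N \<le> top_level"
  proof -
    have "(lvl ^^ length [0..<xvars]) ?N = level (xvars + (2 * n + 1))"
      by (simp only: level_def funpow_add o_apply length_upt diff_zero)
    then show ?thesis unfolding top_level_def by (simp add: level_mono del: funpow.simps)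
  qed
  \<comment> \<open>From a pair of zero stores, the values of the given extended store are played
    one by one and answered by small values.\<close>
  obtain \<tau> where e: "eqv xvars ?N ?\<sigma> \<tau>"
    and b: "\<And>b i. (\<And>i. i < xvars \<Longrightarrow> 0 \<le> b) \<Longrightarrow> i < xvars \<Longrightarrow> \<tau> i \<le> (grow xvars top_level ^^ length [0..<xvars]) b"
    by (rule eqv_extend_list[of xvars "[0..<xvars]" ?N "\<lambda>_. 0" "\<lambda>_. 0" ?\<sigma> top_level])
       (use lv in \<open>auto simp: eqv_refl xstore_simps\<close>)
  have b: "\<tau> i \<le> bnd xvars" if "i < xvars" for i using b[of 0 i] that by (simp add: bnd_def)
  have "level 1 \<le> ?N" by (rule level_mono) simp
  then have e1: "eqv xvars (lvl mc) ?\<sigma> \<tau>" using e by (auto simp: level_def elim: eqv_mono)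
  then have e0: "eqv xvars mc ?\<sigma> \<tau>" using lvl_ge by (rule eqv_mono)
  \<comment> \<open>Equality of the two copies is a comparison of linear forms, so it is
    inherited.\<close>
  have save: "\<tau> (nv + i) = \<tau> i" if "i < nv" for i
    using nlin_eqv_eq[OF nlin_var nlin_var e0, of "nv + i" i] that xvars_ge(1) by (simp add: xstore_simps)
  define F where "F x = (SOME c. c \<in> forms nv mc \<and> fval nv c (saved \<tau>) = x)" for x
  \<comment> \<open>A cell takes its content from the variable of a form with that address, chosen
    by \<open>F\<close>. Cells addressed by no form get the default 0.\<close>
  define h' :: heap where "h' x = (if 0 < cnt L (saved \<tau>) x then
      Some (if \<exists>c\<in>forms nv mc. fval nv c (saved \<tau>) = x then \<tau> (2 * nv + F x) else 0) else None)" for x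
  have F: "F x \<in> forms nv mc" "fval nv (F x) (saved \<tau>) = x" if "\<exists>c\<in>forms nv mc. fval nv c (saved \<tau>) = x" for x
    using that someI_ex[of "\<lambda>c. c \<in> forms nv mc \<and> fval nv c (saved \<tau>) = x"] by (auto simp: F_def)
  \<comment> \<open>The choice made by \<open>F\<close> does not matter: forms equal in the new
    store are equal in the given one, where their variables hold the content of one cell, and
    equality of variables is inherited.\<close>
  have unique: "\<tau> (2 * nv + c) = \<tau> (2 * nv + c')"
    if c: "c \<in> forms nv mc" "c' \<in> forms nv mc" "fval nv c (saved \<tau>) = fval nv c' (saved \<tau>)" for c c'
  proof -
    have "fval nv c (saved ?\<sigma>) = fval nv c' (saved ?\<sigma>)"
      using nlin_eqv_eq[OF nlin_saved[OF nlin_fval[OF c(1)]] nlin_saved[OF nlin_fval[OF c(2)]] e0] c(3) by simp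
    moreover have "fval nv c (saved ?\<sigma>) = fval nv c s" for c
      by (rule fval_cong) (simp add: saved_def xstore_simps)
    ultimately have "?\<sigma> (2 * nv + c) = ?\<sigma> (2 * nv + c')" using c by (simp add: xstore_simps)
    then show ?thesis
      using nlin_eqv_eq[OF nlin_var nlin_var e0, of "2 * nv + c" "2 * nv + c'"]
        xvars_ge(3)[OF c(1)] xvars_ge(3)[OF c(2)] by simp
  qed
  have link: "linked L ?\<sigma> h" using L codes(2) by (rule linked_xstore)
  have link': "linked L \<tau> h'" unfolding linked_def
  proof (intro conjI ballI allI impI)
    show "dom h' = {x. 0 < cnt L (saved \<tau>) x}" by (auto simp: h'_def dom_def)
    fix c v assume c: "c \<in> forms nv mc" and "h' (fval nv c (saved \<tau>)) = Some v"
    then have "v = \<tau> (2 * nv + F (fval nv c (saved \<tau>)))" by (auto simp: h'_def split: if_splits)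
    moreover have "\<exists>c'\<in>forms nv mc. fval nv c' (saved \<tau>) = fval nv c (saved \<tau>)" using c by blast
    ultimately show "\<tau> (2 * nv + c) = v" using unique[OF c F(1)] F(2) by metis
  qed
  have sP: "sat_pure ?\<sigma> P" and sL: "sat_spatial ?\<sigma> h L"
    using P L codes(1,2) sat_pure_cong[of P nv ?\<sigma> s] sat_spatial_cong[of L nv ?\<sigma> s h]
    by (auto simp: xstore_simps)
  have "sat_pure \<tau> P"
  proof -
    have "eqv xvars ((lvl ^^ code_pure P) mc) ?\<sigma> \<tau>" using e
      by (rule eqv_mono) (use codes(1) in \<open>auto simp: level_def simp del: funpow.simps intro: funpow_lvl_mono\<close>)
    then show ?thesis using sat_pure_eqv[of P xvars mc ?\<sigma> \<tau>] sP codes(1) xvars_ge(2) by simp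
  qed
  moreover have tL: "sat_spatial \<tau> h' L"
  proof (rule transport[OF e1 link link' codes(2,2) _ sL])
    fix t u assume "(t, u) \<in> points L"
    then have "nlin nv mc (\<lambda>s. tm_val s t)" and t: "code_tm t < nv"
      using code_points[of t u L] codes(2) by (auto intro: nlin_tm_code)
    from ex_form[OF this(1)] obtain c where c: "c \<in> forms nv mc" "\<forall>s. tm_val s t = fval nv c s" by blast
    have "tm_val ?\<sigma> t = tm_val (saved ?\<sigma>) t"
      by (rule tm_val_cong_code[OF t]) (simp add: saved_def xstore_simps)
    then show "\<exists>c\<in>forms nv mc. tm_val ?\<sigma> t = fval nv c (saved ?\<sigma>)" using c by auto
  qed
  moreover have "is_heap h'" unfolding is_heap_def
  proof
    have "dom h' \<subseteq> {..nv * Suc (bnd xvars)}"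
      using link' codes(2) b xvars_ge(1) cnt_pos_le[of L "saved \<tau>" _ nv "bnd xvars"]
      by (auto simp: linked_def saved_def)
    then show "finite (dom h')" by (rule finite_subset) simp
    \<comment> \<open>The null address is a constant form, so its exclusion from the domain is
      inherited.\<close>
    have "cnt L (saved ?\<sigma>) 0 = cnt L (saved \<tau>) 0"
      unfolding saved_def using cnt_eqv[OF e0 codes(2) xvars_ge(1) nlin_const[of 0]] by simp
    then show "0 \<notin> dom h'" using heap link link' by (simp add: linked_def is_heap_def)
  qed
  moreover have "v \<le> bnd xvars" if "h' x = Some v" for x v
    using that b xvars_ge(3)[OF F(1), of x] by (auto simp: h'_def split: if_splits)
  moreover have "\<not> sat_symheap \<tau> h' D" if D: "D \<in> set Ds" for D
  proof (cases D)
    case (Exists ys P' S)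
    have c: "list_encode ys \<le> n" "code_pure P' \<le> n" "code_spatial S \<le> n"
      using codes(3)[OF D] add_le_prod_encode[of "list_encode ys" "prod_encode (code_pure P', code_spatial S)"]
        add_le_prod_encode[of "code_pure P'" "code_spatial S"] by (simp_all add: Exists)
    show ?thesis
    proof
      assume "sat_symheap \<tau> h' D"
      then obtain s1 where s1: "\<forall>i. i \<notin> set ys \<longrightarrow> s1 i = \<tau> i" "sat_pure s1 P'" "sat_spatial s1 h' S"
        by (auto simp: Exists sat_exs_iff)
      have agree: "s1 i = \<tau> i" if "i \<notin> set ys" for i using s1(1) that by blast
      \<comment> \<open>The equivalence is used backwards, from the small model to the given
        countermodel.\<close>
      from symheap_transfer[OF eqv_sym[OF e] link' link codes(2) c(3,2,1) restr[OF D, unfolded Exists]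
            save agree s1(2,3)]
      obtain t1 where t1: "\<forall>i. i \<notin> set ys \<longrightarrow> t1 i = ?\<sigma> i" "sat_pure t1 P'" "sat_spatial t1 h S"
        by blast
      let ?t1 = "\<lambda>i. if i < nv then t1 i else s i"
      have "sat_pure ?t1 P'" "sat_spatial ?t1 h S"
        using t1 c sat_pure_cong[of P' nv ?t1 t1] sat_spatial_cong[of S nv ?t1 t1 h] by auto
      moreover have "?t1 i = s i" if "i \<notin> set ys" for i using t1(1) that by (simp add: xstore_simps)
      ultimately have "sat_symheap s h D" by (auto simp: Exists sat_exs_iff intro!: exI[of _ ?t1])
      with Ds[OF D] show False by blast
    qed
  qed
  ultimately show ?thesis using b xvars_ge(2) by (intro exI[of _ \<tau>] exI[of _ h']) auto
qed

lemma valid_iff_bounded: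
  assumes codes: "code_pure P \<le> n" "code_spatial L \<le> n" "\<And>D. D \<in> set Ds \<Longrightarrow> code_symheap D \<le> n"
    and restr: "restricted (Entails P L Ds)"
  shows "valid (Entails P L Ds) \<longleftrightarrow> (\<forall>s h. (\<forall>i<nv. s i \<le> bnd xvars) \<and> is_heap h \<and>
     (\<forall>x v. h x = Some v \<longrightarrow> v \<le> bnd xvars) \<and> sat_pure s P \<and> sat_spatial s h L \<longrightarrow> (\<exists>D\<in>set Ds. bsat s h D))"
    (is "_ \<longleftrightarrow> ?B")
proof -
  have restr': "restricted_symheap D" if "D \<in> set Ds" for D using restr that by simp
  have bsat: "bsat s h D \<longleftrightarrow> sat_symheap s h D"
    if "D \<in> set Ds" "\<forall>i<nv. s i \<le> bnd xvars" "\<forall>x v. h x = Some v \<longrightarrow> v \<le> bnd xvars" "sat_spatial s h L" for D s h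
    using that by (intro bsat_iff[where L = L] codes(3) restr' codes(2)) auto
  show ?thesis
  proof
    assume "valid (Entails P L Ds)"
    then show ?B using bsat by fastforce
  next
    assume B: ?B
    show "valid (Entails P L Ds)"
    proof (rule ccontr)
      assume "\<not> valid (Entails P L Ds)"
      then obtain s h where "is_heap h" "sat_pure s P" "sat_spatial s h L" "\<forall>D\<in>set Ds. \<not> sat_symheap s h D"
        by auto
      with bounded_countermodel[OF codes restr', of Ds h s] obtain s' h' where
        c: "\<forall>i<nv. s' i \<le> bnd xvars" "is_heap h'" "\<forall>x v. h' x = Some v \<longrightarrow> v \<le> bnd xvars"
           "sat_pure s' P" "sat_spatial s' h' L" "\<forall>D\<in>set Ds. \<not> sat_symheap s' h' D" by blast
      with B obtain D where "D \<in> set Ds" "bsat s' h' D" by blast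
      with bsat[of D s' h'] c show False by blast
    qed
  qed
qed

end


section \<open>Computability of the bounded search\<close>

lemma computable_fact [comp_intros]: "computable a \<Longrightarrow> computable (\<lambda>z. fact (a z))"
proof (rule computable_primrec[where f = "\<lambda>x k. fact k" and a = "\<lambda>_. 0" and b = a and
      g = "\<lambda>_. 1" and h = "\<lambda>x k r. Suc k * r"])
  show "computable (\<lambda>z. Suc (pfst (psnd z)) * psnd (psnd z))" by (intro comp_intros)
qed (simp_all add: computable_const)

lemma computable_lvl [comp_intros]: "computable a \<Longrightarrow> computable (\<lambda>z. lvl (a z))"
  unfolding lvl_def by (intro comp_intros)

lemma computable_grow [comp_intros]:
  "computable a \<Longrightarrow> computable b \<Longrightarrow> computable c \<Longrightarrow> computable (\<lambda>z. grow (a z) (b z) (c z))"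
  unfolding grow_def by (intro comp_intros)

lemma computable_seq_bound [comp_intros]:
  assumes "computable a" "computable b" shows "computable (\<lambda>z. seq_bound (a z) (b z))"
proof (rule computable_primrec[where f = seq_bound and a = a and b = b and
        g = "\<lambda>_. 1" and h = "\<lambda>x k r. Suc (prod_encode (x, r))", OF _ _ _ _ assms])
  show "computable (\<lambda>z. Suc (prod_encode (pfst z, psnd (psnd z))))" by (intro comp_intros)
qed (simp_all add: computable_const)

lemma computable_level [comp_intros]:
  assumes "computable a" "computable b" shows "computable (\<lambda>z. level (a z) (b z))"
proof (rule computable_primrec[where f = level and a = a and b = b and
        g = "\<lambda>n. Suc (2 * n)" and h = "\<lambda>x k r. lvl r", OF _ _ _ _ assms])
  show "computable (\<lambda>z. lvl (psnd (psnd z)))" by (intro comp_intros)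
  show "computable (\<lambda>n. Suc (2 * n))" by (intro comp_intros)
qed (simp_all add: level_def)

lemma computable_xvars [comp_intros]: "computable a \<Longrightarrow> computable (\<lambda>z. xvars (a z))"
  unfolding xvars_def by (intro comp_intros)

lemma computable_top_level [comp_intros]: "computable a \<Longrightarrow> computable (\<lambda>z. top_level (a z))"
  unfolding top_level_def by (intro comp_intros)

lemma computable_bnd [comp_intros]:
  assumes "computable a" "computable b" shows "computable (\<lambda>z. bnd (a z) (b z))"
proof (rule computable_primrec[where f = bnd and a = a and b = b and
        g = "\<lambda>n. 0" and h = "\<lambda>n k r. grow (xvars n) (top_level n) r", OF _ _ _ _ assms])
  show "computable (\<lambda>z. grow (xvars (pfst z)) (top_level (pfst z)) (psnd (psnd z)))" by (intro comp_intros)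
qed (simp_all add: bnd_def computable_const)

text \<open>Beyond the \<open>xvars n\<close> answers behind the store, \<open>n\<close> are
  reserved for a quantifier block and \<open>n\<close> for nested quantifiers of a pure
  formula.\<close>

definition stores :: "nat \<Rightarrow> nat" where
  "stores n = seq_bound (bnd n (xvars n + 2 * n)) (Suc n)"

text \<open>The address bound of \<open>cnt_pos_le\<close>, made strict. Stores of witnesses count
  as well, hence \<open>xvars n + n\<close>.\<close>

definition cells :: "nat \<Rightarrow> nat" where
  "cells n = Suc (Suc n * Suc (bnd n (xvars n + n)))"

text \<open>An entry 0 stands for an unallocated address, so contents are shifted by one and the
  bound with them.\<close>

definition heaps :: "nat \<Rightarrow> nat" where
  "heaps n = seq_bound (Suc (bnd n (xvars n))) (cells n)"

lemma computable_bounds [comp_intros]: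
  "computable a \<Longrightarrow> computable (\<lambda>z. stores (a z))"
  "computable a \<Longrightarrow> computable (\<lambda>z. cells (a z))"
  "computable a \<Longrightarrow> computable (\<lambda>z. heaps (a z))"
  unfolding stores_def cells_def heaps_def by (intro comp_intros; assumption)+

section \<open>Evaluation of terms and formulas on codes\<close>

definition tmc :: "nat \<Rightarrow> nat \<Rightarrow> nat" where
  "tmc c = on_code code_tm (tm_val (get c))"

lemma computable_tmc [comp_intros]: "computable a \<Longrightarrow> computable b \<Longrightarrow> computable (\<lambda>z. tmc (a z) (b z))"
  unfolding tmc_def
  by (rule computable_on_code_tm[where ?f1.0 = get and ?f2.0 = "\<lambda>x v. v" and ?f3.0 = "\<lambda>x r1 r2. r1 + r2"])
     (simp_all add: comp_intros)

text \<open>The bound for the quantified variable of \<open>Ex x P\<close> decreases in the code of \<open>P\<close>, so that it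
  exceeds the bound for the store in which \<open>Ex x P\<close> is evaluated.\<close>

fun bounded_sat :: "nat \<Rightarrow> nat \<Rightarrow> pure \<Rightarrow> bool" where
  "bounded_sat n c (Eq t u) \<longleftrightarrow> tm_val (get c) t = tm_val (get c) u"
| "bounded_sat n c (And P Q) \<longleftrightarrow> bounded_sat n c P \<and> bounded_sat n c Q"
| "bounded_sat n c (Neg P) \<longleftrightarrow> \<not> bounded_sat n c P"
| "bounded_sat n c (Ex x P) \<longleftrightarrow> (\<exists>c'<stores n. get c' x \<le> bnd n (xvars n + n + (n - code_pure P)) \<and>
     (\<forall>i<Suc n. i \<noteq> x \<longrightarrow> get c' i = get c i) \<and> bounded_sat n c' P)"

lemma grow_mono_vars: "K \<le> K' \<Longrightarrow> grow K N b \<le> grow K' N b"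
  unfolding grow_def by (intro add_mono mult_mono) simp_all

lemma ex_store_code:
  assumes "\<And>i. i < Suc n \<Longrightarrow> s i \<le> bnd n j" "j \<le> xvars n + 2 * n"
  shows "\<exists>c<stores n. \<forall>i<Suc n. get c i = s i"
  unfolding stores_def
  using assms bnd_mono[of j "xvars n + 2 * n" n] by (intro ex_code_bounded) (meson le_trans)

lemma bounded_sat_iff:
  "code_pure P \<le> n \<Longrightarrow> \<forall>i<Suc n. get c i \<le> bnd n (xvars n + n + (n - code_pure P)) \<Longrightarrow>
    bounded_sat n c P \<longleftrightarrow> sat_pure (get c) P"
proof (induction P arbitrary: c)
  case (And P Q)
  have less: "code_pure P < code_pure (And P Q)" "code_pure Q < code_pure (And P Q)"
    using code_pure_less(1,2) by blast+
  have "bnd n (xvars n + n + (n - code_pure (And P Q))) \<le> bnd n (xvars n + n + (n - code_pure P))"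
    "bnd n (xvars n + n + (n - code_pure (And P Q))) \<le> bnd n (xvars n + n + (n - code_pure Q))"
    using less by (intro bnd_mono; linarith)+
  with And.prems(2) have "\<forall>i<Suc n. get c i \<le> bnd n (xvars n + n + (n - code_pure P))"
    "\<forall>i<Suc n. get c i \<le> bnd n (xvars n + n + (n - code_pure Q))" by (meson le_trans)+
  with And.IH less And.prems(1) show ?case by (simp del: code_pure.simps)
next
  case (Neg P)
  have less: "code_pure P < code_pure (Neg P)" by (rule code_pure_less)
  then have "bnd n (xvars n + n + (n - code_pure (Neg P))) \<le> bnd n (xvars n + n + (n - code_pure P))"
    by (intro bnd_mono) linarith
  with Neg.prems(2) have "\<forall>i<Suc n. get c i \<le> bnd n (xvars n + n + (n - code_pure P))" by (meson le_trans)
  with Neg.IH less Neg.prems(1) show ?case by (simp del: code_pure.simps)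
next
  case (Ex x P)
  let ?j = "xvars n + n + (n - code_pure (Ex x P))" and ?j' = "xvars n + n + (n - code_pure P)"
  have less: "code_pure P < code_pure (Ex x P)" "x < code_pure (Ex x P)" using code_pure_less(4,5) by blast+
  \<comment> \<open>The smaller code of the body raises the exponent by at least one: room for the
    one application of \<open>grow\<close> in the witness bound.\<close>
  have j: "Suc ?j \<le> ?j'" using less(1) Ex.prems(1) by linarith
  then have b: "bnd n ?j \<le> bnd n ?j'" "bnd n (Suc ?j) \<le> bnd n ?j'" by (intro bnd_mono; linarith)+
  have P: "code_pure P \<le> n" using less Ex.prems(1) by linarith
  have eq: "sat_pure (get c') P \<longleftrightarrow> sat_pure ((get c)(x := get c' x)) P"
    if "\<forall>i<Suc n. i \<noteq> x \<longrightarrow> get c' i = get c i" for c'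
    using that P by (intro sat_pure_cong[of P "Suc n"]) auto
  have IH: "bounded_sat n c' P \<longleftrightarrow> sat_pure (get c') P"
    if "get c' x \<le> bnd n ?j'" "\<forall>i<Suc n. i \<noteq> x \<longrightarrow> get c' i = get c i" for c'
  proof (rule Ex.IH[OF P], intro allI impI)
    fix i assume "i < Suc n"
    then show "get c' i \<le> bnd n ?j'" using that Ex.prems(2) b(1) by (cases "i = x") (auto intro: le_trans)
  qed
  show ?case
  proof
    assume "bounded_sat n c (Ex x P)"
    then show "sat_pure (get c) (Ex x P)" using IH eq by auto
  next
    assume s: "sat_pure (get c) (Ex x P)"
    have "(lvl ^^ Suc n) (Suc (2 * n)) \<le> top_level n"
      unfolding top_level_def level_def by (intro funpow_lvl_mono) simp
    from sat_pure_Ex_bounded[OF _ _ _ this s, of "bnd n ?j"] Ex.prems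
    obtain a where a: "a \<le> grow (Suc n) (top_level n) (bnd n ?j)" "sat_pure ((get c)(x := a)) P" by auto
    have "grow (Suc n) (top_level n) (bnd n ?j) \<le> grow (xvars n) (top_level n) (bnd n ?j)"
      by (rule grow_mono_vars[OF xvars_ge(2)])
    also have "\<dots> = bnd n (Suc ?j)" by (simp add: bnd_def)
    finally have a': "a \<le> bnd n ?j'" using a(1) b(2) by linarith
    have "((get c)(x := a)) i \<le> bnd n ?j'" if "i < Suc n" for i
      using that a' Ex.prems(2) b(1) by (auto intro: le_trans)
    from ex_store_code[of n "(get c)(x := a)", OF this] obtain c' where c': "c' < stores n" "\<forall>i<Suc n. get c' i = ((get c)(x := a)) i"
      by auto
    have x: "get c' x = a" using c'(2) less(2) Ex.prems(1) by simp
    have off: "\<forall>i<Suc n. i \<noteq> x \<longrightarrow> get c' i = get c i" using c'(2) by simp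
    have "bounded_sat n c' P" using IH[OF _ off] eq[OF off] a(2) a' x by simp
    then show "bounded_sat n c (Ex x P)" using c'(1) x a' off by auto
  qed
qed simp

lemma tab_cong: "(\<And>i. i < b \<Longrightarrow> f i = g i) \<Longrightarrow> tab b f = tab b g"
  by (simp add: tab_def)

text \<open>Under a quantifier the body is evaluated at other stores, while recursion on codes keeps
  its parameter fixed. So the recursive value is the truth table over all store codes.\<close>

definition sat_table :: "nat \<Rightarrow> pure \<Rightarrow> nat" where
  "sat_table n P = tab (stores n) (\<lambda>c. of_bool (bounded_sat n c P))"

definition purec :: "nat \<Rightarrow> nat \<Rightarrow> nat" where
  "purec n = on_code code_pure (sat_table n)"

lemma computable_purec [comp_intros]:
  assumes "computable a" "computable b" shows "computable (\<lambda>z. purec (a z) (b z))"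
  unfolding purec_def
proof (rule computable_on_code_pure[OF _ _ _ _ _ _ _ _ assms])
  show "sat_table n (Eq t u) = tab (stores n) (\<lambda>c. of_bool (tmc c (code_tm t) = tmc c (code_tm u)))" for n t u
    by (simp add: sat_table_def tmc_def)
  show "sat_table n (And P Q) = tab (stores n) (\<lambda>c. of_bool (get (sat_table n P) c = 1 \<and> get (sat_table n Q) c = 1))" for n P Q
    unfolding sat_table_def by (rule tab_cong) (simp add: get_tab)
  show "sat_table n (Neg P) = tab (stores n) (\<lambda>c. of_bool (get (sat_table n P) c = 0))" for n P
    unfolding sat_table_def by (rule tab_cong) (simp add: get_tab)
  show "sat_table n (Ex x P) = tab (stores n) (\<lambda>c. of_bool (\<exists>c'<stores n.
      get c' x \<le> bnd n (xvars n + n + (n - code_pure P)) \<and>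
     (\<forall>i<Suc n. i \<noteq> x \<longrightarrow> get c' i = get c i) \<and> get (sat_table n P) c' = 1))" for n x P
  proof -
    have "bounded_sat n c' P \<longleftrightarrow> get (sat_table n P) c' = 1" if "c' < stores n" for c'
      using that by (simp add: sat_table_def get_tab)
    then have "bounded_sat n c (Ex x P) \<longleftrightarrow> (\<exists>c'<stores n.
        get c' x \<le> bnd n (xvars n + n + (n - code_pure P)) \<and>
        (\<forall>i<Suc n. i \<noteq> x \<longrightarrow> get c' i = get c i) \<and> get (sat_table n P) c' = 1)" for c
      unfolding bounded_sat.simps by blast
    then show ?thesis unfolding sat_table_def[of n "Ex x P"] by (simp only:)
  qed
qed (intro comp_intros)+

lemma purec_get: "c < stores n \<Longrightarrow> get (purec n (code_pure P) - 1) c = of_bool (bounded_sat n c P)"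
  by (simp add: purec_def sat_table_def get_tab)

definition heap_of :: "nat \<Rightarrow> nat \<Rightarrow> heap" where
  "heap_of m e = (\<lambda>x. if x < m \<and> get e x \<noteq> 0 then Some (get e x - 1) else None)"

definition cntc :: "nat \<Rightarrow> nat \<Rightarrow> nat" where
  "cntc z = on_code code_spatial (\<lambda>S. cnt S (get (pfst z)) (psnd z))"

lemma computable_cntc [comp_intros]:
  assumes "computable a" "computable b" shows "computable (\<lambda>z. cntc (a z) (b z))"
  unfolding cntc_def
proof (rule computable_on_code_spatial[where R = "\<lambda>z S. cnt S (get (pfst z)) (psnd z)", OF _ _ _ _ _ _ _ _ assms])
  show "cnt Emp (get (pfst z)) (psnd z) = 0" for z by simp
  \<comment> \<open>\<open>tmc\<close> returns the value plus one, so the address is compared after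
    a shift by one.\<close>
  show "cnt (PointsTo t u) (get (pfst z)) (psnd z) = of_bool (Suc (psnd z) = tmc (pfst z) (code_tm t))" for z t u
    by (simp add: tmc_def)
  show "cnt (Arr t u) (get (pfst z)) (psnd z) = of_bool (tmc (pfst z) (code_tm t) \<le> Suc (psnd z) \<and>
      Suc (psnd z) \<le> tmc (pfst z) (code_tm u))" for z t u
    by (simp add: tmc_def)
  show "cnt (Sep S T) (get (pfst z)) (psnd z) = cnt S (get (pfst z)) (psnd z) + cnt T (get (pfst z)) (psnd z)" for z S T
    by simp
qed (intro comp_intros)+

definition okc :: "nat \<Rightarrow> nat \<Rightarrow> nat" where
  "okc z = on_code code_spatial (\<lambda>S. of_bool (cells_ok (get (pfst (psnd z))) (heap_of (pfst z) (psnd (psnd z))) S))"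

lemma computable_okc [comp_intros]:
  assumes "computable a" "computable b" shows "computable (\<lambda>z. okc (a z) (b z))"
  unfolding okc_def
proof (rule computable_on_code_spatial[where
      R = "\<lambda>z S. of_bool (cells_ok (get (pfst (psnd z))) (heap_of (pfst z) (psnd (psnd z))) S)",
      OF _ _ _ _ _ _ _ _ assms])
  let ?ok = "\<lambda>z S. cells_ok (get (pfst (psnd z))) (heap_of (pfst z) (psnd (psnd z))) S"
  show "(of_bool (?ok z Emp) :: nat) = 1" for z by simp
  \<comment> \<open>In the second conjunct two shifts cancel: a stored content and a value of
    \<open>tmc\<close> are both one too large. A positive value of \<open>tmc\<close> also makes the
    entry an allocated one.\<close>
  show "(of_bool (?ok z (PointsTo t u)) :: nat) = of_bool (tmc (pfst (psnd z)) (code_tm t) - 1 < pfst z \<and>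
      get (psnd (psnd z)) (tmc (pfst (psnd z)) (code_tm t) - 1) = tmc (pfst (psnd z)) (code_tm u))" for z t u
    by (auto simp: tmc_def heap_of_def)
  show "(of_bool (?ok z (Arr t u)) :: nat) = of_bool (tmc (pfst (psnd z)) (code_tm t) \<le> tmc (pfst (psnd z)) (code_tm u))" for z t u
    by (simp add: tmc_def)
  show "(of_bool (?ok z (Sep S T)) :: nat) = of_bool (?ok z S) * of_bool (?ok z T)" for z S T
    by simp
qed (intro comp_intros)+

definition tm_freec :: "nat \<Rightarrow> nat \<Rightarrow> nat" where
  "tm_freec l = on_code code_tm (\<lambda>t. of_bool (tm_vars t \<inter> {x. list_mem x l} = {}))"

lemma computable_tm_freec [comp_intros]:
  assumes "computable a" "computable b" shows "computable (\<lambda>z. tm_freec (a z) (b z))"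
  unfolding tm_freec_def
proof (rule computable_on_code_tm[where R = "\<lambda>l t. of_bool (tm_vars t \<inter> {x. list_mem x l} = {})",
      OF _ _ _ _ _ _ assms])
  let ?free = "\<lambda>l t. tm_vars t \<inter> {x. list_mem x l} = {}"
  show "(of_bool (?free l (Var x)) :: nat) = of_bool (\<not> list_mem x l)" for l x by simp
  show "(of_bool (?free l (Num x)) :: nat) = 1" for l x by simp
  show "(of_bool (?free l (Add t u)) :: nat) = of_bool (?free l t) * of_bool (?free l u)" for l t u
    by (auto simp: Int_Un_distrib2)
qed (intro comp_intros)+

definition restrictedc :: "nat \<Rightarrow> nat \<Rightarrow> nat" where
  "restrictedc l = on_code code_spatial
     (\<lambda>S. of_bool (\<forall>(t, v)\<in>arrays S. \<exists>u. v = Add t u \<and> tm_vars u \<inter> {x. list_mem x l} = {}))"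

lemma computable_restrictedc [comp_intros]:
  assumes "computable a" "computable b" shows "computable (\<lambda>z. restrictedc (a z) (b z))"
  unfolding restrictedc_def
proof (rule computable_on_code_spatial[where
      R = "\<lambda>l S. of_bool (\<forall>(t, v)\<in>arrays S. \<exists>u. v = Add t u \<and> tm_vars u \<inter> {x. list_mem x l} = {})",
      OF _ _ _ _ _ _ _ _ assms])
  let ?r = "\<lambda>l S. \<forall>(t, v)\<in>arrays S. \<exists>u. v = Add t u \<and> tm_vars u \<inter> {x. list_mem x l} = {}"
  show "(of_bool (?r l Emp) :: nat) = 1" for l by simp
  show "(of_bool (?r l (PointsTo t u)) :: nat) = 1" for l t u by simp
  show "(of_bool (?r l (Arr t v)) :: nat) = of_bool (pfst (code_tm v) = 2 \<and> pfst (psnd (code_tm v)) = code_tm t \<and>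
     tm_freec l (psnd (psnd (code_tm v))) = 2)" for l t v
    by (cases v) (auto simp: tm_freec_def dest: code_tm_inject)
  show "(of_bool (?r l (Sep S T)) :: nat) = of_bool (?r l S) * of_bool (?r l T)" for l S T
    by (auto simp: ball_Un)
qed (intro comp_intros)+

section \<open>Satisfaction and validity as decidable predicates on codes\<close>

definition spatialc :: "nat \<Rightarrow> nat \<Rightarrow> nat \<Rightarrow> nat \<Rightarrow> bool" where
  "spatialc m c e p \<longleftrightarrow> okc (prod_encode (m, prod_encode (c, e))) p = 2 \<and>
     (\<forall>x<m. cntc (prod_encode (c, x)) p = Suc (of_bool (get e x \<noteq> 0)))"

lemma dec_spatialc [comp_intros]:
  "computable m \<Longrightarrow> computable c \<Longrightarrow> computable e \<Longrightarrow> computable p \<Longrightarrow>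
    dec (\<lambda>z. spatialc (m z) (c z) (e z) (p z))"
proof -
  assume c: "computable m" "computable c" "computable e" "computable p"
  have "dec (\<lambda>z. (\<lambda>m c e p. spatialc m c e p) (pfst z) (pfst (psnd z)) (pfst (psnd (psnd z))) (psnd (psnd (psnd z))))"
    unfolding spatialc_def by (intro comp_intros)
  from computable_app4[OF this[unfolded dec_def] c] show ?thesis by (simp add: dec_def)
qed

text \<open>From \<open>cells n\<close> on, addresses are neither covered by \<open>S\<close> nor
  allocated in the decoded heap, so a test of the smaller ones decides coverage.\<close>

lemma spatialc_iff:
  assumes "code_spatial S \<le> n" "\<And>i. i < Suc n \<Longrightarrow> get c i \<le> bnd n (xvars n + n)"
  shows "spatialc (cells n) c e (code_spatial S) \<longleftrightarrow> sat_spatial (get c) (heap_of (cells n) e) S"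
proof -
  have le: "x < cells n" if "0 < cnt S (get c) x" for x
    using cnt_pos_le[OF that, of "Suc n" "bnd n (xvars n + n)"] assms by (simp add: cells_def)
  have "(\<forall>x. cnt S (get c) x = of_bool (x \<in> dom (heap_of (cells n) e))) \<longleftrightarrow>
      (\<forall>x<cells n. cnt S (get c) x = of_bool (get e x \<noteq> 0))"
  proof -
    have "cnt S (get c) x = of_bool (x \<in> dom (heap_of (cells n) e)) \<longleftrightarrow>
        (x < cells n \<longrightarrow> cnt S (get c) x = of_bool (get e x \<noteq> 0))" for x
      using le[of x] by (cases "x < cells n") (auto simp: heap_of_def split: if_splits)
    then show ?thesis by blast
  qed
  then show ?thesis by (simp add: spatialc_def sat_spatial_iff okc_def cntc_def conj_commute)
qed

definition symheapc :: "nat \<Rightarrow> nat \<Rightarrow> nat \<Rightarrow> nat \<Rightarrow> bool" where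
  "symheapc n c e d \<longleftrightarrow> (\<exists>c'<stores n. (\<forall>i<Suc n. get c' i \<le> bnd n (xvars n + n)) \<and>
     (\<forall>i<Suc n. \<not> list_mem i (pfst d) \<longrightarrow> get c' i = get c i) \<and>
     get (purec n (pfst (psnd d)) - 1) c' = 1 \<and> spatialc (cells n) c' e (psnd (psnd d)))"

lemma dec_symheapc [comp_intros]:
  "computable m \<Longrightarrow> computable c \<Longrightarrow> computable e \<Longrightarrow> computable p \<Longrightarrow>
    dec (\<lambda>z. symheapc (m z) (c z) (e z) (p z))"
proof -
  assume c: "computable m" "computable c" "computable e" "computable p"
  have "dec (\<lambda>z. (\<lambda>m c e p. symheapc m c e p) (pfst z) (pfst (psnd z)) (pfst (psnd (psnd z))) (psnd (psnd (psnd z))))"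
    unfolding symheapc_def by (intro comp_intros)
  from computable_app4[OF this[unfolded dec_def] c] show ?thesis by (simp add: dec_def)
qed

lemma code_symheap_le:
  assumes "code_symheap (Exists ys P S) \<le> n"
  shows "list_encode ys \<le> n" "code_pure P \<le> n" "code_spatial S \<le> n"
  using assms add_le_prod_encode[of "list_encode ys" "prod_encode (code_pure P, code_spatial S)"]
    add_le_prod_encode[of "code_pure P" "code_spatial S"] by simp_all

text \<open>Only variables below \<open>Suc n\<close> can occur, so a store may be exchanged for any
  code that agrees with it there; bounded witnesses have such a code below
  \<open>stores n\<close>.\<close>

lemma symheapc_iff:
  assumes D: "code_symheap D \<le> n" and s: "\<And>i. i < Suc n \<Longrightarrow> get c i = s i"
  shows "symheapc n c e (code_symheap D) \<longleftrightarrow> bsat n s (heap_of (cells n) e) D"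
proof (cases D)
  case (Exists ys P S)
  note codes = code_symheap_le[OF D[unfolded Exists]]
  have ys: "i < Suc n" if "i \<in> set ys" for i
    using list_encode_bounds(2)[OF that] codes(1) by linarith
  have pure: "get (purec n (code_pure P) - 1) c' = 1 \<longleftrightarrow> sat_pure (get c') P"
    if "c' < stores n" "\<forall>i<Suc n. get c' i \<le> bnd n (xvars n + n)" for c'
  proof -
    have "bnd n (xvars n + n) \<le> bnd n (xvars n + n + (n - code_pure P))" by (rule bnd_mono) simp
    with that(2) have "\<forall>i<Suc n. get c' i \<le> bnd n (xvars n + n + (n - code_pure P))" by (meson le_trans)
    from bounded_sat_iff[OF codes(2) this] show ?thesis using purec_get[OF that(1), of P] by simp
  qed
  have "symheapc n c e (code_symheap D) \<longleftrightarrow> (\<exists>c'<stores n. (\<forall>i<Suc n. get c' i \<le> bnd n (xvars n + n)) \<and>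
     (\<forall>i<Suc n. i \<notin> set ys \<longrightarrow> get c' i = s i) \<and>
     sat_pure (get c') P \<and> sat_spatial (get c') (heap_of (cells n) e) S)"
    (is "_ \<longleftrightarrow> ?C")
    unfolding symheapc_def Exists code_symheap.simps pfst_pair psnd_pair list_mem_encode
  proof (intro ex_cong1 conj_cong refl)
    fix c'
    assume c': "c' < stores n" "\<forall>i<Suc n. get c' i \<le> bnd n (xvars n + n)"
    show "(\<forall>i<Suc n. i \<notin> set ys \<longrightarrow> get c' i = get c i) = (\<forall>i<Suc n. i \<notin> set ys \<longrightarrow> get c' i = s i)"
      using s by auto
    show "(get (purec n (code_pure P) - 1) c' = 1) = sat_pure (get c') P" by (rule pure[OF c'])
    show "spatialc (cells n) c' e (code_spatial S) = sat_spatial (get c') (heap_of (cells n) e) S"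
      using c'(2) by (intro spatialc_iff codes(3)) blast
  qed
  also have "?C \<longleftrightarrow> bsat n s (heap_of (cells n) e) D"
  proof
    assume ?C
    then obtain c' where c': "\<forall>i<Suc n. get c' i \<le> bnd n (xvars n + n)"
      "\<forall>i<Suc n. i \<notin> set ys \<longrightarrow> get c' i = s i"
      "sat_pure (get c') P" "sat_spatial (get c') (heap_of (cells n) e) S" by blast
    let ?s = "\<lambda>i. if i < Suc n then get c' i else s i"
    have "sat_pure ?s P" "sat_spatial ?s (heap_of (cells n) e) S"
      using c'(3,4) codes sat_pure_cong[of P "Suc n" ?s "get c'"]
        sat_spatial_cong[of S "Suc n" ?s "get c'" "heap_of (cells n) e"] by auto
    then show "bsat n s (heap_of (cells n) e) D"
      using c'(1,2) ys unfolding bsat_def Exists symheap.case by (intro exI[of _ ?s]) auto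
  next
    assume "bsat n s (heap_of (cells n) e) D"
    then obtain s1 where s1: "\<forall>i. i \<notin> set ys \<longrightarrow> s1 i = s i" "\<forall>i<Suc n. s1 i \<le> bnd n (xvars n + n)"
      "sat_pure s1 P" "sat_spatial s1 (heap_of (cells n) e) S"
      by (auto simp: bsat_def Exists)
    from ex_store_code[of n s1 "xvars n + n"] s1(2) obtain c'
      where c': "c' < stores n" "\<forall>i<Suc n. get c' i = s1 i" by auto
    have "sat_pure (get c') P" "sat_spatial (get c') (heap_of (cells n) e) S"
      using c'(2) s1(3,4) codes sat_pure_cong[of P "Suc n" "get c'" s1]
        sat_spatial_cong[of S "Suc n" "get c'" s1 "heap_of (cells n) e"] by auto
    then show ?C using c' s1(1,2) by auto
  qed
  finally show ?thesis .
qed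

text \<open>The evaluators act as recognisers here: a value other than 0 certifies a code, whatever
  the parameter, and 2 is truth shifted by one. Members of a coded list lie below \<open>e\<close>,
  so the quantifier misses none.\<close>

definition wellformedc :: "nat \<Rightarrow> bool" where
  "wellformedc e \<longleftrightarrow> purec e (pfst (pfst e)) \<noteq> 0 \<and> okc 0 (psnd (pfst e)) \<noteq> 0 \<and>
     (\<forall>d<e. list_mem d (psnd e) \<longrightarrow> purec e (pfst (psnd d)) \<noteq> 0 \<and> restrictedc (pfst d) (psnd (psnd d)) = 2)"

text \<open>The code of the entailment is its own size bound. \<open>get e 0 = 0\<close> keeps the
  null address out of the heap.\<close>

definition checkc :: "nat \<Rightarrow> bool" where
  "checkc n \<longleftrightarrow> (\<forall>c<stores n. (\<forall>i<Suc n. get c i \<le> bnd n (xvars n)) \<longrightarrow>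
     (\<forall>e<heaps n. get e 0 = 0 \<and> (\<forall>x<cells n. get e x \<le> Suc (bnd n (xvars n))) \<and>
        get (purec n (pfst (pfst n)) - 1) c = 1 \<and> spatialc (cells n) c e (psnd (pfst n)) \<longrightarrow>
        (\<exists>d<n. list_mem d (psnd n) \<and> symheapc n c e d)))"

lemma dec_wellformedc: "dec wellformedc" and dec_checkc: "dec checkc"
proof -
  have "dec (\<lambda>n. wellformedc n)" unfolding wellformedc_def by (intro comp_intros)
  then show "dec wellformedc" by simp
  have "dec (\<lambda>n. checkc n)" unfolding checkc_def by (intro comp_intros)
  then show "dec checkc" by simp
qed

lemma code_entailment_le:
  assumes "n = code_entailment (Entails P L Ds)"
  shows "code_pure P \<le> n" "code_spatial L \<le> n" "D \<in> set Ds \<Longrightarrow> code_symheap D < n"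
proof -
  let ?l = "list_encode (map code_symheap Ds)"
  have le: "code_pure P + code_spatial L + ?l \<le> n"
    using assms add_le_prod_encode[of "prod_encode (code_pure P, code_spatial L)" ?l]
      add_le_prod_encode[of "code_pure P" "code_spatial L"] by simp
  then show "code_pure P \<le> n" "code_spatial L \<le> n" by linarith+
  assume "D \<in> set Ds"
  then have "code_symheap D \<in> set (map code_symheap Ds)" by simp
  from list_encode_bounds(2)[OF this] le show "code_symheap D < n" by linarith
qed

lemma restrictedc_iff:
  "restrictedc (pfst d) (psnd (psnd d)) = 2 \<and> purec n (pfst (psnd d)) \<noteq> 0 \<longleftrightarrow>
   (\<exists>D. d = code_symheap D \<and> restricted_symheap D)"
proof
  assume a: "restrictedc (pfst d) (psnd (psnd d)) = 2 \<and> purec n (pfst (psnd d)) \<noteq> 0"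
  then obtain P where P: "pfst (psnd d) = code_pure P" by (auto simp: purec_def on_code_eq_0_iff)
  from a have "on_code code_spatial (\<lambda>S. of_bool (\<forall>(t, v)\<in>arrays S. \<exists>u. v = Add t u \<and>
      tm_vars u \<inter> {x. list_mem x (pfst d)} = {})) (psnd (psnd d)) \<noteq> 0"
    by (simp add: restrictedc_def)
  then obtain S where S: "psnd (psnd d) = code_spatial S" unfolding on_code_eq_0_iff by blast
  let ?D = "Exists (list_decode (pfst d)) P S"
  have "code_symheap ?D = prod_encode (pfst d, prod_encode (pfst (psnd d), psnd (psnd d)))"
    by (simp add: P S)
  then have "d = code_symheap ?D" by simp
  moreover have "restricted_symheap ?D" using a unfolding S 
    by (simp add: restrictedc_def list_mem_def of_bool_def split: if_splits)
  ultimately show "\<exists>D. d = code_symheap D \<and> restricted_symheap D" by blast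
next
  assume "\<exists>D. d = code_symheap D \<and> restricted_symheap D"
  then obtain ys P S where "d = code_symheap (Exists ys P S)" "restricted_symheap (Exists ys P S)"
    by (metis symheap.exhaust)
  then show "restrictedc (pfst d) (psnd (psnd d)) = 2 \<and> purec n (pfst (psnd d)) \<noteq> 0"
    by (simp add: restrictedc_def purec_def)
qed

lemma wellformedc_iff: "wellformedc n \<longleftrightarrow> (\<exists>E. n = code_entailment E \<and> restricted E)"
proof
  assume w: "wellformedc n"
  then obtain P where P: "pfst (pfst n) = code_pure P" by (auto simp: wellformedc_def purec_def on_code_eq_0_iff)
  from w obtain L where L: "psnd (pfst n) = code_spatial L"
    by (auto simp: wellformedc_def okc_def on_code_eq_0_iff)
  have "\<exists>D. d = code_symheap D \<and> restricted_symheap D" if d: "d \<in> set (list_decode (psnd n))" for d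
  proof -
    have "d < n" using list_encode_bounds(2)[OF d] psnd_le[of n] by simp
    with w d have "restrictedc (pfst d) (psnd (psnd d)) = 2 \<and> purec n (pfst (psnd d)) \<noteq> 0"
      by (simp add: wellformedc_def list_mem_def)
    then show ?thesis by (simp only: restrictedc_iff)
  qed
  then obtain f where f: "\<And>d. d \<in> set (list_decode (psnd n)) \<Longrightarrow> d = code_symheap (f d) \<and> restricted_symheap (f d)"
    by metis
  let ?Ds = "map f (list_decode (psnd n))"
  have "map code_symheap ?Ds = list_decode (psnd n)" using f by (simp add: map_idI)
  then have "code_entailment (Entails P L ?Ds) = prod_encode (prod_encode (pfst (pfst n), psnd (pfst n)), psnd n)"
    by (simp only: code_entailment.simps P L list_decode_inverse)
  then have "n = code_entailment (Entails P L ?Ds)" by simp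
  moreover have "restricted (Entails P L ?Ds)" using f by simp
  ultimately show "\<exists>E. n = code_entailment E \<and> restricted E" by blast
next
  assume "\<exists>E. n = code_entailment E \<and> restricted E"
  then obtain P L Ds where n: "n = code_entailment (Entails P L Ds)" and r: "restricted (Entails P L Ds)"
    by (metis entailment.exhaust)
  have "restrictedc (pfst d) (psnd (psnd d)) = 2 \<and> purec n (pfst (psnd d)) \<noteq> 0"
    if "list_mem d (psnd n)" for d
  proof -
    from that n obtain D where "D \<in> set Ds" "d = code_symheap D" by auto
    with r show ?thesis unfolding restrictedc_iff by auto
  qed
  moreover have "purec n (pfst (pfst n)) \<noteq> 0" "okc 0 (psnd (pfst n)) \<noteq> 0"
    unfolding n by (simp_all add: purec_def okc_def)
  ultimately show "wellformedc n" by (simp add: wellformedc_def)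
qed

text \<open>Every store and heap in the criterion of \<open>valid_iff_bounded\<close> has codes
  within the search range, and codes that pass the tests decode to such a pair. For heaps the
  left-hand side is essential: it confines the domain to addresses below
  \<open>cells n\<close>.\<close>

lemma checkc_iff:
  assumes n: "n = code_entailment (Entails P L Ds)" and r: "restricted (Entails P L Ds)"
  shows "checkc n \<longleftrightarrow> valid (Entails P L Ds)"
proof -
  note codes = code_entailment_le[OF n]
  have proj: "pfst (pfst n) = code_pure P" "psnd (pfst n) = code_spatial L"
    "list_mem d (psnd n) \<longleftrightarrow> (\<exists>D\<in>set Ds. d = code_symheap D)" for d
    by (auto simp: n)
  let ?m = "cells n" and ?b = "bnd n (xvars n)"
  have mono: "?b \<le> bnd n (xvars n + n)" "?b \<le> bnd n (xvars n + n + (n - code_pure P))"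
    by (intro bnd_mono; simp)+
  have pure: "get (purec n (code_pure P) - 1) c = 1 \<longleftrightarrow> sat_pure (get c) P"
    if "c < stores n" "\<forall>i<Suc n. get c i \<le> ?b" for c
  proof -
    from that(2) mono(2) have "\<forall>i<Suc n. get c i \<le> bnd n (xvars n + n + (n - code_pure P))" by (meson le_trans)
    from bounded_sat_iff[OF codes(1) this] show ?thesis using purec_get[OF that(1), of P] by simp
  qed
  have spatial: "spatialc ?m c e (code_spatial L) \<longleftrightarrow> sat_spatial (get c) (heap_of ?m e) L"
    if "\<forall>i<Suc n. get c i \<le> ?b" for c e
    using that mono(1) by (intro spatialc_iff codes(2)) (meson le_trans)
  have rhs: "(\<exists>d<n. list_mem d (psnd n) \<and> symheapc n c e d) \<longleftrightarrow> (\<exists>D\<in>set Ds. bsat n s (heap_of ?m e) D)"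
    if "\<And>i. i < Suc n \<Longrightarrow> get c i = s i" for c e s
  proof -
    have "symheapc n c e (code_symheap D) \<longleftrightarrow> bsat n s (heap_of ?m e) D" if "D \<in> set Ds" for D
      using codes(3)[OF that] \<open>\<And>i. i < Suc n \<Longrightarrow> get c i = s i\<close> by (intro symheapc_iff) auto
    then show ?thesis unfolding proj(3) using codes(3) by blast
  qed
  have "checkc n \<longleftrightarrow> (\<forall>s h. (\<forall>i<Suc n. s i \<le> ?b) \<and> is_heap h \<and> (\<forall>x v. h x = Some v \<longrightarrow> v \<le> ?b) \<and>
      sat_pure s P \<and> sat_spatial s h L \<longrightarrow> (\<exists>D\<in>set Ds. bsat n s h D))" (is "_ \<longleftrightarrow> ?V")
  proof
    assume check: "checkc n"
    show ?V
    proof (intro allI impI, elim conjE)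
      fix s h assume s: "\<forall>i<Suc n. s i \<le> ?b" and h: "is_heap h" "\<forall>x v. h x = Some v \<longrightarrow> v \<le> ?b"
        and P: "sat_pure s P" and L: "sat_spatial s h L"
      from ex_store_code[of n s "xvars n"] s obtain c where c: "c < stores n" "\<forall>i<Suc n. get c i = s i" by auto
      define g where "g x = (case h x of None \<Rightarrow> 0 | Some v \<Rightarrow> Suc v)" for x
      have "g x \<le> Suc ?b" for x using h(2) by (auto simp: g_def split: option.split)
      then obtain e where e: "e < heaps n" "\<forall>x<?m. get e x = g x"
        using ex_code_bounded[of ?m g "Suc ?b"] unfolding heaps_def by blast
      have dom: "x < ?m" if "h x = Some v" for x v
      proof -
        have "0 < cnt L s x" using L that by (auto simp: sat_spatial_iff)
        from cnt_pos_le[OF this, of "Suc n" ?b] s codes(2) have "x \<le> Suc n * Suc ?b" by simp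
        also have "\<dots> \<le> Suc n * Suc (bnd n (xvars n + n))" using mono(1) by (intro mult_le_mono2) simp
        finally show ?thesis unfolding cells_def by (rule le_imp_less_Suc)
      qed
      have heap: "heap_of ?m e = h"
      proof
        fix x show "heap_of ?m e x = h x"
          using e(2) dom[of x] by (cases "h x") (auto simp: heap_of_def g_def)
      qed
      have cb: "\<forall>i<Suc n. get c i \<le> ?b" using c s by simp
      have "0 < ?m" by (simp add: cells_def)
      then have "get e 0 = g 0" using e(2) by blast
      moreover have "h 0 = None" using h(1) by (auto simp: is_heap_def)
      ultimately have "get e 0 = 0" by (simp add: g_def)
      moreover have "\<forall>x<?m. get e x \<le> Suc ?b" using e(2) \<open>\<And>x. g x \<le> Suc ?b\<close> by simp
      moreover have "sat_pure (get c) P" "sat_spatial (get c) h L"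
        using P L c codes sat_pure_cong[of P "Suc n" "get c" s] sat_spatial_cong[of L "Suc n" "get c" s h] by auto
      moreover have "get e 0 = 0 \<and> (\<forall>x<?m. get e x \<le> Suc ?b) \<and>
          get (purec n (code_pure P) - 1) c = 1 \<and> spatialc ?m c e (code_spatial L) \<longrightarrow>
          (\<exists>d<n. list_mem d (psnd n) \<and> symheapc n c e d)"
        using check[unfolded checkc_def proj(1,2), rule_format, OF c(1) _ e(1)] cb by simp
      ultimately have "\<exists>d<n. list_mem d (psnd n) \<and> symheapc n c e d"
        by (simp only: pure[OF c(1) cb] spatial[OF cb] heap simp_thms)
      then show "\<exists>D\<in>set Ds. bsat n s h D" using rhs[of c s e] c(2) heap by simp
    qed
  next
    assume V: ?V
    show "checkc n" unfolding checkc_def proj(1,2)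
    proof (intro allI impI, elim conjE)
      fix c e assume c: "c < stores n" and cb: "\<forall>i<Suc n. get c i \<le> ?b" and e0: "get e 0 = 0"
        and eb: "\<forall>x<?m. get e x \<le> Suc ?b" and P: "get (purec n (code_pure P) - 1) c = 1"
        and L: "spatialc ?m c e (code_spatial L)"
      have "is_heap (heap_of ?m e)" unfolding is_heap_def
      proof
        have "dom (heap_of ?m e) \<subseteq> {..<?m}" by (auto simp: heap_of_def split: if_splits)
        then show "finite (dom (heap_of ?m e))" by (rule finite_subset) simp
        show "0 \<notin> dom (heap_of ?m e)" using e0 by (auto simp: heap_of_def split: if_splits)
      qed
      moreover have "\<forall>x v. heap_of ?m e x = Some v \<longrightarrow> v \<le> ?b"
        using eb by (auto simp: heap_of_def split: if_splits)
      ultimately have "\<exists>D\<in>set Ds. bsat n (get c) (heap_of ?m e) D"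
        using V cb P L pure[OF c cb] spatial[OF cb] by blast
      then show "\<exists>d<n. list_mem d (psnd n) \<and> symheapc n c e d" using rhs[of c "get c" e] by simp
    qed
  qed
  also have "?V \<longleftrightarrow> valid (Entails P L Ds)"
    using codes(3) by (intro valid_iff_bounded[symmetric] codes(1,2) r less_imp_le)
  finally show ?thesis .
qed

theorem theorem3p4:
  shows "decidable (code_entailment ` {E. restricted E \<and> valid E})"
proof (rule decidableI)
  have "n \<in> code_entailment ` {E. restricted E \<and> valid E} \<longleftrightarrow> wellformedc n \<and> checkc n" for n
  proof
    assume "n \<in> code_entailment ` {E. restricted E \<and> valid E}"
    then obtain E where E: "n = code_entailment E" "restricted E" "valid E" by blast
    then show "wellformedc n \<and> checkc n"
      using wellformedc_iff[of n] checkc_iff by (cases E) blast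
  next
    assume w: "wellformedc n \<and> checkc n"
    then obtain E where E: "n = code_entailment E" "restricted E" using wellformedc_iff by blast
    with w have "valid E" using checkc_iff by (cases E) blast
    with E show "n \<in> code_entailment ` {E. restricted E \<and> valid E}" by blast
  qed
  then show "dec (\<lambda>n. n \<in> code_entailment ` {E. restricted E \<and> valid E})"
    using dec_and[OF dec_wellformedc dec_checkc] by simp
qed

end
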